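(* Let $\tau\ge1$ be an integer, $c\in\mathbb{C}\setminus\{0\}$, let $a_0,\dots,a_\tau$ be complex constants with $a_\tau\neq 0$, and for a meromorphic function $f$ let $L_c(z,f)=\sum_{j=0}^{\tau}a_jf(z+jc)$. Let $f(z)$ be a transcendental meromorphic function on $\mathbb{C}$ with finite order, let $m$ and $n$ be two positive integers such that $m\ge(\tau+1)(n+2)+2$, let $p(z)$ be a meromorphic function satisfying $\overline{N}\left(r,\frac{1}{p(z)}\right)=S(r,f)$, and let $q(z)$ be a non-zero meromorphic function satisfying $T(r,q(z))=S(r,f)$. Then $f(z)$ is not a solution of the equation $$f^m(z)+q(z)\bigl(L_c(z,f)\bigr)^n=p(z).$$
   Context: $T(r,f)$ denotes the Nevanlinna characteristic of a meromorphic function $f$ on $\mathbb{C}$, and $\overline{N}(r,f)$ the integrated counting function of the poles of $f$ counted without multiplicity (so $\overline{N}(r,1/p)$ counts the distinct zeros of $p$). $S(r,f)$ denotes any quantity satisfying $S(r,f)=o(T(r,f))$ as $r\to\infty$, possibly outside a set of $r$ of finite logarithmic measure. The order of $f$ is $\rho(f)=\limsup_{r\to\infty}\frac{\log T(r,f)}{\log r}$.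
   Formalization: The formal theorem also assumes that L_c(z,f) is not identically zero; without this the claim fails, e.g. f=e^z, c=2πi, τ=1, a_0=-1, a_1=1, n=1, m=8, q=1, p=e^{8z}, where L_c(z,f)=0 and f^m=p. *)

theory Defs
  imports
    "HOL-Complex_Analysis.Complex_Analysis"
    "HOL-Library.Landau_Symbols"
    "HOL-Library.Liminf_Limsup"
begin

(* A meromorphic function on the complex plane is a function f with
   "f meromorphic_on UNIV". The library does not constrain the values of f at its poles (nor at
   a discrete set of other points), so identities between meromorphic functions are stated
   for all points outside a discrete closed set, i.e. with the cosparse quantifier. The quantities
   below depend only on the limiting behaviour of f at its poles and on its values outside
   a discrete closed set. *)

definition pole_count :: "(complex \<Rightarrow> complex) \<Rightarrow> real \<Rightarrow> nat" where
  "pole_count f t = (\<Sum>z | is_pole f z \<and> norm z \<le> t. nat (- zorder f z))"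

definition distinct_pole_count :: "(complex \<Rightarrow> complex) \<Rightarrow> real \<Rightarrow> nat" where
  "distinct_pole_count f t = card {z. is_pole f z \<and> norm z \<le> t}"

definition integrated_count :: "(real \<Rightarrow> nat) \<Rightarrow> real \<Rightarrow> real" where
  "integrated_count n r =
     integral {0..r} (\<lambda>t. (real (n t) - real (n 0)) / t) + real (n 0) * ln r"

definition nevanlinna_N :: "real \<Rightarrow> (complex \<Rightarrow> complex) \<Rightarrow> real" where
  "nevanlinna_N r f = integrated_count (pole_count f) r"

definition nevanlinna_Nbar :: "real \<Rightarrow> (complex \<Rightarrow> complex) \<Rightarrow> real" where
  "nevanlinna_Nbar r f = integrated_count (distinct_pole_count f) r"

(* As ln 0 = 0, the integrand is 0 where f vanishes, which agrees with the positive part of the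
   logarithm. *)
definition nevanlinna_m :: "real \<Rightarrow> (complex \<Rightarrow> complex) \<Rightarrow> real" where
  "nevanlinna_m r f =
     1 / (2 * pi) * integral {0..2 * pi} (\<lambda>\<theta>. max 0 (ln (norm (f (of_real r * cis \<theta>)))))"

definition nevanlinna_T :: "real \<Rightarrow> (complex \<Rightarrow> complex) \<Rightarrow> real" where
  "nevanlinna_T r f = nevanlinna_m r f + nevanlinna_N r f"

definition finite_log_measure :: "real set \<Rightarrow> bool" where
  "finite_log_measure E \<longleftrightarrow>
     E \<in> sets lebesgue \<and> E \<subseteq> {1..} \<and> (\<integral>\<^sup>+ r\<in>E. ennreal (1 / r) \<partial>lebesgue) < \<infinity>"

(* g(r) = S(r,f): the limit in the o-term is taken along r outside the exceptional set E. *)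
definition small_wrt :: "(real \<Rightarrow> real) \<Rightarrow> (complex \<Rightarrow> complex) \<Rightarrow> bool" where
  "small_wrt g f \<longleftrightarrow>
     (\<exists>E. finite_log_measure E \<and>
          g \<in> o[inf at_top (principal (- E))](\<lambda>r. nevanlinna_T r f))"

definition meromorphic_order :: "(complex \<Rightarrow> complex) \<Rightarrow> ereal" where
  "meromorphic_order f = Limsup at_top (\<lambda>r. ereal (ln (nevanlinna_T r f) / ln r))"

definition transcendental_meromorphic :: "(complex \<Rightarrow> complex) \<Rightarrow> bool" where
  "transcendental_meromorphic f \<longleftrightarrow>
     f meromorphic_on UNIV \<and>
     \<not> (\<exists>P Q :: complex poly. Q \<noteq> 0 \<and> (\<forall>\<^sub>\<approx>z\<in>UNIV. f z = poly P z / poly Q z))"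

(* This may vanish identically for non-trivial coefficients: for f = exp, c = 2 pi i it sends f to
   0 when the coefficients sum to 0. *)
definition shift_op ::
    "nat \<Rightarrow> (nat \<Rightarrow> complex) \<Rightarrow> complex \<Rightarrow> (complex \<Rightarrow> complex) \<Rightarrow> complex \<Rightarrow> complex" where
  "shift_op \<tau> a c f z = (\<Sum>j\<le>\<tau>. a j * f (z + of_nat j * c))"

end

(* Write f = g/h and q = q1/q2 with entire numerators and denominators without common zeros, and
   L_c(z,f) = X/Y with Y the product of the h(z + jc). Then A = g^m q2 Y^n and B = h^m q1 X^n are entire, and
   the equation says that A + B = p h^m q2 Y^n. By Jensen's formula, T(r,f) is, up to a constant, the mean D(r) of
   log max(|g|,|h|) over the circle of radius r. The truncated second main theorem for A + B, proved with the
   Wronskian of A and B and the lemma on the logarithmic derivative, bounds m D(r) by the counting function of the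
   distinct zeros of A, B and A + B, plus T(r,q), plus n times the mean of log max(|X|,|Y|). As zeros of h are zeros
   of Y, the distinct zeros cost at most one T(r,f) for g, plus the means of log |X| and log |Y|, plus o(T(r,f)).
   The mean of log max(|X|,|Y|) is at most tau + 1 translated means of log max(|g|,|h|), and each of these is at
   most (1 + eps) D(r + s) + O(1) by Harnack's inequality for the harmonic majorant of log max(|g|,|h|).
   As D has finite order, D(r + s) <= (1 + eps) D(r) for arbitrarily large r outside the exceptional sets, whence
   m <= (tau + 1)(n + 2) + 1. *)

theory Submission
  imports Defs "HOL-Real_Asymp.Real_Asymp"
begin

section \<open>Zeros of entire functions\<close>

text \<open>The mean of log max(|g|,|h|) is a continuous increasing stand-in for T(r,f), insensitive
  to the unconstrained values of \<open>f\<close> on a discrete set. The main obstacle is that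
  \<open>A\<close> and \<open>B\<close> may share zeros. No common divisor is removed: at every
  point the order of \<open>A\<close> or of \<open>B\<close> is at most that of q1 q2 X^n Y^n, and
  Jensen's formula for this product cancels the resulting loss, up to a constant, when max(|A|,|B|)
  is estimated from below. Finite order serves twice: it makes the error in the lemma on the
  logarithmic derivative O(log r) on every circle, without an exceptional set, and it keeps a
  translation from costing more than a factor close to 1. A single radius outside the exceptional
  sets of the two S(r,f) terms suffices for the contradiction. The hypothesis on m leaves a margin
  of 1, into which three error terms of a quarter of D(r) each fit.\<close>

definition entire_nz :: "(complex \<Rightarrow> complex) \<Rightarrow> bool" where
  "entire_nz F \<longleftrightarrow> F holomorphic_on UNIV \<and> (\<exists>z. F z \<noteq> 0)"

text \<open>The zero divisor of \<open>F\<close> as a function with natural values; being 0 off the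
  zeros by definition, it can be added to other divisors and summed without side conditions.\<close>

definition zord :: "(complex \<Rightarrow> complex) \<Rightarrow> complex \<Rightarrow> nat" where
  "zord F a = (if F a = 0 then nat (zorder F a) else 0)"

lemma zord_eq_0 [simp]: "F a \<noteq> 0 \<Longrightarrow> zord F a = 0"
  by (simp add: zord_def)

lemma zord_eqI:
  assumes F: "\<And>z. F z = (z - a) ^ n * G z" and G: "G holomorphic_on UNIV" and nz: "G a \<noteq> 0"
  shows "zord F a = n"
proof (cases n)
  case 0
  then show ?thesis using F[of a] nz by (simp add: zord_def)
next
  case (Suc k)
  have "zorder F a = int n"
    by (rule zorder_eqI[of UNIV _ G]) (use G nz F in \<open>auto simp: mult.commute power_int_def\<close>)
  moreover have "F a = 0" using F Suc by simp
  ultimately show ?thesis by (simp add: zord_def)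
qed

text \<open>The cofactor is entire, not merely local: F / (z - a)^n is holomorphic off
  \<open>a\<close>, and near \<open>a\<close> it agrees with the local cofactor
  \<open>zor_poly\<close>.\<close>

lemma zord_factorization:
  assumes "entire_nz F"
  obtains G where "G holomorphic_on UNIV" "G a \<noteq> 0" "\<And>z. F z = (z - a) ^ zord F a * G z"
proof -
  have hol: "F holomorphic_on UNIV" and nz: "\<exists>w\<in>UNIV. F w \<noteq> 0"
    using assms by (auto simp: entire_nz_def)
  define n where "n = zord F a"
  define g where "g = zor_poly F a"
  obtain r where r: "r > 0" "g holomorphic_on cball a r"
    and *: "\<forall>w\<in>cball a r. F w = g w * (w - a) ^ nat (zorder F a) \<and> g w \<noteq> 0"
    and o: "if F a = 0 then zorder F a > 0 else zorder F a = 0"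
    using zorder_exist_zero[OF hol open_UNIV connected_UNIV UNIV_I nz, of a]
    unfolding g_def[symmetric] by blast
  have n: "nat (zorder F a) = n"
    using o by (auto simp: n_def zord_def split: if_splits)
  define G where "G = (\<lambda>z. if z = a then g a else F z / (z - a) ^ n)"
  have Gg: "G z = g z" if "z \<in> ball a r" for z
    using that * n by (auto simp: G_def)
  have "G holomorphic_on (UNIV - {a})"
  proof (rule holomorphic_transform)
    show "(\<lambda>z. F z / (z - a) ^ n) holomorphic_on (UNIV - {a})"
      by (intro holomorphic_intros holomorphic_on_subset[OF hol]) auto
  qed (auto simp: G_def)
  moreover have "G holomorphic_on ball a r"
    by (rule holomorphic_transform[of g]) (use r Gg in \<open>auto intro: holomorphic_on_subset\<close>)
  ultimately have "G holomorphic_on ((UNIV - {a}) \<union> ball a r)"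
    by (intro holomorphic_on_Un) auto
  moreover have "(UNIV - {a}) \<union> ball a r = UNIV" using r by auto
  ultimately have "G holomorphic_on UNIV" by simp
  moreover have "G a \<noteq> 0" using * r by (auto simp: G_def)
  moreover have "F z = (z - a) ^ zord F a * G z" for z
  proof (cases "z = a")
    case True
    have "F a = g a * (a - a) ^ n" using * r n by auto
    then show ?thesis using True by (simp add: G_def n_def)
  next
    case False
    then show ?thesis by (simp add: G_def n_def)
  qed
  ultimately show thesis by (rule that)
qed

lemma entire_nz_holomorphic: "entire_nz F \<Longrightarrow> F holomorphic_on A"
  by (auto simp: entire_nz_def intro: holomorphic_on_subset)

lemma entire_nz_eventually:
  assumes "entire_nz F" shows "eventually (\<lambda>z. F z \<noteq> 0) (at a)"
proof -
  obtain w where "F w \<noteq> 0" using assms by (auto simp: entire_nz_def)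
  then have "\<forall>\<^sub>F w in at a. F w \<noteq> 0 \<and> w\<in>UNIV"
    using assms non_zero_neighbour_alt[of F UNIV a w] by (auto simp: entire_nz_def)
  then show ?thesis by simp
qed

lemma entire_nz_finite_zeros:
  assumes "entire_nz F" shows "finite {z. F z = 0 \<and> norm z \<le> r}"
proof (rule ccontr)
  assume inf: "infinite {z. F z = 0 \<and> norm z \<le> r}"
  have "{z. F z = 0 \<and> norm z \<le> r} \<subseteq> cball 0 r" by auto
  then obtain a where "a islimpt {z. F z = 0 \<and> norm z \<le> r}"
    using Heine_Borel_imp_Bolzano_Weierstrass[OF compact_cball inf] by blast
  then have "frequently (\<lambda>z. F z = 0) (at a)"
    by (auto simp: islimpt_conv_frequently_at elim: frequently_elim1)
  then show False using entire_nz_eventually[OF assms, of a] by (simp add: frequently_def)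
qed

lemma entire_nz_mult:
  assumes "entire_nz F" "entire_nz G" shows "entire_nz (\<lambda>z. F z * G z)"
proof -
  have "eventually (\<lambda>z. F z * G z \<noteq> 0) (at 0)"
    using entire_nz_eventually[OF assms(1), of 0] entire_nz_eventually[OF assms(2), of 0]
    by eventually_elim auto
  then have "\<exists>z. F z * G z \<noteq> 0"
    using eventually_happens[of _ "at (0::complex)"] by (auto simp: trivial_limit_at)
  with assms show ?thesis by (auto simp: entire_nz_def intro!: holomorphic_intros)
qed

lemma entire_nz_const [simp]: "entire_nz (\<lambda>_. c) \<longleftrightarrow> c \<noteq> 0"
  by (auto simp: entire_nz_def)

lemma entire_nz_power:
  assumes "entire_nz F" shows "entire_nz (\<lambda>z. F z ^ n)"
  using assms by (auto simp: entire_nz_def intro!: holomorphic_intros)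

lemma entire_nz_prod:
  assumes "\<And>i. i \<in> I \<Longrightarrow> entire_nz (F i)" shows "entire_nz (\<lambda>z. \<Prod>i\<in>I. F i z)"
  using assms by (induction I rule: infinite_finite_induct) (auto intro: entire_nz_mult)

lemma entire_nz_linear [simp]: "entire_nz (\<lambda>z. z - a)"
  unfolding entire_nz_def by (intro conjI holomorphic_intros exI[of _ "a + 1"]) simp

lemma entire_nz_shift:
  assumes "entire_nz F" shows "entire_nz (\<lambda>z. F (z + c))"
proof -
  obtain w where "F w \<noteq> 0" using assms by (auto simp: entire_nz_def)
  then have "F ((w - c) + c) \<noteq> 0" by simp
  moreover have "(F \<circ> (\<lambda>z. z + c)) holomorphic_on UNIV"
    by (rule holomorphic_on_compose[OF _ entire_nz_holomorphic[OF assms]]) (intro holomorphic_intros)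
  ultimately show ?thesis unfolding entire_nz_def comp_def by blast
qed

lemma zord_mult:
  assumes "entire_nz F" "entire_nz G" shows "zord (\<lambda>z. F z * G z) a = zord F a + zord G a"
proof -
  obtain F1 where F: "F1 holomorphic_on UNIV" "F1 a \<noteq> 0" "\<And>z. F z = (z - a) ^ zord F a * F1 z"
    using zord_factorization[OF assms(1)] by metis
  obtain G1 where G: "G1 holomorphic_on UNIV" "G1 a \<noteq> 0" "\<And>z. G z = (z - a) ^ zord G a * G1 z"
    using zord_factorization[OF assms(2)] by metis
  show ?thesis
    by (rule zord_eqI[where G = "\<lambda>z. F1 z * G1 z"])
      (use F(1,2) G(1,2) in \<open>auto simp: F(3) G(3) power_add intro!: holomorphic_intros\<close>)
qed

lemma zord_power:
  assumes "entire_nz F" shows "zord (\<lambda>z. F z ^ n) a = n * zord F a"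
  using assms by (induction n) (auto simp: zord_mult entire_nz_power)

lemma zord_pos_iff:
  assumes "entire_nz F" shows "zord F a > 0 \<longleftrightarrow> F a = 0"
proof
  assume "F a = 0"
  obtain G where G: "G a \<noteq> 0" "\<And>z. F z = (z - a) ^ zord F a * G z"
    using zord_factorization[OF assms] by metis
  show "zord F a > 0"
  proof (rule ccontr)
    assume "\<not> ?thesis"
    then have "F a = G a" using G(2)[of a] by simp
    with G \<open>F a = 0\<close> show False by simp
  qed
next
  assume "zord F a > 0"
  then show "F a = 0" using zord_eq_0[of F a] by (cases "F a = 0") auto
qed

lemma zord_ge:
  assumes "entire_nz F" "G holomorphic_on UNIV" "\<And>z. F z = (z - a) ^ n * G z"
  shows "n \<le> zord F a"
proof -
  have "entire_nz G" using assms by (auto simp: entire_nz_def)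
  moreover have "entire_nz (\<lambda>z. (z - a) ^ n)"
    by (simp add: entire_nz_power)
  moreover have "zord (\<lambda>z. (z - a) ^ n) a = n"
    by (rule zord_eqI[OF mult_1_right[symmetric]]) simp_all
  ultimately have "zord (\<lambda>z. (z - a) ^ n * G z) a = n + zord G a"
    by (simp add: zord_mult)
  moreover have "F = (\<lambda>z. (z - a) ^ n * G z)" using assms by auto
  ultimately show ?thesis by simp
qed

lemma zord_minus: "zord (\<lambda>z. - F z) a = zord F a"
  by (simp add: zord_def)

text \<open>With A = (z - a)^k A1 and B = (z - a)^l B1, each term of the Wronskian contains one
  derivative, which lowers the total order k + l by at most one. This single loss per point is the
  source of truncated counting.\<close>

lemma zord_wronskian_ge:
  assumes A: "entire_nz A" and B: "entire_nz B"
    and W: "entire_nz (\<lambda>z. A z * deriv B z - deriv A z * B z)"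
  shows "zord A a + zord B a \<le> Suc (zord (\<lambda>z. A z * deriv B z - deriv A z * B z) a)"
proof (cases "zord A a + zord B a")
  case (Suc n)
  define k l where "k = zord A a" and "l = zord B a"
  obtain A1 where A1: "A1 holomorphic_on UNIV" "\<And>z. A z = (z - a) ^ k * A1 z"
    using zord_factorization[OF A] unfolding k_def by metis
  obtain B1 where B1: "B1 holomorphic_on UNIV" "\<And>z. B z = (z - a) ^ l * B1 z"
    using zord_factorization[OF B] unfolding l_def by metis
  have dA: "deriv A z = of_nat k * (z - a) ^ (k - 1) * A1 z + (z - a) ^ k * deriv A1 z" for z
  proof (rule DERIV_imp_deriv)
    have "(A1 has_field_derivative deriv A1 z) (at z)"
      using A1(1) by (simp add: holomorphic_derivI)
    then have "((\<lambda>z. (z - a) ^ k * A1 z) has_field_derivative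
        of_nat k * (z - a) ^ (k - 1) * A1 z + (z - a) ^ k * deriv A1 z) (at z)"
      by (auto intro!: derivative_eq_intros)
    moreover have "A = (\<lambda>z. (z - a) ^ k * A1 z)" using A1(2) by auto
    ultimately show "(A has_field_derivative
        of_nat k * (z - a) ^ (k - 1) * A1 z + (z - a) ^ k * deriv A1 z) (at z)" by simp
  qed
  have dB: "deriv B z = of_nat l * (z - a) ^ (l - 1) * B1 z + (z - a) ^ l * deriv B1 z" for z
  proof (rule DERIV_imp_deriv)
    have "(B1 has_field_derivative deriv B1 z) (at z)"
      using B1(1) by (simp add: holomorphic_derivI)
    then have "((\<lambda>z. (z - a) ^ l * B1 z) has_field_derivative
        of_nat l * (z - a) ^ (l - 1) * B1 z + (z - a) ^ l * deriv B1 z) (at z)"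
      by (auto intro!: derivative_eq_intros)
    moreover have "B = (\<lambda>z. (z - a) ^ l * B1 z)" using B1(2) by auto
    ultimately show "(B has_field_derivative
        of_nat l * (z - a) ^ (l - 1) * B1 z + (z - a) ^ l * deriv B1 z) (at z)" by simp
  qed
  have kl: "k + l = Suc n" using Suc by (simp add: k_def l_def)
  define V where "V = (\<lambda>z. (of_nat l - of_nat k) * A1 z * B1 z
      + (z - a) * (A1 z * deriv B1 z - deriv A1 z * B1 z))"
  have "n \<le> zord (\<lambda>z. A z * deriv B z - deriv A z * B z) a"
  proof (rule zord_ge[OF W, of V])
    show "V holomorphic_on UNIV" unfolding V_def
      using A1(1) B1(1) by (intro holomorphic_intros) auto
    fix z
    \<comment> \<open>Natural subtraction truncates \<open>k - 1\<close> at \<open>k = 0\<close>,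
      but the coefficient is 0 in that case; likewise for \<open>l\<close> below.\<close>
    have 1: "of_nat k * (z - a) ^ (k - 1) * (z - a) ^ l = of_nat k * (z - a) ^ n"
      using kl by (cases k) (auto simp flip: power_add)
    have 2: "(z - a) ^ k * (of_nat l * (z - a) ^ (l - 1)) = of_nat l * (z - a) ^ n"
      using kl by (cases l) (auto simp flip: power_add)
    have 3: "(z - a) ^ k * (z - a) ^ l = (z - a) ^ n * (z - a)"
      using kl by (metis power_Suc2 power_add)
    have "A z * deriv B z - deriv A z * B z =
        ((z - a) ^ k * (of_nat l * (z - a) ^ (l - 1))) * (A1 z * B1 z)
        - (of_nat k * (z - a) ^ (k - 1) * (z - a) ^ l) * (A1 z * B1 z)
        + ((z - a) ^ k * (z - a) ^ l) * (A1 z * deriv B1 z - deriv A1 z * B1 z)"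
      unfolding A1(2)[of z] B1(2)[of z] dA dB by (simp add: algebra_simps)
    also have "\<dots> = (z - a) ^ n * V z"
      unfolding 1 2 3 V_def by (simp add: algebra_simps)
    finally show "A z * deriv B z - deriv A z * B z = (z - a) ^ n * V z" .
  qed
  then show ?thesis using Suc by simp
qed simp

text \<open>Only finitely many zeros matter on a disc, so finite products replace Weierstrass
  products. A new point is not a root of the factors already split off, hence its order in the
  cofactor is its order in \<open>F\<close>.\<close>

lemma entire_nz_divide_zeros:
  assumes F: "entire_nz F" and "finite Z"
  obtains G where "entire_nz G" "\<And>z. F z = (\<Prod>a\<in>Z. (z - a) ^ zord F a) * G z"
    "\<And>a. a \<in> Z \<Longrightarrow> G a \<noteq> 0"
proof -
  have "\<exists>G. entire_nz G \<and> (\<forall>z. F z = (\<Prod>a\<in>Z. (z - a) ^ zord F a) * G z) \<and> (\<forall>a\<in>Z. G a \<noteq> 0)"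
    using \<open>finite Z\<close>
  proof (induction Z)
    case empty
    then show ?case using F by auto
  next
    case (insert b Z)
    then obtain G where G: "entire_nz G" "\<And>z. F z = (\<Prod>a\<in>Z. (z - a) ^ zord F a) * G z"
      "\<And>a. a \<in> Z \<Longrightarrow> G a \<noteq> 0" by auto
    have P: "entire_nz (\<lambda>z. \<Prod>a\<in>Z. (z - a) ^ zord F a)"
      by (intro entire_nz_prod entire_nz_power entire_nz_linear)
    have "(\<Prod>a\<in>Z. (b - a) ^ zord F a) \<noteq> 0" using insert by auto
    then have "zord (\<lambda>z. (\<Prod>a\<in>Z. (z - a) ^ zord F a) * G z) b = zord G b"
      by (subst zord_mult[OF P G(1)]) auto
    moreover have "F = (\<lambda>z. (\<Prod>a\<in>Z. (z - a) ^ zord F a) * G z)" using G(2) by auto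
    ultimately have z: "zord F b = zord G b" by simp
    obtain H where H: "H holomorphic_on UNIV" "H b \<noteq> 0" "\<And>z. G z = (z - b) ^ zord G b * H z"
      using zord_factorization[OF G(1)] by metis
    have "H a \<noteq> 0" if "a \<in> insert b Z" for a
      using that H(2,3) G(3) by auto
    moreover have "F z = (\<Prod>a\<in>insert b Z. (z - a) ^ zord F a) * H z" for z
      using insert G(2)[of z] H(3)[of z] z by simp
    moreover have "entire_nz H" using H by (auto simp: entire_nz_def)
    ultimately show ?case by blast
  qed
  then show thesis using that by auto
qed

lemma holomorphic_log_ball:
  assumes "G holomorphic_on ball 0 R" "\<And>z. z \<in> ball 0 R \<Longrightarrow> G z \<noteq> 0"
  obtains k where "k holomorphic_on ball 0 R" "\<And>z. z \<in> ball 0 R \<Longrightarrow> G z = exp (k z)"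
proof -
  have "\<exists>g. g holomorphic_on ball 0 R \<and> (\<forall>z\<in>ball 0 R. G z = exp (g z))"
    using contractible_imp_holomorphic_log[OF assms(1)
        convex_imp_contractible[OF convex_ball] assms(2)] by metis
  then show thesis using that by auto
qed

text \<open>Cauchy's formula on the circle of radius \<open>R\<close> needs a logarithm on a larger
  open disc. There are finitely many zeros of modulus at most \<open>R + 1\<close>, so the least of
  their moduli and of \<open>R + 1\<close> is such a radius.\<close>

lemma entire_nz_nonzero_cball_imp_ball:
  assumes "entire_nz U" "\<And>z. norm z \<le> R \<Longrightarrow> U z \<noteq> 0"
  obtains R' where "R' > R" "\<And>z. norm z < R' \<Longrightarrow> U z \<noteq> 0"
proof -
  let ?Z = "{z. U z = 0 \<and> norm z \<le> R + 1}"
  have fin: "finite (norm ` ?Z)" using entire_nz_finite_zeros[OF assms(1)] by simp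
  define R' where "R' = Min (insert (R + 1) (norm ` ?Z))"
  have "R < R'" unfolding R'_def using fin assms(2) by (subst Min_gr_iff) (auto simp: not_le[symmetric])
  moreover have "U z \<noteq> 0" if "norm z < R'" for z
  proof
    assume "U z = 0"
    have "R' \<le> R + 1" using fin by (simp add: R'_def)
    then have "norm z \<in> norm ` ?Z" using that \<open>U z = 0\<close> by auto
    then have "R' \<le> norm z" using fin by (auto simp: R'_def)
    with that show False by simp
  qed
  ultimately show thesis using that by blast
qed

lemma entire_nz_no_zeros_on_circle:
  assumes "finite I" "\<And>i. i \<in> I \<Longrightarrow> entire_nz (F i)" "a < b"
  obtains R where "a < R" "R < b" "\<And>i z. i \<in> I \<Longrightarrow> norm z = R \<Longrightarrow> F i z \<noteq> 0"
proof -
  let ?S = "norm ` (\<Union>i\<in>I. {z. F i z = 0 \<and> norm z \<le> b})"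
  have "finite ?S" using assms entire_nz_finite_zeros by auto
  then have "\<not> {a<..<b} \<subseteq> ?S"
    using assms(3) infinite_Ioo finite_subset by blast
  then obtain R where R: "a < R" "R < b" "R \<notin> ?S"
    unfolding subset_iff greaterThanLessThan_iff by blast
  then show thesis using that[of R] by force
qed

section \<open>Circle means and the Poisson kernel\<close>

text \<open>Absolute integrability, so that maxima and absolute values of integrable functions
  remain integrable.\<close>

definition circ_int :: "real \<Rightarrow> (complex \<Rightarrow> real) \<Rightarrow> bool" where
  "circ_int r \<phi> \<longleftrightarrow> (\<lambda>t. \<phi> (of_real r * cis t)) absolutely_integrable_on {0..2*pi}"

definition circ_mean :: "real \<Rightarrow> (complex \<Rightarrow> real) \<Rightarrow> real" where
  "circ_mean r \<phi> = integral {0..2*pi} (\<lambda>t. \<phi> (of_real r * cis t)) / (2 * pi)"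

lemma circ_int_imp_integrable:
  "circ_int r \<phi> \<Longrightarrow> (\<lambda>t. \<phi> (of_real r * cis t)) integrable_on {0..2*pi}"
  by (auto simp: circ_int_def absolutely_integrable_on_def)

lemma circ_int_add:
  assumes "circ_int r \<phi>" "circ_int r \<psi>" shows "circ_int r (\<lambda>z. \<phi> z + \<psi> z)"
  using assms unfolding circ_int_def by simp

lemma circ_int_diff:
  assumes "circ_int r \<phi>" "circ_int r \<psi>" shows "circ_int r (\<lambda>z. \<phi> z - \<psi> z)"
  using assms unfolding circ_int_def by simp

lemma circ_int_cmult:
  assumes "circ_int r \<phi>" shows "circ_int r (\<lambda>z. c * \<phi> z)"
  using absolutely_integrable_scaleR_left[OF assms[unfolded circ_int_def], of c]
  unfolding circ_int_def by simp

lemma circ_int_const [simp]: "circ_int r (\<lambda>_. c)"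
  by (simp add: circ_int_def)

lemma circ_int_max:
  assumes "circ_int r \<phi>" "circ_int r \<psi>" shows "circ_int r (\<lambda>z. max (\<phi> z) (\<psi> z))"
  using absolutely_integrable_max_1 assms unfolding circ_int_def by blast

lemma circ_int_abs:
  assumes "circ_int r \<phi>" shows "circ_int r (\<lambda>z. \<bar>\<phi> z\<bar>)"
  using absolutely_integrable_norm[OF assms[unfolded circ_int_def]]
  unfolding circ_int_def by (simp add: o_def)

lemma circ_int_sum:
  assumes "\<And>i. i \<in> I \<Longrightarrow> circ_int r (\<phi> i)" shows "circ_int r (\<lambda>z. \<Sum>i\<in>I. \<phi> i z)"
  using assms by (induction I rule: infinite_finite_induct) (auto intro: circ_int_add)

lemma circ_int_continuous:
  assumes "continuous_on UNIV \<phi>" shows "circ_int r \<phi>"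
  unfolding circ_int_def
  by (intro absolutely_integrable_continuous_real continuous_on_compose2[OF assms] continuous_intros) auto

lemma circ_mean_add:
  assumes "circ_int r \<phi>" "circ_int r \<psi>"
  shows "circ_mean r (\<lambda>z. \<phi> z + \<psi> z) = circ_mean r \<phi> + circ_mean r \<psi>"
  using assms[THEN circ_int_imp_integrable]
  by (simp add: circ_mean_def integral_add add_divide_distrib)

lemma circ_mean_diff:
  assumes "circ_int r \<phi>" "circ_int r \<psi>"
  shows "circ_mean r (\<lambda>z. \<phi> z - \<psi> z) = circ_mean r \<phi> - circ_mean r \<psi>"
  using assms[THEN circ_int_imp_integrable]
  by (simp add: circ_mean_def integral_diff diff_divide_distrib)

lemma circ_mean_cmult: "circ_mean r (\<lambda>z. c * \<phi> z) = c * circ_mean r \<phi>"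
  by (simp add: circ_mean_def)

lemma circ_mean_const [simp]: "circ_mean r (\<lambda>_. c) = c"
  by (simp add: circ_mean_def)

lemma circ_mean_sum:
  assumes "\<And>i. i \<in> I \<Longrightarrow> circ_int r (\<phi> i)"
  shows "circ_mean r (\<lambda>z. \<Sum>i\<in>I. \<phi> i z) = (\<Sum>i\<in>I. circ_mean r (\<phi> i))"
  using assms
  by (induction I rule: infinite_finite_induct) (auto simp: circ_mean_add circ_int_sum)

lemma finite_cis_vimage:
  assumes "r > 0" "finite S" shows "finite {t \<in> {0..2*pi}. of_real r * cis t \<in> S}"
proof -
  have "finite {t \<in> {0..2*pi}. of_real r * cis t = z}" for z
  proof (cases "\<exists>t\<in>{0..2*pi}. of_real r * cis t = z")
    case True
    then obtain s where s: "s \<in> {0..2*pi}" "of_real r * cis s = z" by blast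
    have "{t \<in> {0..2*pi}. of_real r * cis t = z} \<subseteq> {s - 2*pi, s, s + 2*pi}"
    proof (rule subsetI)
      fix t assume "t \<in> {t \<in> {0..2*pi}. of_real r * cis t = z}"
      then have t: "t \<in> {0..2*pi}" "of_real r * cis t = z" by auto
      then have "of_real r * cis t = of_real r * cis s" using s by simp
      then have "cis t = cis s" using assms by simp
      then have "sin t = sin s \<and> cos t = cos s" by (simp add: cis.ctr)
      then obtain n :: int where n: "t = s + 2 * pi * n" using sin_cos_eq_iff by blast
      have "\<bar>2 * pi * n\<bar> \<le> 2 * pi * 1" using n s t by auto
      then have "\<bar>real_of_int n\<bar> \<le> 1" by (simp add: abs_mult)
      then have "n = -1 \<or> n = 0 \<or> n = 1" by linarith
      then show "t \<in> {s - 2*pi, s, s + 2*pi}" using n by auto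
    qed
    then show ?thesis using finite_subset by blast
  next
    case False
    then have e: "{t \<in> {0..2*pi}. of_real r * cis t = z} = {}" by blast
    show ?thesis unfolding e by simp
  qed
  moreover have "{t \<in> {0..2*pi}. of_real r * cis t \<in> S} = (\<Union>z\<in>S. {t \<in> {0..2*pi}. of_real r * cis t = z})"
    by auto
  ultimately show ?thesis using assms(2) by simp
qed

lemma circ_int_spike:
  assumes "r > 0" "circ_int r \<phi>" "finite S" "\<And>z. norm z = r \<Longrightarrow> z \<notin> S \<Longrightarrow> \<psi> z = \<phi> z"
  shows "circ_int r \<psi>"
  unfolding circ_int_def
proof (rule absolutely_integrable_spike)
  show "(\<lambda>t. \<phi> (of_real r * cis t)) absolutely_integrable_on {0..2*pi}"
    using assms(2) by (simp add: circ_int_def)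
  show "negligible {t \<in> {0..2*pi}. of_real r * cis t \<in> S}"
    using finite_cis_vimage[OF assms(1,3)] by (rule negligible_finite)
qed (use assms in \<open>auto simp: norm_mult\<close>)

lemma circ_mean_spike:
  assumes "r > 0" "finite S" "\<And>z. norm z = r \<Longrightarrow> z \<notin> S \<Longrightarrow> \<psi> z = \<phi> z"
  shows "circ_mean r \<psi> = circ_mean r \<phi>"
proof -
  have "integral {0..2*pi} (\<lambda>t. \<psi> (of_real r * cis t)) = integral {0..2*pi} (\<lambda>t. \<phi> (of_real r * cis t))"
  proof (rule integral_spike)
    show "negligible {t \<in> {0..2*pi}. of_real r * cis t \<in> S}"
      using finite_cis_vimage[OF assms(1,2)] by (rule negligible_finite)
  qed (use assms in \<open>auto simp: norm_mult\<close>)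
  then show ?thesis by (simp add: circ_mean_def)
qed

lemma circ_mean_mono:
  assumes "r > 0" "circ_int r \<phi>" "circ_int r \<psi>" "finite S"
    and "\<And>z. norm z = r \<Longrightarrow> z \<notin> S \<Longrightarrow> \<phi> z \<le> \<psi> z"
  shows "circ_mean r \<phi> \<le> circ_mean r \<psi>"
proof -
  have \<psi>: "circ_int r (\<lambda>z. if z \<in> S then \<phi> z else \<psi> z)"
    by (rule circ_int_spike[OF assms(1,3,4)]) auto
  have "circ_mean r \<psi> = circ_mean r (\<lambda>z. if z \<in> S then \<phi> z else \<psi> z)"
    by (rule circ_mean_spike[OF assms(1,4)]) auto
  moreover have "integral {0..2*pi} (\<lambda>t. \<phi> (of_real r * cis t)) \<le>
      integral {0..2*pi} (\<lambda>t. if of_real r * cis t \<in> S then \<phi> (of_real r * cis t) else \<psi> (of_real r * cis t))"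
    by (rule integral_le) (use circ_int_imp_integrable[OF \<psi>] circ_int_imp_integrable[OF assms(2)] assms in
        \<open>auto simp: norm_mult\<close>)
  ultimately show ?thesis by (simp add: circ_mean_def divide_right_mono)
qed

section \<open>Cauchy's theorem and formulas as integrals over the angle\<close>

lemma has_integral_circle_Cauchy:
  fixes g :: "complex \<Rightarrow> complex"
  assumes "g holomorphic_on ball 0 R'" "0 < R" "R < R'"
  shows "((\<lambda>t. g (of_real R * cis t) * (of_real R * cis t)) has_integral 0) {0..2*pi}"
proof -
  have "(g has_contour_integral 0) (circlepath 0 R)"
    by (rule Cauchy_theorem_disc_simple[OF assms(1)]) (use assms in auto)
  then have "((\<lambda>t. g (0 + of_real R * cis t) * of_real R * \<i> * cis t) has_integral 0) {0..2*pi}"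
    unfolding circlepath_def by (subst (asm) has_contour_integral_part_circlepath_iff) auto
  then have "((\<lambda>t. (g (0 + of_real R * cis t) * of_real R * \<i> * cis t) * (- \<i>)) has_integral 0 * (- \<i>)) {0..2*pi}"
    by (rule has_integral_mult_left)
  then show ?thesis by (simp add: algebra_simps)
qed

lemma has_integral_circle_Cauchy_formula:
  fixes g :: "complex \<Rightarrow> complex"
  assumes "g holomorphic_on ball 0 R'" "R < R'" "norm z < R"
  shows "((\<lambda>t. g (of_real R * cis t) * (of_real R * cis t / (of_real R * cis t - z)))
           has_integral 2 * pi * g z) {0..2*pi}"
proof -
  have "((\<lambda>u. g u / (u - z)) has_contour_integral (2 * of_real pi * \<i> * g z)) (circlepath 0 R)"
    by (rule Cauchy_integral_circlepath_simple) (use assms in \<open>auto intro!: holomorphic_on_subset[OF assms(1)]\<close>)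
  then have "((\<lambda>t. g (0 + of_real R * cis t) / (0 + of_real R * cis t - z) * of_real R * \<i> * cis t)
      has_integral (2 * of_real pi * \<i> * g z)) {0..2*pi}"
    unfolding circlepath_def by (subst (asm) has_contour_integral_part_circlepath_iff) auto
  then have "((\<lambda>t. (g (0 + of_real R * cis t) / (0 + of_real R * cis t - z) * of_real R * \<i> * cis t) * (- \<i>))
      has_integral (2 * of_real pi * \<i> * g z) * (- \<i>)) {0..2*pi}"
    by (rule has_integral_mult_left)
  then show ?thesis by (simp add: algebra_simps)
qed

lemma has_integral_circle_Cauchy_deriv:
  fixes g :: "complex \<Rightarrow> complex"
  assumes "g holomorphic_on ball 0 R'" "R < R'" "norm z < R"
  shows "((\<lambda>t. g (of_real R * cis t) * (of_real R * cis t / (of_real R * cis t - z)\<^sup>2))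
           has_integral 2 * pi * deriv g z) {0..2*pi}"
proof -
  have sub: "cball 0 R \<subseteq> ball 0 R'" using assms by auto
  have c: "continuous_on (cball 0 R) g"
    using holomorphic_on_subset[OF assms(1) sub] holomorphic_on_imp_continuous_on by blast
  have h: "g holomorphic_on ball 0 R"
    by (rule holomorphic_on_subset[OF assms(1) order_trans[OF ball_subset_cball sub]])
  have z: "z \<in> ball 0 R" using assms by simp
  define I where "I = contour_integral (circlepath 0 R) (\<lambda>u. g u / (u - z)\<^sup>2)"
  have "deriv g z = 1 / (2 * of_real pi * \<i>) * I"
    unfolding I_def by (rule DERIV_imp_deriv[OF Cauchy_derivative_integral_circlepath(2)[OF c h z]])
  then have I: "I = 2 * of_real pi * \<i> * deriv g z" by simp
  have "((\<lambda>u. g u / (u - z)\<^sup>2) has_contour_integral I) (circlepath 0 R)"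
    unfolding I_def
    by (rule has_contour_integral_integral[OF Cauchy_derivative_integral_circlepath(1)[OF c h z]])
  then have "((\<lambda>t. g (0 + of_real R * cis t) / (0 + of_real R * cis t - z)\<^sup>2 * of_real R * \<i> * cis t)
      has_integral I) {0..2*pi}"
    unfolding circlepath_def by (subst (asm) has_contour_integral_part_circlepath_iff) auto
  then have "((\<lambda>t. (g (0 + of_real R * cis t) / (0 + of_real R * cis t - z)\<^sup>2 * of_real R * \<i> * cis t) * (- \<i>))
      has_integral I * (- \<i>)) {0..2*pi}"
    by (rule has_integral_mult_left)
  then show ?thesis by (simp add: algebra_simps I)
qed

section \<open>The Poisson kernel and derivative estimates from the real part\<close>

definition poisson :: "real \<Rightarrow> real \<Rightarrow> complex \<Rightarrow> real" where
  "poisson R t z = Re ((of_real R * cis t + z) / (of_real R * cis t - z))"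

lemma circle_ne: "norm z < R \<Longrightarrow> of_real R * cis t \<noteq> z"
  using norm_mult[of "of_real R" "cis t"] by auto

lemma poisson_eq:
  assumes "norm z < R"
  shows "poisson R t z = (R\<^sup>2 - (norm z)\<^sup>2) / (norm (of_real R * cis t - z))\<^sup>2"
proof -
  define w where "w = of_real R * cis t"
  have w: "norm w = R" using assms norm_ge_zero[of z] by (auto simp: w_def norm_mult simp del: norm_ge_zero)
  have "Re ((w + z) / (w - z)) = Re ((w + z) * cnj (w - z)) / (norm (w - z))\<^sup>2"
    unfolding complex_div_cnj[of "w + z" "w - z"] of_real_power[symmetric] Re_divide_of_real ..
  also have "Re ((w + z) * cnj (w - z)) = (norm w)\<^sup>2 - (norm z)\<^sup>2"
    unfolding cmod_power2 by (simp add: algebra_simps power2_eq_square)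
  finally show ?thesis unfolding poisson_def w_def[symmetric] w by simp
qed

lemma poisson_nonneg: "norm z < R \<Longrightarrow> poisson R t z \<ge> 0"
  by (subst poisson_eq) (auto intro!: divide_nonneg_nonneg simp: power_mono less_imp_le)

lemma poisson_le:
  assumes "norm z < R" shows "poisson R t z \<le> (R + norm z) / (R - norm z)"
proof -
  have "R - norm z \<le> norm (of_real R * cis t - z)"
    using norm_triangle_ineq2[of "of_real R * cis t" z] assms by (simp add: norm_mult)
  then have "(R - norm z)\<^sup>2 \<le> (norm (of_real R * cis t - z))\<^sup>2"
    using assms by (intro power_mono) auto
  then have "poisson R t z \<le> (R\<^sup>2 - (norm z)\<^sup>2) / (R - norm z)\<^sup>2"
    using assms by (subst poisson_eq[OF assms]) (auto intro!: divide_left_mono mult_pos_pos simp: power_mono less_imp_le circle_ne)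
  also have "\<dots> = (R + norm z) / (R - norm z)"
    using assms by (simp add: power2_eq_square square_diff_square_factored)
  finally show ?thesis .
qed

lemma poisson_0: "R > 0 \<Longrightarrow> poisson R t 0 = 1"
  by (simp add: poisson_def)

text \<open>The expression vanishes only at the reflection R^2 / conj(z) of \<open>z\<close> in the
  circle, which lies outside the closed disc. Kernels with this denominator are therefore
  holomorphic slightly beyond the circle.\<close>

lemma reflected_point_outside:
  assumes z: "norm z < R" and R: "R < R'"
  obtains R'' where "R < R''" "R'' \<le> R'" "\<And>w. norm w < R'' \<Longrightarrow> of_real (R\<^sup>2) - cnj z * w \<noteq> 0"
proof -
  define R'' where "R'' = (if z = 0 then R' else min R' (R\<^sup>2 / norm z))"
  have R0: "R > 0" using z norm_ge_zero[of z] by linarith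
  have R'': "R < R''" "R'' \<le> R'" using R z R0 by (auto simp: R''_def field_simps power2_eq_square)
  have ne: "of_real (R\<^sup>2) - cnj z * w \<noteq> 0" if "norm w < R''" for w
  proof
    assume "of_real (R\<^sup>2) - cnj z * w = 0"
    then have "of_real (R\<^sup>2) = cnj z * w" by simp
    then have "norm (complex_of_real (R\<^sup>2)) = norm (cnj z * w)" by (rule arg_cong)
    then have eq: "R\<^sup>2 = norm z * norm w" using R0 by (simp only: norm_of_real norm_mult complex_mod_cnj) simp
    show False
    proof (cases "z = 0")
      case False
      then have "norm w < R\<^sup>2 / norm z" using that by (simp add: R''_def)
      then show False using eq False by (simp add: field_simps)
    qed (use eq R0 in auto)
  qed
  from R'' ne show thesis by (rule that)
qed

text \<open>On the circle, the kernel with the reflected pole is the conjugate of z / (w - z). By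
  Cauchy's theorem its integral against \<open>k\<close> is 0, and adding it to Cauchy's formula
  turns the kernel w / (w - z) into the real Poisson kernel, so that real parts can be
  taken.\<close>

lemma has_integral_poisson:
  fixes k :: "complex \<Rightarrow> complex"
  assumes k: "k holomorphic_on ball 0 R'" and R: "R < R'" and z: "norm z < R"
  shows "((\<lambda>t. Re (k (of_real R * cis t)) * poisson R t z) has_integral 2 * pi * Re (k z)) {0..2*pi}"
proof -
  have R0: "R > 0" using z norm_ge_zero[of z] by linarith
  obtain R'' where R'': "R < R''" "R'' \<le> R'"
    and ne: "\<And>w. norm w < R'' \<Longrightarrow> of_real (R\<^sup>2) - cnj z * w \<noteq> 0"
    using reflected_point_outside[OF z R] by metis
  have "(\<lambda>w. k w * (cnj z / (of_real (R\<^sup>2) - cnj z * w))) holomorphic_on ball 0 R''"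
    by (intro holomorphic_intros holomorphic_on_subset[OF k]) (use ne R'' in auto)
  from has_integral_circle_Cauchy[OF this R0 R''(1)]
  have 1: "((\<lambda>t. k (of_real R * cis t) * (cnj z / (of_real (R\<^sup>2) - cnj z * (of_real R * cis t))) * (of_real R * cis t))
      has_integral 0) {0..2*pi}" .
  have 2: "((\<lambda>t. k (of_real R * cis t) * (of_real R * cis t / (of_real R * cis t - z)))
           has_integral 2 * pi * k z) {0..2*pi}"
    by (rule has_integral_circle_Cauchy_formula[OF k R z])
  have "((\<lambda>t. Re (k (of_real R * cis t) * (of_real R * cis t / (of_real R * cis t - z)) +
      k (of_real R * cis t) * (cnj z / (of_real (R\<^sup>2) - cnj z * (of_real R * cis t))) * (of_real R * cis t)))
       has_integral Re (2 * pi * k z + 0)) {0..2*pi}"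
    by (intro has_integral_Re has_integral_add 1 2)
  moreover have "Re (k (of_real R * cis t) * (of_real R * cis t / (of_real R * cis t - z)) +
      k (of_real R * cis t) * (cnj z / (of_real (R\<^sup>2) - cnj z * (of_real R * cis t))) * (of_real R * cis t))
      = Re (k (of_real R * cis t)) * poisson R t z" for t
  proof -
    define w where "w = of_real R * cis t"
    have w: "norm w = R" using R0 by (auto simp: w_def norm_mult)
    have wz: "w \<noteq> z" "cnj w \<noteq> cnj z" using w z by auto
    have w0: "w \<noteq> 0" using w R0 by auto
    have RR: "of_real (R\<^sup>2) = w * cnj w" using w complex_norm_square[of w] by simp
    have "cnj z / (of_real (R\<^sup>2) - cnj z * w) * w = cnj (z / (w - z))"
      unfolding RR using wz w0 by (simp add: field_simps)
    then have e: "k w * (w / (w - z)) + k w * (cnj z / (of_real (R\<^sup>2) - cnj z * w)) * w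
        = k w * (w / (w - z) + cnj (z / (w - z)))"
      unfolding mult.assoc[of "k w"] by (simp only: distrib_left)
    have "w / (w - z) = 1 + z / (w - z)" using wz by (simp add: field_simps)
    with e have *: "k w * (w / (w - z)) + k w * (cnj z / (of_real (R\<^sup>2) - cnj z * w)) * w
        = k w * (1 + z / (w - z) + cnj (z / (w - z)))" by simp
    define v where "v = z / (w - z)"
    have v: "(w + z) / (w - z) = 1 + 2 * v" unfolding v_def using wz by (simp add: field_simps)
    have "1 + z / (w - z) + cnj (z / (w - z)) = of_real (Re ((w + z) / (w - z)))"
      unfolding v v_def[symmetric] by (simp add: complex_eq_iff)
    with * show ?thesis unfolding poisson_def w_def[symmetric] by simp
  qed
  ultimately show ?thesis by simp
qed

lemma has_integral_mean_value:
  fixes k :: "complex \<Rightarrow> complex"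
  assumes k: "k holomorphic_on ball 0 R'" and R: "R < R'" and R0: "0 < R"
  shows "((\<lambda>t. Re (k (of_real R * cis t))) has_integral 2 * pi * Re (k 0)) {0..2*pi}"
  using has_integral_poisson[OF k R, of 0] R0 by (simp add: poisson_0)

text \<open>The conjugate of a vanishing integral is added to Cauchy's formula for the derivative;
  the two terms combine to 2 Re k times w / (w - z)^2. So \<open>Re k\<close> alone controls the
  derivative, which matters because for a logarithm \<open>k\<close> only the real part is known on
  the circle.\<close>

lemma norm_deriv_le_circle_mean:
  fixes k :: "complex \<Rightarrow> complex"
  assumes k: "k holomorphic_on ball 0 R'" and R: "R < R'" and z: "norm z < R"
  shows "norm (deriv k z) \<le> 2 * R / (R - norm z)\<^sup>2 * circ_mean R (\<lambda>w. \<bar>Re (k w)\<bar>)"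
proof -
  have R0: "R > 0" using z norm_ge_zero[of z] by linarith
  obtain R'' where R'': "R < R''" "R'' \<le> R'"
    and ne: "\<And>w. norm w < R'' \<Longrightarrow> of_real (R\<^sup>2) - cnj z * w \<noteq> 0"
    using reflected_point_outside[OF z R] by metis
  have "(\<lambda>w. k w * (of_real (R\<^sup>2) / (of_real (R\<^sup>2) - cnj z * w)\<^sup>2)) holomorphic_on ball 0 R''"
    by (intro holomorphic_intros holomorphic_on_subset[OF k]) (use ne R'' in auto)
  from has_integral_cnj[THEN iffD2, OF has_integral_circle_Cauchy[OF this R0 R''(1)]]
  have 1: "((\<lambda>t. cnj (k (of_real R * cis t) * (of_real (R\<^sup>2) / (of_real (R\<^sup>2) - cnj z * (of_real R * cis t))\<^sup>2) * (of_real R * cis t)))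
      has_integral 0) {0..2*pi}" by (simp add: o_def)
  have 2: "((\<lambda>t. k (of_real R * cis t) * (of_real R * cis t / (of_real R * cis t - z)\<^sup>2))
           has_integral 2 * pi * deriv k z) {0..2*pi}"
    by (rule has_integral_circle_Cauchy_deriv[OF k R z])
  have eq: "k (of_real R * cis t) * (of_real R * cis t / (of_real R * cis t - z)\<^sup>2) +
      cnj (k (of_real R * cis t) * (of_real (R\<^sup>2) / (of_real (R\<^sup>2) - cnj z * (of_real R * cis t))\<^sup>2) * (of_real R * cis t))
      = of_real (2 * Re (k (of_real R * cis t))) * (of_real R * cis t / (of_real R * cis t - z)\<^sup>2)" for t
  proof -
    define w where "w = of_real R * cis t"
    have w: "norm w = R" using R0 by (auto simp: w_def norm_mult)
    have wz: "w \<noteq> z" using w z by auto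
    have w0: "w \<noteq> 0" using w R0 by auto
    have RR: "of_real (R\<^sup>2) = w * cnj w" using w complex_norm_square[of w] by simp
    have "cnj (of_real (R\<^sup>2) / (of_real (R\<^sup>2) - cnj z * w)\<^sup>2 * w) = w / (w - z)\<^sup>2"
      unfolding RR using wz w0 by (simp add: divide_simps) (simp add: power2_eq_square algebra_simps)
    then have "cnj (k w * (of_real (R\<^sup>2) / (of_real (R\<^sup>2) - cnj z * w)\<^sup>2) * w) = cnj (k w) * (w / (w - z)\<^sup>2)"
      unfolding mult.assoc[of "k w"] complex_cnj_mult[of "k w"] by (simp only:)
    then have "k w * (w / (w - z)\<^sup>2) + cnj (k w * (of_real (R\<^sup>2) / (of_real (R\<^sup>2) - cnj z * w)\<^sup>2) * w)
       = (k w + cnj (k w)) * (w / (w - z)\<^sup>2)" by (simp only: distrib_right)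
    also have "k w + cnj (k w) = of_real (2 * Re (k w))" by (simp add: complex_add_cnj)
    finally show ?thesis unfolding w_def[symmetric] .
  qed
  have I: "((\<lambda>t. of_real (2 * Re (k (of_real R * cis t))) * (of_real R * cis t / (of_real R * cis t - z)\<^sup>2))
       has_integral 2 * pi * deriv k z) {0..2*pi}"
    using has_integral_add[OF 2 1] unfolding eq by simp
  have cont: "continuous_on {0..2*pi} (\<lambda>t. \<bar>Re (k (of_real R * cis t))\<bar>)"
    by (intro continuous_intros continuous_on_compose2[OF holomorphic_on_imp_continuous_on[OF k]])
       (use R R0 in \<open>auto simp: norm_mult\<close>)
  have J: "((\<lambda>t. 2 * R / (R - norm z)\<^sup>2 * \<bar>Re (k (of_real R * cis t))\<bar>) has_integral
      2 * R / (R - norm z)\<^sup>2 * integral {0..2*pi} (\<lambda>t. \<bar>Re (k (of_real R * cis t))\<bar>)) {0..2*pi}"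
    by (intro has_integral_mult_right integrable_integral integrable_continuous_real cont)
  have "norm (2 * pi * deriv k z) \<le> 2 * R / (R - norm z)\<^sup>2 * integral {0..2*pi} (\<lambda>t. \<bar>Re (k (of_real R * cis t))\<bar>)"
    unfolding integral_unique[OF I, symmetric] integral_unique[OF J, symmetric]
  proof (rule integral_norm_bound_integral)
    fix t :: real
    define w where "w = of_real R * cis t"
    have w: "norm w = R" using R0 by (auto simp: w_def norm_mult)
    have "R - norm z \<le> norm (w - z)"
      using norm_triangle_ineq2[of w z] w by simp
    then have "(R - norm z)\<^sup>2 \<le> (norm (w - z))\<^sup>2"
      using z by (intro power_mono) auto
    then have "norm (w / (w - z)\<^sup>2) \<le> R / (R - norm z)\<^sup>2"
      using z w R0 by (auto simp: norm_divide norm_power intro!: divide_left_mono mult_pos_pos)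
    then have "2 * \<bar>Re (k w)\<bar> * norm (w / (w - z)\<^sup>2) \<le> 2 * \<bar>Re (k w)\<bar> * (R / (R - norm z)\<^sup>2)"
      by (intro mult_left_mono) auto
    moreover have "norm (of_real (2 * Re (k w)) * (w / (w - z)\<^sup>2)) = 2 * \<bar>Re (k w)\<bar> * norm (w / (w - z)\<^sup>2)"
      by (simp only: norm_mult norm_of_real abs_mult abs_numeral)
    ultimately show "norm (of_real (2 * Re (k (of_real R * cis t))) * (of_real R * cis t / (of_real R * cis t - z)\<^sup>2))
        \<le> 2 * R / (R - norm z)\<^sup>2 * \<bar>Re (k (of_real R * cis t))\<bar>"
      unfolding w_def[symmetric] by (simp only: times_divide_eq_right times_divide_eq_left mult_ac)
  qed (use I J in blast)+
  moreover have "norm (2 * pi * deriv k z) = 2 * pi * norm (deriv k z)" by (simp add: norm_mult)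
  moreover have "x \<le> K * (I / (2 * pi))" if "2 * pi * x \<le> K * I" for x K I :: real
    using that by (simp add: field_simps)
  ultimately show ?thesis unfolding circ_mean_def by metis
qed

section \<open>Jensen's formula\<close>

text \<open>At a zero of \<open>F\<close> the value is \<open>ln 0 = 0\<close> instead of minus
  infinity. A nonzero entire function has finitely many zeros on a circle, so means do not see this,
  but pointwise comparisons usually have to exclude the zeros.\<close>

abbreviation lnorm :: "(complex \<Rightarrow> complex) \<Rightarrow> complex \<Rightarrow> real" where
  "lnorm F z \<equiv> ln (norm (F z))"

text \<open>The logarithm of a modulus is unbounded below at zeros on the circle; an upper bound is
  enough to pass from integrability to absolute integrability.\<close>

lemma circ_int_imp_upper_bounded:
  assumes "(\<lambda>t. \<phi> (of_real r * cis t)) integrable_on {0..2*pi}" "\<And>z. norm z = \<bar>r\<bar> \<Longrightarrow> \<phi> z \<le> B"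
  shows "circ_int r \<phi>"
  unfolding circ_int_def
  by (rule absolutely_integrable_absolutely_integrable_ubound[OF assms(1), of "\<lambda>_. B"])
     (auto simp: norm_mult intro!: assms(2))

lemma lnorm_bounded_on_circle:
  assumes "F holomorphic_on UNIV"
  obtains B where "\<And>z. norm z = r \<Longrightarrow> lnorm F z \<le> B"
proof -
  have "compact (F ` sphere 0 r)"
    by (intro compact_continuous_image holomorphic_on_imp_continuous_on holomorphic_on_subset[OF assms]) auto
  then obtain C where C: "\<And>z. z \<in> sphere 0 r \<Longrightarrow> norm (F z) \<le> C"
    using compact_imp_bounded bounded_iff by (metis imageI)
  have "lnorm F z \<le> max 0 (ln C)" if "norm z = r" for z
  proof (cases "F z = 0")
    case False
    then have "lnorm F z \<le> ln C" using C[of z] that by (intro ln_mono) auto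
    then show ?thesis by simp
  qed simp
  then show thesis by (rule that)
qed

lemma
  assumes G: "entire_nz G" and nz: "\<And>z. norm z \<le> r \<Longrightarrow> G z \<noteq> 0" and r: "r > 0"
  shows circ_int_lnorm_nonvanishing: "circ_int r (lnorm G)"
    and circ_mean_lnorm_nonvanishing: "circ_mean r (lnorm G) = lnorm G 0"
proof -
  obtain R' where R': "R' > r" "\<And>z. norm z < R' \<Longrightarrow> G z \<noteq> 0"
    using entire_nz_nonzero_cball_imp_ball[OF G nz] by metis
  obtain k where k: "k holomorphic_on ball 0 R'" "\<And>z. z \<in> ball 0 R' \<Longrightarrow> G z = exp (k z)"
    using holomorphic_log_ball[of G R'] R' entire_nz_holomorphic[OF G] by auto
  have ln: "lnorm G z = Re (k z)" if "norm z \<le> r" for z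
    using that k(2)[of z] R' by simp
  have I: "((\<lambda>t. Re (k (of_real r * cis t))) has_integral 2 * pi * Re (k 0)) {0..2*pi}"
    by (rule has_integral_mean_value[OF k(1) R'(1) r])
  then have I: "((\<lambda>t. lnorm G (of_real r * cis t)) has_integral 2 * pi * lnorm G 0) {0..2*pi}"
    using r ln by (simp add: norm_mult)
  obtain B where "\<And>z. norm z = r \<Longrightarrow> lnorm G z \<le> B"
    using lnorm_bounded_on_circle[OF entire_nz_holomorphic[OF G]] by metis
  then show "circ_int r (lnorm G)"
    using I r by (intro circ_int_imp_upper_bounded[of _ _ B]) auto
  show "circ_mean r (lnorm G) = lnorm G 0"
    using I by (simp add: circ_mean_def integral_unique)
qed

lemma norm_diff_on_circle:
  assumes "norm z = r" "r > 0"
  shows "norm (z - a) = r * norm (1 - cnj a * z / of_real (r\<^sup>2))"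
proof -
  have "norm z * norm (z - a) = norm z * norm (cnj z - cnj a)"
    by (metis complex_cnj_diff complex_mod_cnj)
  also have "\<dots> = norm (z * cnj z - cnj a * z)" by (simp add: norm_mult[symmetric] algebra_simps)
  also have "z * cnj z = of_real (r\<^sup>2)" using assms complex_norm_square[of z] by simp
  also have "of_real (r\<^sup>2) - cnj a * z = of_real (r\<^sup>2) * (1 - cnj a * z / of_real (r\<^sup>2))"
    using assms by (simp add: field_simps)
  also have "norm \<dots> = r\<^sup>2 * norm (1 - cnj a * z / of_real (r\<^sup>2))"
    by (simp only: norm_mult norm_of_real) simp
  finally show ?thesis using assms by (simp add: power2_eq_square)
qed

text \<open>On the circle, |z - a| is r |1 - conj(a) z / r^2|, and the second factor has no zero in
  the closed disc. The mean of its logarithm is thus the value at 0, namely ln 1 = 0.\<close>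

lemma integral_lnorm_linear_less:
  assumes "norm a < r"
  shows "((\<lambda>t. lnorm (\<lambda>z. z - a) (of_real r * cis t)) has_integral 2 * pi * ln r) {0..2*pi}"
proof -
  have r: "r > 0" using assms norm_ge_zero[of a] by linarith
  define G where "G = (\<lambda>z. 1 - cnj a * z / of_real (r\<^sup>2))"
  have "G holomorphic_on UNIV" unfolding G_def using r by (intro holomorphic_intros) auto
  moreover have "G 0 \<noteq> 0" by (simp add: G_def)
  ultimately have G: "entire_nz G" by (auto simp: entire_nz_def)
  have nz: "G z \<noteq> 0" if "norm z \<le> r" for z
  proof
    assume "G z = 0"
    then have "cnj a * z = of_real (r\<^sup>2)" using r by (simp add: G_def field_simps)
    then have "norm (cnj a * z) = norm (complex_of_real (r\<^sup>2))" by simp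
    then have "norm a * norm z = r\<^sup>2" by (simp only: norm_mult norm_of_real complex_mod_cnj) simp
    moreover have "norm a * norm z \<le> norm a * r" using that by (intro mult_left_mono) auto
    moreover have "norm a * r < r * r" using assms r by simp
    ultimately show False by (simp add: power2_eq_square)
  qed
  have "((\<lambda>t. lnorm G (of_real r * cis t)) has_integral 2 * pi * lnorm G 0) {0..2*pi}"
    using circ_int_imp_integrable[OF circ_int_lnorm_nonvanishing[OF G nz r]]
      circ_mean_lnorm_nonvanishing[OF G nz r]
    by (auto simp: circ_mean_def field_simps has_integral_iff)
  then have "((\<lambda>t. lnorm G (of_real r * cis t) + ln r) has_integral 2 * pi * lnorm G 0 + 2 * pi * ln r) {0..2*pi}"
    using has_integral_const_real[of "ln r" 0 "2*pi"] by (intro has_integral_add) auto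
  moreover have "lnorm G (of_real r * cis t) + ln r = lnorm (\<lambda>z. z - a) (of_real r * cis t)" for t
  proof -
    let ?z = "of_real r * cis t"
    have z: "norm ?z = r" using r by (simp add: norm_mult)
    have "norm (G ?z) > 0" using nz z by simp
    then show ?thesis
      unfolding norm_diff_on_circle[OF z r, of a] using r by (simp add: G_def ln_mult)
  qed
  ultimately show ?thesis by (simp add: G_def)
qed

text \<open>The derivative of the squared distance along the ray has the sign of r - Re(a conj(e)),
  which is nonnegative for r >= |a|. This supplies the monotonicity for approaching a zero on the
  circle from larger radii.\<close>

lemma norm_ray_mono:
  fixes a e :: complex
  assumes "norm e = 1" "norm a \<le> r" "r \<le> s"
  shows "norm (of_real r * e - a) \<le> norm (of_real s * e - a)"
proof -
  have "Re (a * cnj e) \<le> r"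
    using complex_Re_le_cmod[of "a * cnj e"] assms by (simp add: norm_mult)
  define w where "w = of_real r * e - a"
  have ee: "(Re e)\<^sup>2 + (Im e)\<^sup>2 = 1" using assms(1) by (metis cmod_power2 one_power2)
  have "(norm (w + of_real (s - r) * e))\<^sup>2 = (norm w)\<^sup>2 + 2 * (s - r) * Re (w * cnj e) + (s - r)\<^sup>2 * ((Re e)\<^sup>2 + (Im e)\<^sup>2)"
    unfolding cmod_power2 by (simp add: power2_eq_square algebra_simps)
  moreover have "Re (w * cnj e) = r * ((Re e)\<^sup>2 + (Im e)\<^sup>2) - Re (a * cnj e)"
    unfolding w_def by (simp add: power2_eq_square algebra_simps)
  moreover have "w + of_real (s - r) * e = of_real s * e - a" by (simp add: w_def algebra_simps)
  ultimately have "(norm w)\<^sup>2 \<le> (norm (of_real s * e - a))\<^sup>2"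
    using \<open>Re (a * cnj e) \<le> r\<close> assms ee by simp
  then show ?thesis unfolding w_def by (simp add: power2_le_iff_abs_le)
qed

text \<open>When the zero lies on the circle, the integrals over the circles of radius r + 1/(n + 1)
  are known, their integrands decrease in n, and monotone convergence passes to the limit.\<close>

lemma integral_lnorm_linear_eq:
  assumes "norm a = r" "r > 0"
  shows "((\<lambda>t. lnorm (\<lambda>z. z - a) (of_real r * cis t)) has_integral 2 * pi * ln r) {0..2*pi}"
proof -
  define \<rho> where "\<rho> = (\<lambda>n::nat. r + 1 / real (Suc n))"
  define B where "B = {t \<in> {0..2*pi}. of_real r * cis t \<in> {a}}"
  have B: "finite B" unfolding B_def using assms by (intro finite_cis_vimage) auto
  \<comment> \<open>The functions are set to 0 at the angles of \<open>a\<close>: there the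
    approximants tend to minus infinity while the limit function has the value
    \<open>ln 0 = 0\<close>.\<close>
  define f where "f = (\<lambda>n t. if t \<in> B then 0 else lnorm (\<lambda>z. z - a) (of_real (\<rho> n) * cis t))"
  define g where "g = (\<lambda>t. if t \<in> B then 0 else lnorm (\<lambda>z. z - a) (of_real r * cis t))"
  have f: "(f n has_integral 2 * pi * ln (\<rho> n)) {0..2*pi}" for n
    unfolding f_def
    by (rule has_integral_spike_finite[OF B _ integral_lnorm_linear_less[of a "\<rho> n"]])
       (auto simp: \<rho>_def assms)
  have \<rho>: "\<rho> \<longlonglongrightarrow> r"
  proof -
    have "(\<lambda>n. r + 1 / real (Suc n)) \<longlonglongrightarrow> r + 0"
      by (intro tendsto_add tendsto_const) (use LIMSEQ_inverse_real_of_nat in \<open>simp add: inverse_eq_divide\<close>)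
    then show ?thesis by (simp add: \<rho>_def)
  qed
  have ln\<rho>: "(\<lambda>n. 2 * pi * ln (\<rho> n)) \<longlonglongrightarrow> 2 * pi * ln r"
    using \<rho> assms by (intro tendsto_intros) auto
  have pos: "norm (of_real (\<rho> n) * cis t - a) > 0" for n t
  proof -
    have "\<rho> n > r" by (simp add: \<rho>_def)
    then have "norm (of_real (\<rho> n) * cis t) > norm a" using assms by (simp add: norm_mult)
    then show ?thesis by auto
  qed
  have "g integrable_on {0..2*pi} \<and> (\<lambda>n. integral {0..2*pi} (f n)) \<longlonglongrightarrow> integral {0..2*pi} g"
  proof (rule monotone_convergence_decreasing)
    show "f n integrable_on {0..2*pi}" for n using f by blast
    show "f (Suc n) t \<le> f n t" for n t
    proof -
      have "norm (of_real (\<rho> (Suc n)) * cis t - a) \<le> norm (of_real (\<rho> n) * cis t - a)"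
        by (rule norm_ray_mono) (auto simp: \<rho>_def assms field_simps)
      then show ?thesis using pos by (simp add: f_def)
    qed
    show "(\<lambda>n. f n t) \<longlonglongrightarrow> g t" if "t \<in> {0..2*pi}" for t
    proof (cases "t \<in> B")
      case False
      then have "of_real r * cis t - a \<noteq> 0" using that by (auto simp: B_def)
      moreover have "(\<lambda>n. complex_of_real (\<rho> n) * cis t - a) \<longlonglongrightarrow> of_real r * cis t - a"
        using \<rho> by (intro tendsto_intros)
      ultimately have "(\<lambda>n. ln (norm (complex_of_real (\<rho> n) * cis t - a))) \<longlonglongrightarrow> ln (norm (of_real r * cis t - a))"
        by (intro tendsto_ln tendsto_norm) auto
      then show ?thesis using False by (simp add: f_def g_def)
    qed (simp add: f_def g_def)
    have "(\<lambda>n. integral {0..2*pi} (f n)) = (\<lambda>n. 2 * pi * ln (\<rho> n))"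
      using f by (auto simp: integral_unique)
    then show "bounded (range (\<lambda>n. integral {0..2*pi} (f n)))"
      using ln\<rho> convergent_imp_bounded by metis
  qed
  moreover have "(\<lambda>n. integral {0..2*pi} (f n)) = (\<lambda>n. 2 * pi * ln (\<rho> n))"
    using f by (auto simp: integral_unique)
  ultimately have gi: "g integrable_on {0..2*pi}" and "(\<lambda>n. 2 * pi * ln (\<rho> n)) \<longlonglongrightarrow> integral {0..2*pi} g"
    by auto
  then have "integral {0..2*pi} g = 2 * pi * ln r" using ln\<rho> LIMSEQ_unique by blast
  with gi have "(g has_integral 2 * pi * ln r) {0..2*pi}" by (simp add: has_integral_iff)
  then show ?thesis
    by (rule has_integral_spike_finite[OF B, rotated]) (auto simp: g_def)
qed

lemma
  assumes "norm a \<le> r" "r > 0"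
  shows circ_int_lnorm_linear: "circ_int r (lnorm (\<lambda>z. z - a))"
    and circ_mean_lnorm_linear: "circ_mean r (lnorm (\<lambda>z. z - a)) = ln r"
proof -
  have I: "((\<lambda>t. lnorm (\<lambda>z. z - a) (of_real r * cis t)) has_integral 2 * pi * ln r) {0..2*pi}"
    using integral_lnorm_linear_less[of a r] integral_lnorm_linear_eq[of a r] assms by fastforce
  obtain B where "\<And>z. norm z = r \<Longrightarrow> lnorm (\<lambda>z. z - a) z \<le> B"
    using lnorm_bounded_on_circle[OF entire_nz_holomorphic[OF entire_nz_linear[of a]]] by metis
  then show "circ_int r (lnorm (\<lambda>z. z - a))"
    using I assms by (intro circ_int_imp_upper_bounded[of _ _ B]) auto
  show "circ_mean r (lnorm (\<lambda>z. z - a)) = ln r"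
    using I by (simp add: circ_mean_def integral_unique)
qed

lemma lnorm_factorization:
  assumes F: "\<And>z. F z = (\<Prod>a\<in>Z. (z - a) ^ \<nu> a) * G z" and "finite Z" "F z \<noteq> 0"
  shows "lnorm F z = (\<Sum>a\<in>Z. real (\<nu> a) * lnorm (\<lambda>z. z - a) z) + lnorm G z"
proof -
  have nz: "(\<Prod>a\<in>Z. (z - a) ^ \<nu> a) \<noteq> 0" "G z \<noteq> 0" using assms(3) unfolding F by auto
  have p: "norm ((z - a) ^ \<nu> a) > 0" if "a \<in> Z" for a
    using nz(1) that assms(2) by (auto simp: prod_zero_iff)
  have "lnorm F z = ln (norm (\<Prod>a\<in>Z. (z - a) ^ \<nu> a)) + lnorm G z"
    using nz unfolding F by (simp add: norm_mult ln_mult)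
  also have "ln (norm (\<Prod>a\<in>Z. (z - a) ^ \<nu> a)) = (\<Sum>a\<in>Z. ln (norm ((z - a) ^ \<nu> a)))"
    unfolding prod_norm[symmetric] using p assms(2) by (subst ln_prod) auto
  also have "\<dots> = (\<Sum>a\<in>Z. real (\<nu> a) * lnorm (\<lambda>z. z - a) z)"
  proof (rule sum.cong)
    fix a assume "a \<in> Z"
    then have "z = a \<Longrightarrow> \<nu> a = 0" using p[of a] by (auto intro: ccontr)
    then show "ln (norm ((z - a) ^ \<nu> a)) = real (\<nu> a) * lnorm (\<lambda>z. z - a) z"
      by (cases "z = a") (auto simp: norm_power ln_realpow)
  qed simp
  finally show ?thesis .
qed

text \<open>Each zero in the closed disc contributes ln r per multiplicity, whether it lies inside
  or on the circle, and the zero-free cofactor contributes its value at 0.\<close>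

lemma
  assumes F: "entire_nz F" and r: "r > 0"
  shows circ_int_lnorm: "circ_int r (lnorm F)"
    and circ_mean_lnorm: "\<And>G Z. Z = {a. F a = 0 \<and> norm a \<le> r} \<Longrightarrow> entire_nz G \<Longrightarrow>
      (\<And>z. F z = (\<Prod>a\<in>Z. (z - a) ^ zord F a) * G z) \<Longrightarrow> (\<And>a. a \<in> Z \<Longrightarrow> G a \<noteq> 0) \<Longrightarrow>
      circ_mean r (lnorm F) = (\<Sum>a\<in>Z. real (zord F a) * ln r) + lnorm G 0"
proof -
  define Z where "Z = {a. F a = 0 \<and> norm a \<le> r}"
  have Z: "finite Z" unfolding Z_def by (rule entire_nz_finite_zeros[OF F])
  have main: "circ_int r (lnorm F) \<and> circ_mean r (lnorm F) = (\<Sum>a\<in>Z. real (zord F a) * ln r) + lnorm G 0"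
    if G: "entire_nz G" "\<And>z. F z = (\<Prod>a\<in>Z. (z - a) ^ zord F a) * G z" "\<And>a. a \<in> Z \<Longrightarrow> G a \<noteq> 0" for G
  proof -
    let ?\<phi> = "\<lambda>z. (\<Sum>a\<in>Z. real (zord F a) * lnorm (\<lambda>z. z - a) z) + lnorm G z"
    have nz: "G z \<noteq> 0" if "norm z \<le> r" for z
    proof
      assume "G z = 0"
      then have "F z = 0" using G(2)[of z] by simp
      then have "z \<in> Z" using that by (simp add: Z_def)
      then show False using G(3) \<open>G z = 0\<close> by blast
    qed
    have l: "circ_int r (lnorm (\<lambda>z. z - a))" if "a \<in> Z" for a
      using that r by (intro circ_int_lnorm_linear) (auto simp: Z_def)
    have i: "circ_int r (lnorm G)" by (rule circ_int_lnorm_nonvanishing[OF G(1) nz r])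
    have \<phi>: "circ_int r ?\<phi>"
      by (intro circ_int_add circ_int_sum circ_int_cmult i) (use l in auto)
    have eq: "lnorm F z = ?\<phi> z" if "norm z = r" "z \<notin> Z" for z
      by (rule lnorm_factorization[OF G(2) Z]) (use that in \<open>auto simp: Z_def\<close>)
    have "circ_mean r (lnorm F) = circ_mean r ?\<phi>"
      by (rule circ_mean_spike[OF r Z eq])
    also have "\<dots> = (\<Sum>a\<in>Z. real (zord F a) * ln r) + lnorm G 0"
    proof (subst circ_mean_add[OF circ_int_sum i])
      show "circ_int r (\<lambda>z. real (zord F a) * lnorm (\<lambda>z. z - a) z)" if "a \<in> Z" for a
        using l[OF that] by (rule circ_int_cmult)
      then have "circ_mean r (\<lambda>z. \<Sum>a\<in>Z. real (zord F a) * lnorm (\<lambda>z. z - a) z)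
          = (\<Sum>a\<in>Z. circ_mean r (\<lambda>z. real (zord F a) * lnorm (\<lambda>z. z - a) z))"
        by (rule circ_mean_sum)
      also have "\<dots> = (\<Sum>a\<in>Z. real (zord F a) * ln r)"
        unfolding circ_mean_cmult
        by (intro sum.cong refl, subst circ_mean_lnorm_linear) (use r in \<open>auto simp: Z_def\<close>)
      finally show "circ_mean r (\<lambda>z. \<Sum>a\<in>Z. real (zord F a) * lnorm (\<lambda>z. z - a) z) + circ_mean r (lnorm G)
          = (\<Sum>a\<in>Z. real (zord F a) * ln r) + lnorm G 0"
        by (simp add: circ_mean_lnorm_nonvanishing[OF G(1) nz r])
    qed
    finally show ?thesis using circ_int_spike[OF r \<phi> Z eq] by simp
  qed
  obtain G where "entire_nz G" "\<And>z. F z = (\<Prod>a\<in>Z. (z - a) ^ zord F a) * G z" "\<And>a. a \<in> Z \<Longrightarrow> G a \<noteq> 0"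
    using entire_nz_divide_zeros[OF F Z] by metis
  then show "circ_int r (lnorm F)" using main by blast
  show "circ_mean r (lnorm F) = (\<Sum>a\<in>Z'. real (zord F a) * ln r) + lnorm G 0"
    if "Z' = {a. F a = 0 \<and> norm a \<le> r}" "entire_nz G"
      "\<And>z. F z = (\<Prod>a\<in>Z'. (z - a) ^ zord F a) * G z" "\<And>a. a \<in> Z' \<Longrightarrow> G a \<noteq> 0" for G Z'
    using main[of G] that unfolding Z_def by blast
qed

section \<open>Counting functions of divisors and Jensen's formula\<close>

definition locfin :: "(complex \<Rightarrow> nat) \<Rightarrow> bool" where
  "locfin \<nu> \<longleftrightarrow> (\<forall>r. finite {a. \<nu> a \<noteq> 0 \<and> norm a \<le> r})"

text \<open>The integrated counting function after termwise integration: a point a with 0 < |a| <= r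
  gives the integral of 1/t from |a| to r, and the origin gives ln r. As a sum it is visibly
  additive and monotone in the divisor.\<close>

definition Ncount :: "(complex \<Rightarrow> nat) \<Rightarrow> real \<Rightarrow> real" where
  "Ncount \<nu> r = (\<Sum>a | \<nu> a \<noteq> 0 \<and> norm a \<le> r. real (\<nu> a) * (if a = 0 then ln r else ln (r / norm a)))"

lemma locfin_zord: "entire_nz F \<Longrightarrow> locfin (zord F)"
  unfolding locfin_def
proof
  fix r assume "entire_nz F"
  then show "finite {a. zord F a \<noteq> 0 \<and> norm a \<le> r}"
    by (rule finite_subset[OF _ entire_nz_finite_zeros[of F r], rotated]) (auto simp: zord_def split: if_splits)
qed

lemma locfin_mono: "locfin \<mu> \<Longrightarrow> (\<And>a. \<nu> a \<noteq> 0 \<Longrightarrow> \<mu> a \<noteq> 0) \<Longrightarrow> locfin \<nu>"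
  unfolding locfin_def
proof
  fix r assume "\<forall>r. finite {a. \<mu> a \<noteq> 0 \<and> norm a \<le> r}" "\<And>a. \<nu> a \<noteq> 0 \<Longrightarrow> \<mu> a \<noteq> 0"
  then show "finite {a. \<nu> a \<noteq> 0 \<and> norm a \<le> r}"
    by (intro finite_subset[of "{a. \<nu> a \<noteq> 0 \<and> norm a \<le> r}" "{a. \<mu> a \<noteq> 0 \<and> norm a \<le> r}"]) blast+
qed

lemma locfin_add: "locfin \<mu> \<Longrightarrow> locfin \<nu> \<Longrightarrow> locfin (\<lambda>a. \<mu> a + \<nu> a)"
  unfolding locfin_def
proof
  fix r assume "\<forall>r. finite {a. \<mu> a \<noteq> 0 \<and> norm a \<le> r}" "\<forall>r. finite {a. \<nu> a \<noteq> 0 \<and> norm a \<le> r}"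
  then have "finite ({a. \<mu> a \<noteq> 0 \<and> norm a \<le> r} \<union> {a. \<nu> a \<noteq> 0 \<and> norm a \<le> r})" by blast
  then show "finite {a. \<mu> a + \<nu> a \<noteq> 0 \<and> norm a \<le> r}" by (rule finite_subset[rotated]) auto
qed

lemma locfin_cmult: "locfin \<mu> \<Longrightarrow> locfin (\<lambda>a. n * \<mu> a)"
  by (erule locfin_mono) auto

lemma Ncount_superset:
  assumes "finite Z" "\<And>a. \<nu> a \<noteq> 0 \<Longrightarrow> norm a \<le> r \<Longrightarrow> a \<in> Z" "\<And>a. a \<in> Z \<Longrightarrow> norm a \<le> r"
  shows "Ncount \<nu> r = (\<Sum>a\<in>Z. real (\<nu> a) * (if a = 0 then ln r else ln (r / norm a)))"
  unfolding Ncount_def by (rule sum.mono_neutral_left) (use assms in auto)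

lemma Ncount_add:
  assumes "locfin \<mu>" "locfin \<nu>" shows "Ncount (\<lambda>a. \<mu> a + \<nu> a) r = Ncount \<mu> r + Ncount \<nu> r"
proof -
  let ?Z = "{a. \<mu> a + \<nu> a \<noteq> 0 \<and> norm a \<le> r}"
  have Z: "finite ?Z" using locfin_add[OF assms] by (simp add: locfin_def)
  show ?thesis
    by (subst (1 2 3) Ncount_superset[OF Z]) (auto simp: algebra_simps sum.distrib[symmetric])
qed

lemma Ncount_cmult: "Ncount (\<lambda>a. n * \<nu> a) r = real n * Ncount \<nu> r"
proof (cases "n = 0")
  case False
  then show ?thesis unfolding Ncount_def sum_distrib_left by (intro sum.cong) auto
qed (simp add: Ncount_def)

lemma Ncount_weight_nonneg:
  "r \<ge> 1 \<Longrightarrow> norm a \<le> r \<Longrightarrow> (if a = 0 then ln r else ln (r / norm a)) \<ge> 0"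
  by (auto intro!: ln_ge_zero simp: field_simps)

lemma Ncount_mono:
  assumes "locfin \<mu>" "\<And>a. \<nu> a \<le> \<mu> a" "r \<ge> 1" shows "Ncount \<nu> r \<le> Ncount \<mu> r"
proof -
  let ?Z = "{a. \<mu> a \<noteq> 0 \<and> norm a \<le> r}"
  have Z: "finite ?Z" using assms by (simp add: locfin_def)
  have p: "\<nu> a \<noteq> 0 \<Longrightarrow> \<mu> a \<noteq> 0" for a using assms(2)[of a] by linarith
  show ?thesis
    by (subst (1 2) Ncount_superset[OF Z])
       (use p assms Ncount_weight_nonneg in \<open>auto intro!: sum_mono mult_right_mono\<close>)
qed

lemma Ncount_nonneg: "r \<ge> 1 \<Longrightarrow> Ncount \<nu> r \<ge> 0"
  unfolding Ncount_def by (intro sum_nonneg mult_nonneg_nonneg Ncount_weight_nonneg) auto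

lemma jensen_nonzero:
  assumes F: "entire_nz F" and F0: "F 0 \<noteq> 0" and r: "r > 0"
  shows "circ_mean r (lnorm F) = Ncount (zord F) r + lnorm F 0"
proof -
  define Z where "Z = {a. F a = 0 \<and> norm a \<le> r}"
  have Z: "finite Z" unfolding Z_def by (rule entire_nz_finite_zeros[OF F])
  obtain G where G: "entire_nz G" "\<And>z. F z = (\<Prod>a\<in>Z. (z - a) ^ zord F a) * G z" "\<And>a. a \<in> Z \<Longrightarrow> G a \<noteq> 0"
    using entire_nz_divide_zeros[OF F Z] by metis
  have 1: "circ_mean r (lnorm F) = (\<Sum>a\<in>Z. real (zord F a) * ln r) + lnorm G 0"
    by (rule circ_mean_lnorm[OF F r Z_def G])
  have 2: "lnorm F 0 = (\<Sum>a\<in>Z. real (zord F a) * ln (norm a)) + lnorm G 0"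
    using lnorm_factorization[OF G(2) Z F0] by simp
  have 3: "Ncount (zord F) r = (\<Sum>a\<in>Z. real (zord F a) * (if a = 0 then ln r else ln (r / norm a)))"
    by (rule Ncount_superset[OF Z]) (auto simp: Z_def zord_def split: if_splits)
  also have "\<dots> = (\<Sum>a\<in>Z. real (zord F a) * ln r - real (zord F a) * ln (norm a))"
    using F0 r by (intro sum.cong) (auto simp: Z_def ln_div algebra_simps)
  also have "\<dots> = (\<Sum>a\<in>Z. real (zord F a) * ln r) - (\<Sum>a\<in>Z. real (zord F a) * ln (norm a))"
    by (rule sum_subtractf)
  finally show ?thesis using 1 2 by simp
qed

text \<open>The constant is log|G(0)| in F = z^k G; only its independence of \<open>r\<close>
  matters in the sequel.\<close>

theorem jensen:
  assumes F: "entire_nz F"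
  obtains C where "\<And>r. r > 0 \<Longrightarrow> circ_mean r (lnorm F) = Ncount (zord F) r + C"
proof -
  obtain G where G: "G holomorphic_on UNIV" "G 0 \<noteq> 0" "\<And>z. F z = (z - 0) ^ zord F 0 * G z"
    using zord_factorization[OF F, of 0] by metis
  have Gn: "entire_nz G" using G by (auto simp: entire_nz_def)
  have Fe: "F = (\<lambda>z. (z - 0) ^ zord F 0 * G z)" using G(3) by auto
  have z: "zord F a = (if a = 0 then zord F 0 else zord G a)" for a
  proof (cases "a = 0")
    case False
    have "zord (\<lambda>z. (z - 0) ^ zord F 0 * G z) a = zord G a"
      using False by (subst zord_mult[OF entire_nz_power[OF entire_nz_linear] Gn]) simp
    then show ?thesis using False Fe by simp
  qed simp
  have "circ_mean r (lnorm F) = Ncount (zord F) r + lnorm G 0" if r: "r > 0" for r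
  proof -
    let ?Z = "{0} \<union> {a. G a = 0 \<and> norm a \<le> r}"
    have Z: "finite ?Z" using entire_nz_finite_zeros[OF Gn] by simp
    have "circ_mean r (lnorm F) = circ_mean r (\<lambda>z. real (zord F 0) * lnorm (\<lambda>z. z - 0) z + lnorm G z)"
    proof (rule circ_mean_spike[OF r Z])
      fix z assume "norm z = r" "z \<notin> ?Z"
      then have "z \<noteq> 0" "G z \<noteq> 0" by auto
      then have "ln (norm (z ^ zord F 0 * G z)) = real (zord F 0) * ln (norm z) + ln (norm (G z))"
        by (simp add: norm_mult norm_power ln_mult ln_realpow)
      then show "lnorm F z = real (zord F 0) * lnorm (\<lambda>z. z - 0) z + lnorm G z"
        using G(3)[of z] by simp
    qed
    also have "\<dots> = real (zord F 0) * ln r + circ_mean r (lnorm G)"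
      using r circ_int_lnorm[OF Gn r] circ_int_lnorm_linear[of 0 r] circ_mean_lnorm_linear[of 0 r]
      by (subst circ_mean_add) (auto intro: circ_int_cmult simp: circ_mean_cmult)
    also have "circ_mean r (lnorm G) = Ncount (zord G) r + lnorm G 0"
      by (rule jensen_nonzero[OF Gn G(2) r])
    also have "Ncount (zord G) r = (\<Sum>a\<in>?Z - {0}. real (zord G a) * (if a = 0 then ln r else ln (r / norm a)))"
      by (rule Ncount_superset) (use Z G(2) in \<open>auto simp: zord_def split: if_splits\<close>)
    also have "\<dots> = (\<Sum>a\<in>?Z - {0}. real (zord F a) * (if a = 0 then ln r else ln (r / norm a)))"
      by (intro sum.cong) (auto simp: z)
    also have "real (zord F 0) * ln r + (\<dots> + lnorm G 0) =
        (\<Sum>a\<in>?Z. real (zord F a) * (if a = 0 then ln r else ln (r / norm a))) + lnorm G 0"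
      by (subst sum.remove[OF Z, of 0]) auto
    also have "(\<Sum>a\<in>?Z. real (zord F a) * (if a = 0 then ln r else ln (r / norm a))) = Ncount (zord F) r"
    proof (rule Ncount_superset[OF Z, symmetric])
      fix a assume "zord F a \<noteq> 0" "norm a \<le> r"
      then show "a \<in> ?Z" using z[of a] by (cases "a = 0") (auto simp: zord_def split: if_splits)
    qed (use r in auto)
    finally show ?thesis .
  qed
  then show thesis by (rule that)
qed

section \<open>Blaschke factors and the logarithmic derivative\<close>

text \<open>A relation that includes nonvanishing, so that logarithmic derivatives of products add
  up by introduction rules and are compared by uniqueness.\<close>

definition has_logderiv :: "(complex \<Rightarrow> complex) \<Rightarrow> complex \<Rightarrow> complex \<Rightarrow> bool" where
  "has_logderiv F z D \<longleftrightarrow> F z \<noteq> 0 \<and> (F has_field_derivative D * F z) (at z)"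

lemma has_logderiv_deriv:
  assumes "F holomorphic_on UNIV" "F z \<noteq> 0" shows "has_logderiv F z (deriv F z / F z)"
  using assms holomorphic_derivI[of F UNIV z] by (simp add: has_logderiv_def)

lemma has_logderiv_unique:
  assumes "has_logderiv F z D" "has_logderiv F z D'" shows "D = D'"
  using assms DERIV_unique[of F "D * F z" z "D' * F z"] by (auto simp: has_logderiv_def)

lemma has_logderiv_mult:
  assumes "has_logderiv F z D" "has_logderiv G z E" shows "has_logderiv (\<lambda>z. F z * G z) z (D + E)"
  using assms unfolding has_logderiv_def
  by (auto intro!: derivative_eq_intros simp: algebra_simps)

lemma has_logderiv_power:
  assumes "has_logderiv F z D" shows "has_logderiv (\<lambda>z. F z ^ n) z (of_nat n * D)"
proof (induction n)
  case 0
  then show ?case by (simp add: has_logderiv_def)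
next
  case (Suc n)
  from has_logderiv_mult[OF assms Suc] show ?case by (simp add: algebra_simps)
qed

lemma has_logderiv_prod:
  assumes "\<And>i. i \<in> I \<Longrightarrow> has_logderiv (F i) z (D i)"
  shows "has_logderiv (\<lambda>z. \<Prod>i\<in>I. F i z) z (\<Sum>i\<in>I. D i)"
  using assms
proof (induction I rule: infinite_finite_induct)
  case (insert i I)
  have "has_logderiv (\<lambda>z. F i z * (\<Prod>i\<in>I. F i z)) z (D i + (\<Sum>i\<in>I. D i))"
    by (intro has_logderiv_mult) (use insert in auto)
  then show ?case using insert by simp
qed (auto simp: has_logderiv_def)

lemma has_logderiv_linear: "z \<noteq> a \<Longrightarrow> has_logderiv (\<lambda>z. z - a) z (1 / (z - a))"
  unfolding has_logderiv_def by (auto intro!: derivative_eq_intros)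

lemma has_logderiv_exp:
  assumes "k holomorphic_on A" "open A" "z \<in> A" "\<And>z. z \<in> A \<Longrightarrow> F z = exp (k z)"
  shows "has_logderiv F z (deriv k z)"
proof -
  have "((\<lambda>z. exp (k z)) has_field_derivative deriv k z * exp (k z)) (at z)"
    using holomorphic_derivI[OF assms(1-3)] by (auto intro!: derivative_eq_intros)
  then have "(F has_field_derivative deriv k z * exp (k z)) (at z)"
    by (rule has_field_derivative_transform_within_open[OF _ assms(2,3)]) (simp add: assms(4))
  then show ?thesis using assms(3,4) by (simp add: has_logderiv_def)
qed

text \<open>The identity behind the Blaschke factor R (z - a) / (R^2 - conj(a) z): its modulus is 1
  on the circle and at most 1 inside.\<close>

lemma norm_reflected_diff:
  "(norm (of_real (R\<^sup>2) - cnj a * z))\<^sup>2 - R\<^sup>2 * (norm (z - a))\<^sup>2 = (R\<^sup>2 - (norm a)\<^sup>2) * (R\<^sup>2 - (norm z)\<^sup>2)"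
  unfolding cmod_power2 by (simp add: power2_eq_square algebra_simps)

lemma reflected_ge:
  assumes "norm a < R" "norm z \<le> R"
  shows "R * norm (z - a) \<le> norm (of_real (R\<^sup>2) - cnj a * z)"
    and "R * (R - norm z) \<le> norm (of_real (R\<^sup>2) - cnj a * z)"
proof -
  have R: "R > 0" using assms norm_ge_zero[of a] by linarith
  have "(R\<^sup>2 - (norm a)\<^sup>2) * (R\<^sup>2 - (norm z)\<^sup>2) \<ge> 0"
    using assms R by (intro mult_nonneg_nonneg) (auto simp: power_mono)
  then have "(R * norm (z - a))\<^sup>2 \<le> (norm (of_real (R\<^sup>2) - cnj a * z))\<^sup>2"
    using norm_reflected_diff[of R a z] by (simp add: power_mult_distrib)
  then show "R * norm (z - a) \<le> norm (of_real (R\<^sup>2) - cnj a * z)"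
    by (rule power2_le_imp_le) simp
  have "norm a * norm z \<le> R * norm z" using assms by (intro mult_right_mono) auto
  moreover have "norm (complex_of_real (R\<^sup>2)) - norm (cnj a * z) \<le> norm (of_real (R\<^sup>2) - cnj a * z)"
    by (rule norm_triangle_ineq2)
  moreover have "norm (complex_of_real (R\<^sup>2)) = R\<^sup>2" by (simp only: norm_of_real) simp
  ultimately show "R * (R - norm z) \<le> norm (of_real (R\<^sup>2) - cnj a * z)"
    by (simp add: norm_mult power2_eq_square algebra_simps)
qed

text \<open>Every factor z - a is replaced by (R^2 - conj(a) z) / R, which has the same modulus on
  the circle, a modulus at least as large inside, and no zero in the closed disc. The resulting
  function is exp(k) on a larger disc. So Re k takes the boundary values log|F| and majorizes
  log|F|, and the two logarithmic derivatives differ by explicit terms at the zeros.\<close>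

lemma blaschke_factorization:
  assumes F: "entire_nz F" and R: "R > 0" and nz: "\<And>z. norm z = R \<Longrightarrow> F z \<noteq> 0"
  obtains k R' where "R < R'" "k holomorphic_on ball 0 R'"
    "\<forall>z. norm z = R \<longrightarrow> Re (k z) = lnorm F z"
    "\<forall>z. norm z < R \<longrightarrow> F z \<noteq> 0 \<longrightarrow> lnorm F z \<le> Re (k z)"
    "\<forall>z. norm z < R \<longrightarrow> F z \<noteq> 0 \<longrightarrow> deriv F z / F z = deriv k z +
       (\<Sum>a | F a = 0 \<and> norm a \<le> R. of_nat (zord F a) * (1 / (z - a) + cnj a / (of_real (R\<^sup>2) - cnj a * z)))"
proof -
  define Z where "Z = {a. F a = 0 \<and> norm a \<le> R}"
  have Z: "finite Z" unfolding Z_def by (rule entire_nz_finite_zeros[OF F])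
  have ZR: "norm a < R" if "a \<in> Z" for a using that nz[of a] by (auto simp: Z_def order_less_le)
  obtain G where G: "entire_nz G" "\<And>z. F z = (\<Prod>a\<in>Z. (z - a) ^ zord F a) * G z" "\<And>a. a \<in> Z \<Longrightarrow> G a \<noteq> 0"
    using entire_nz_divide_zeros[OF F Z] by metis
  define b where "b = (\<lambda>a z. (of_real (R\<^sup>2) - cnj a * z) / of_real R)"
  have b: "entire_nz (b a)" if "a \<in> Z" for a
    unfolding entire_nz_def b_def
    by (intro conjI holomorphic_intros exI[of _ 0]) (use R in auto)
  define U where "U = (\<lambda>z. G z * (\<Prod>a\<in>Z. b a z ^ zord F a))"
  have U: "entire_nz U" unfolding U_def by (intro entire_nz_mult G entire_nz_prod entire_nz_power b)
  have Gnz: "G z \<noteq> 0" if "norm z \<le> R" for z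
  proof
    assume "G z = 0"
    then have "F z = 0" using G(2)[of z] by simp
    then have "z \<in> Z" using that by (simp add: Z_def)
    then show False using G(3) \<open>G z = 0\<close> by blast
  qed
  have norm_b: "norm (b a z) = norm (of_real (R\<^sup>2) - cnj a * z) / R" for a z
    using R by (simp add: b_def norm_divide)
  have bnz: "b a z \<noteq> 0" if "a \<in> Z" "norm z \<le> R" for a z
  proof (cases "norm z = R")
    case True
    have "norm (z - a) > 0" using True ZR[OF that(1)] by auto
    then have "0 < R * norm (z - a)" using R by simp
    then show ?thesis using reflected_ge(1)[OF ZR[OF that(1)] that(2)] R by (auto simp: b_def)
  next
    case False
    then have "0 < R * (R - norm z)" using that R by simp
    then show ?thesis using reflected_ge(2)[OF ZR[OF that(1)] that(2)] R by (auto simp: b_def)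
  qed
  have Unz: "U z \<noteq> 0" if "norm z \<le> R" for z
    using Gnz bnz that Z by (auto simp: U_def)
  obtain R' where R': "R' > R" "\<And>z. norm z < R' \<Longrightarrow> U z \<noteq> 0"
    using entire_nz_nonzero_cball_imp_ball[OF U Unz] by metis
  obtain k where k: "k holomorphic_on ball 0 R'" "\<And>z. z \<in> ball 0 R' \<Longrightarrow> U z = exp (k z)"
    using holomorphic_log_ball[of U R'] R' entire_nz_holomorphic[OF U] by auto
  have normF: "norm (F z) = (\<Prod>a\<in>Z. norm (z - a) ^ zord F a) * norm (G z)" for z
    using G(2)[of z] by (simp add: norm_mult norm_power flip: prod_norm)
  have normU: "norm (U z) = (\<Prod>a\<in>Z. norm (b a z) ^ zord F a) * norm (G z)" for z
    by (simp add: U_def norm_mult norm_power flip: prod_norm)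
  have Rek: "Re (k z) = ln (norm (U z))" if "norm z \<le> R" for z
    using k(2)[of z] that R' by simp
  have 1: "Re (k z) = lnorm F z" if z: "norm z = R" for z
  proof -
    have "norm (b a z) = norm (z - a)" for a
    proof -
      have "(norm (of_real (R\<^sup>2) - cnj a * z))\<^sup>2 = (R * norm (z - a))\<^sup>2"
        using norm_reflected_diff[of R a z] z by (simp add: power_mult_distrib)
      then have "norm (of_real (R\<^sup>2) - cnj a * z) = R * norm (z - a)"
        using R by (simp add: power2_eq_iff_nonneg)
      then show ?thesis using R by (simp add: norm_b)
    qed
    then show ?thesis using z by (simp add: Rek normU normF)
  qed
  have 2: "lnorm F z \<le> Re (k z)" if z: "norm z < R" "F z \<noteq> 0" for z
  proof -
    have "norm (z - a) \<le> norm (b a z)" if "a \<in> Z" for a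
      using reflected_ge(1)[OF ZR[OF that], of z] z R by (simp add: norm_b field_simps)
    then have "norm (F z) \<le> norm (U z)"
      unfolding normF normU by (intro mult_right_mono prod_mono conjI power_mono) auto
    then show ?thesis using z Unz[of z] by (simp add: Rek)
  qed
  have 3: "deriv F z / F z = deriv k z +
       (\<Sum>a\<in>Z. of_nat (zord F a) * (1 / (z - a) + cnj a / (of_real (R\<^sup>2) - cnj a * z)))"
    if z: "norm z < R" "F z \<noteq> 0" for z
  proof -
    have g: "has_logderiv G z (deriv G z / G z)"
      using z by (intro has_logderiv_deriv entire_nz_holomorphic[OF G(1)] Gnz) auto
    have f: "has_logderiv F z (deriv F z / F z)"
      using z by (intro has_logderiv_deriv entire_nz_holomorphic[OF F]) auto
    have "has_logderiv (\<lambda>z. (\<Prod>a\<in>Z. (z - a) ^ zord F a) * G z) z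
        ((\<Sum>a\<in>Z. of_nat (zord F a) * (1 / (z - a))) + deriv G z / G z)"
      by (intro has_logderiv_mult has_logderiv_prod has_logderiv_power has_logderiv_linear g)
         (use z in \<open>auto simp: Z_def\<close>)
    moreover have "(\<lambda>z. (\<Prod>a\<in>Z. (z - a) ^ zord F a) * G z) = F" using G(2) by auto
    ultimately have e1: "deriv F z / F z = (\<Sum>a\<in>Z. of_nat (zord F a) * (1 / (z - a))) + deriv G z / G z"
      using f has_logderiv_unique by metis
    have "has_logderiv (b a) z (- (cnj a / (of_real (R\<^sup>2) - cnj a * z)))" if "a \<in> Z" for a
    proof -
      have n: "b a z \<noteq> 0" using bnz[OF that, of z] z by simp
      then have n': "of_real (R\<^sup>2) - cnj a * z \<noteq> 0" by (auto simp: b_def)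
      have "(b a has_field_derivative (- cnj a / of_real R)) (at z)"
        unfolding b_def using R by (auto intro!: derivative_eq_intros)
      moreover have "- cnj a / of_real R = - (cnj a / (of_real (R\<^sup>2) - cnj a * z)) * b a z"
        using n' unfolding b_def by simp
      ultimately show ?thesis using n by (simp add: has_logderiv_def)
    qed
    then have "has_logderiv U z (deriv G z / G z + (\<Sum>a\<in>Z. of_nat (zord F a) * (- (cnj a / (of_real (R\<^sup>2) - cnj a * z)))))"
      unfolding U_def by (intro has_logderiv_mult has_logderiv_prod has_logderiv_power g) auto
    moreover have "has_logderiv U z (deriv k z)"
      using z R' by (intro has_logderiv_exp[OF k(1) open_ball _ k(2)]) auto
    ultimately have e2: "deriv k z = deriv G z / G z + (\<Sum>a\<in>Z. of_nat (zord F a) * (- (cnj a / (of_real (R\<^sup>2) - cnj a * z))))"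
      using has_logderiv_unique by blast
    show ?thesis unfolding e1 e2 by (simp add: algebra_simps sum.distrib sum_negf)
  qed
  show thesis by (rule that[OF R'(1) k(1)]) (use 1 2 3[unfolded Z_def] in blast)+
qed

text \<open>Subtracting before estimating leaves the mean of |log|F/G||, which Jensen's formula and
  an upper bound for the mean of max(log|F|, log|G|) control. As R >= 2r >= 2, the factor 2R / (R -
  r)^2 is at most 8/R, hence at most 8. Each reflected term is at most 1, since |a| < R and |R^2 -
  conj(a) z| >= R (R - r) >= R.\<close>

lemma norm_logderiv_diff_le:
  assumes F: "entire_nz F" and G: "entire_nz G" and z: "norm z = r" and r: "r \<ge> 1" and R: "2 * r \<le> R"
    and nzF: "\<And>z. norm z = R \<Longrightarrow> F z \<noteq> 0" and nzG: "\<And>z. norm z = R \<Longrightarrow> G z \<noteq> 0"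
    and Fz: "F z \<noteq> 0" and Gz: "G z \<noteq> 0"
  shows "norm (deriv F z / F z - deriv G z / G z) \<le> 8 * circ_mean R (\<lambda>w. \<bar>lnorm F w - lnorm G w\<bar>)
     + (\<Sum>a | F a = 0 \<and> norm a \<le> R. real (zord F a) * (1 / norm (z - a) + 1))
     + (\<Sum>a | G a = 0 \<and> norm a \<le> R. real (zord G a) * (1 / norm (z - a) + 1))"
proof -
  have R0: "R > 0" and zR: "norm z < R" using r R z by auto
  obtain k1 R1 where k1: "R < R1" "k1 holomorphic_on ball 0 R1"
    "\<forall>z. norm z = R \<longrightarrow> Re (k1 z) = lnorm F z"
    "\<forall>z. norm z < R \<longrightarrow> F z \<noteq> 0 \<longrightarrow> deriv F z / F z = deriv k1 z +
       (\<Sum>a | F a = 0 \<and> norm a \<le> R. of_nat (zord F a) * (1 / (z - a) + cnj a / (of_real (R\<^sup>2) - cnj a * z)))"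
    by (rule blaschke_factorization[OF F R0 nzF])
  obtain k2 R2 where k2: "R < R2" "k2 holomorphic_on ball 0 R2"
    "\<forall>z. norm z = R \<longrightarrow> Re (k2 z) = lnorm G z"
    "\<forall>z. norm z < R \<longrightarrow> G z \<noteq> 0 \<longrightarrow> deriv G z / G z = deriv k2 z +
       (\<Sum>a | G a = 0 \<and> norm a \<le> R. of_nat (zord G a) * (1 / (z - a) + cnj a / (of_real (R\<^sup>2) - cnj a * z)))"
    by (rule blaschke_factorization[OF G R0 nzG])
  define S1 where "S1 = (\<Sum>a | F a = 0 \<and> norm a \<le> R. of_nat (zord F a) * (1 / (z - a) + cnj a / (of_real (R\<^sup>2) - cnj a * z)))"
  define S2 where "S2 = (\<Sum>a | G a = 0 \<and> norm a \<le> R. of_nat (zord G a) * (1 / (z - a) + cnj a / (of_real (R\<^sup>2) - cnj a * z)))"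
  define k where "k = (\<lambda>z. k1 z - k2 z)"
  define R' where "R' = min R1 R2"
  have k: "k holomorphic_on ball 0 R'" unfolding k_def R'_def
    by (intro holomorphic_intros holomorphic_on_subset[OF k1(2)] holomorphic_on_subset[OF k2(2)]) auto
  have R': "R < R'" using k1 k2 by (simp add: R'_def)
  have zin: "z \<in> ball 0 R1" "z \<in> ball 0 R2" using zR k1(1) k2(1) by auto
  have "deriv k z = deriv k1 z - deriv k2 z"
    unfolding k_def
    by (rule DERIV_imp_deriv[OF DERIV_diff[OF holomorphic_derivI[OF k1(2) open_ball zin(1)]
        holomorphic_derivI[OF k2(2) open_ball zin(2)]]])
  then have eq: "deriv F z / F z - deriv G z / G z = deriv k z + (S1 - S2)"
    using k1(4)[rule_format, OF zR Fz] k2(4)[rule_format, OF zR Gz] by (simp add: S1_def S2_def)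
  have "circ_mean R (\<lambda>w. \<bar>Re (k w)\<bar>) = circ_mean R (\<lambda>w. \<bar>lnorm F w - lnorm G w\<bar>)"
    by (rule circ_mean_spike[OF R0, of "{}"]) (auto simp: k_def k1(3)[rule_format] k2(3)[rule_format])
  then have "norm (deriv k z) \<le> 2 * R / (R - norm z)\<^sup>2 * circ_mean R (\<lambda>w. \<bar>lnorm F w - lnorm G w\<bar>)"
    using norm_deriv_le_circle_mean[OF k R' zR] by simp
  also have "\<dots> \<le> 8 * circ_mean R (\<lambda>w. \<bar>lnorm F w - lnorm G w\<bar>)"
  proof (rule mult_right_mono)
    have "(R / 2)\<^sup>2 \<le> (R - norm z)\<^sup>2" using R z r by (intro power_mono) auto
    moreover have "R * 1 \<le> R * R" using R0 R r by (intro mult_left_mono) auto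
    moreover have "(R - norm z)\<^sup>2 > 0" using zR by simp
    ultimately show "2 * R / (R - norm z)\<^sup>2 \<le> 8"
      by (simp add: field_simps power2_eq_square)
    have "circ_mean R (\<lambda>_. 0) \<le> circ_mean R (\<lambda>w. \<bar>lnorm F w - lnorm G w\<bar>)"
      by (rule circ_mean_mono[OF R0 _ _ finite.emptyI])
         (auto intro!: circ_int_abs circ_int_diff circ_int_lnorm F G R0)
    then show "0 \<le> circ_mean R (\<lambda>w. \<bar>lnorm F w - lnorm G w\<bar>)" by simp
  qed
  finally have k8: "norm (deriv k z) \<le> 8 * circ_mean R (\<lambda>w. \<bar>lnorm F w - lnorm G w\<bar>)" .
  have tm: "norm (1 / (z - a) + cnj a / (of_real (R\<^sup>2) - cnj a * z)) \<le> 1 / norm (z - a) + 1"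
    if "norm a < R" for a
  proof -
    have "R * 1 \<le> R * (R - norm z)" using R z r R0 by (intro mult_left_mono) auto
    then have "R \<le> norm (of_real (R\<^sup>2) - cnj a * z)"
      using reflected_ge(2)[OF that, of z] zR by simp
    then have "norm (cnj a / (of_real (R\<^sup>2) - cnj a * z)) \<le> 1"
      using that R0 by (simp add: norm_divide divide_le_eq)
    then show ?thesis
      using norm_triangle_ineq[of "1 / (z - a)" "cnj a / (of_real (R\<^sup>2) - cnj a * z)"]
      by (simp add: norm_divide)
  qed
  have S: "norm (\<Sum>a | H a = 0 \<and> norm a \<le> R. of_nat (zord H a) * (1 / (z - a) + cnj a / (of_real (R\<^sup>2) - cnj a * z)))
     \<le> (\<Sum>a | H a = 0 \<and> norm a \<le> R. real (zord H a) * (1 / norm (z - a) + 1))"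
    if nzH: "\<And>z. norm z = R \<Longrightarrow> H z \<noteq> 0" for H
  proof (rule sum_norm_le)
    fix a assume "a \<in> {a. H a = 0 \<and> norm a \<le> R}"
    then have "norm a < R" using nzH[of a] by (auto simp: order_less_le)
    then show "norm (of_nat (zord H a) * (1 / (z - a) + cnj a / (of_real (R\<^sup>2) - cnj a * z)))
        \<le> real (zord H a) * (1 / norm (z - a) + 1)"
      unfolding norm_mult norm_of_nat by (intro mult_left_mono tm) auto
  qed
  have "norm (deriv k z + (S1 - S2)) \<le> norm (deriv k z) + (norm S1 + norm S2)"
    using norm_triangle_ineq[of "deriv k z" "S1 - S2"] norm_triangle_ineq4[of S1 S2] by linarith
  then show ?thesis
    using k8 S[of F, OF nzF] S[of G, OF nzG] unfolding eq S1_def[symmetric] S2_def[symmetric] by linarith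
qed

section \<open>Inverse square roots of distances integrated over circles\<close>

lemma has_integral_inverse_sqrt_dist:
  fixes \<beta> :: real
  shows "((\<lambda>t. 1 / sqrt \<bar>t - \<beta>\<bar>) has_integral 2 * sqrt (2*pi - \<beta>) - 2 * sqrt (0 - \<beta>)) {0..2*pi}"
\<comment> \<open>The root is an odd function here, \<open>sqrt (- x) = - sqrt x\<close>, so the one
  continuous antiderivative 2 sqrt(t - \<beta>) is valid on both sides of the singularity and for
  \<beta> outside the interval.\<close>
proof (rule fundamental_theorem_of_calculus_interior_strong[of "{\<beta>}" 0 "2*pi" "\<lambda>t. 2 * sqrt (t - \<beta>)"])
  fix t assume "t \<in> {0<..<2*pi} - {\<beta>}"
  then have ne: "t - \<beta> \<noteq> 0" by simp
  have "((\<lambda>t. sqrt (t - \<beta>)) has_real_derivative inverse (sqrt \<bar>t - \<beta>\<bar>) / 2 * 1) (at t)"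
  proof (rule DERIV_chain2[of sqrt])
    show "(sqrt has_real_derivative inverse (sqrt \<bar>t - \<beta>\<bar>) / 2) (at (t - \<beta>))"
      using real_sqrt_minus[of "t - \<beta>"] by (intro DERIV_real_sqrt_generic[OF ne]) auto
  qed (auto intro!: derivative_eq_intros)
  then have "((\<lambda>t. 2 * sqrt (t - \<beta>)) has_real_derivative 2 * (inverse (sqrt \<bar>t - \<beta>\<bar>) / 2 * 1)) (at t)"
    by (rule DERIV_cmult)
  then show "((\<lambda>t. 2 * sqrt (t - \<beta>)) has_vector_derivative 1 / sqrt \<bar>t - \<beta>\<bar>) (at t)"
    by (simp add: has_real_derivative_iff_has_vector_derivative inverse_eq_divide)
qed (auto intro!: continuous_intros)

lemma sin_ge_quarter: assumes "0 \<le> x" "x \<le> pi / 2" shows "x / 4 \<le> sin (x::real)"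
proof -
  have *: "y / 2 \<le> sin y" if y: "0 \<le> y" "y \<le> pi / 3" for y
  proof (cases "y = 0")
    case False
    then have "y > 0" using y by simp
    then obtain \<xi> where \<xi>: "0 < \<xi>" "\<xi> < y" "sin y - sin 0 = (y - 0) * cos \<xi>"
      using MVT2[of 0 y sin cos] by (auto intro: DERIV_sin)
    have "cos (pi / 3) \<le> cos \<xi>" by (rule cos_monotone_0_pi_le) (use \<xi> y pi_gt_zero in auto)
    then have "y * (1/2) \<le> y * cos \<xi>" using y by (intro mult_left_mono) (auto simp: cos_60)
    then show ?thesis using \<xi> by simp
  qed simp
  show ?thesis
  proof (cases "x \<le> pi / 3")
    case False
    have "sin (pi / 3) \<le> sin x" by (rule sin_monotone_2pi_le) (use False assms pi_gt_zero in auto)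
    then show ?thesis using *[of "pi / 3"] assms by simp
  qed (use * assms in force)
qed

text \<open>The angle is compared with the representative \<beta> of the argument of
  \<open>a\<close> within \<pi> of \<open>t\<close>. For a difference up to \<pi>/2 the component
  orthogonal to \<open>a\<close> is r |sin(t - \<beta>)|; beyond that the distance is at least r >=
  1, and \<pi>/4 < 1. The bound does not depend on |a|.\<close>

lemma circle_dist_lower:
  assumes r: "r \<ge> 1" and t: "t \<in> {0..2*pi}"
  obtains \<beta> where "\<beta> \<in> {Arg a, Arg a + 2*pi}" "\<bar>t - \<beta>\<bar> / 4 \<le> norm (of_real r * cis t - a)"
proof -
  define \<beta> where "\<beta> = (if t - Arg a \<le> pi then Arg a else Arg a + 2*pi)"
  define \<delta> where "\<delta> = t - \<beta>"
  have \<delta>: "\<bar>\<delta>\<bar> \<le> pi"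
    using t Arg_bounded[of a] by (auto simp: \<delta>_def \<beta>_def abs_le_iff)
  have cis: "cis \<beta> = cis (Arg a)" by (simp add: \<beta>_def cis_mult[symmetric])
  have a: "a = of_real (norm a) * cis \<beta>"
    unfolding cis by (metis rcis_cmod_Arg rcis_def)
  have "of_real r * cis t - a = cis \<beta> * (of_real r * cis \<delta> - of_real (norm a))"
  proof -
    have "cis t = cis \<beta> * cis \<delta>" by (simp add: cis_mult \<delta>_def)
    then show ?thesis by (subst a) (simp add: algebra_simps)
  qed
  then have n: "norm (of_real r * cis t - a) = norm (of_real r * cis \<delta> - of_real (norm a))"
    by (simp add: norm_mult)
  have "\<bar>\<delta>\<bar> / 4 \<le> norm (of_real r * cis \<delta> - of_real (norm a))"
  proof (cases "\<bar>\<delta>\<bar> \<le> pi / 2")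
    case True
    have "\<bar>\<delta>\<bar> / 4 \<le> sin \<bar>\<delta>\<bar>" using True by (intro sin_ge_quarter) auto
    also have "sin \<bar>\<delta>\<bar> \<le> \<bar>sin \<delta>\<bar>" by (cases "\<delta> \<ge> 0") auto
    also have "\<dots> \<le> \<bar>r * sin \<delta>\<bar>" using r by (simp add: abs_mult mult_le_cancel_right1)
    also have "\<dots> = \<bar>Im (of_real r * cis \<delta> - of_real (norm a))\<bar>" by simp
    also have "\<dots> \<le> norm (of_real r * cis \<delta> - of_real (norm a))" by (rule abs_Im_le_cmod)
    finally show ?thesis .
  next
    case False
    have c: "cos \<delta> \<le> 0"
    proof -
      have "cos \<bar>\<delta>\<bar> \<le> cos (pi / 2)" by (rule cos_monotone_0_pi_le) (use False \<delta> in auto)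
      then show ?thesis by simp
    qed
    have "1 \<le> r\<^sup>2" using r by simp
    also have "r\<^sup>2 = r\<^sup>2 * ((cos \<delta>)\<^sup>2 + (sin \<delta>)\<^sup>2)" by simp
    also have "\<dots> \<le> r\<^sup>2 * ((cos \<delta>)\<^sup>2 + (sin \<delta>)\<^sup>2) + (norm a)\<^sup>2 + 2 * (r * norm a * (- cos \<delta>))"
    proof -
      have "0 \<le> r * norm a * (- cos \<delta>)" using r c by (intro mult_nonneg_nonneg) auto
      moreover have "0 \<le> (norm a)\<^sup>2" by simp
      ultimately show ?thesis by linarith
    qed
    also have "\<dots> = (norm (of_real r * cis \<delta> - of_real (norm a)))\<^sup>2"
      unfolding cmod_power2[of "of_real r * cis \<delta> - of_real (norm a)"]
      by (simp add: power2_diff power_mult_distrib algebra_simps del: sin_cos_squared_add sin_cos_squared_add2)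
    finally have "1 \<le> norm (of_real r * cis \<delta> - of_real (norm a))"
      using power2_le_imp_le[of 1 "norm (of_real r * cis \<delta> - of_real (norm a))"] by simp
    moreover have "\<bar>\<delta>\<bar> / 4 \<le> 1" using \<delta> pi_less_4 by simp
    ultimately show ?thesis by linarith
  qed
  then show thesis using that[of \<beta>] unfolding n by (auto simp: \<delta>_def \<beta>_def)
qed

text \<open>There are two singular angles, \<open>Arg a\<close> and \<open>Arg a + 2*pi\<close>.
  Each enters with weight 2, the root of the 4 in the lower bound of the distance, and an integral
  of at most 4 sqrt(3 pi).\<close>

definition circle_const :: real where "circle_const = 16 * sqrt (3 * pi)"

lemma circle_const_nonneg: "circle_const \<ge> 0" by (simp add: circle_const_def)

text \<open>The dominating function depends only on the argument of \<open>a\<close>, so one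
  integral bound serves all points \<open>a\<close> and all radii \<open>r \<ge> 1\<close>.\<close>

lemma inverse_sqrt_dist_dominated:
  fixes a :: complex
  obtains V I S where "(V has_integral I) {0..2*pi}" "I \<le> circle_const" "finite S" "\<And>t. V t \<ge> 0"
    "\<And>r t. r \<ge> 1 \<Longrightarrow> t \<in> {0..2*pi} \<Longrightarrow> t \<notin> S \<Longrightarrow> 1 / sqrt (norm (of_real r * cis t - a)) \<le> V t"
proof -
  define V where "V = (\<lambda>t. 2 * (1 / sqrt \<bar>t - Arg a\<bar>) + 2 * (1 / sqrt \<bar>t - (Arg a + 2*pi)\<bar>))"
  define J where "J = (\<lambda>\<beta>. 2 * sqrt (2*pi - \<beta>) - 2 * sqrt (0 - \<beta>))"
  have J: "J \<beta> \<le> 4 * sqrt (3 * pi)" if "-pi \<le> \<beta>" "\<beta> \<le> 3 * pi" for \<beta>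
  proof -
    have "sqrt (2*pi - \<beta>) \<le> sqrt (3 * pi)" "sqrt (\<beta> - 0) \<le> sqrt (3 * pi)"
      using that by (auto intro!: real_sqrt_le_mono)
    moreover have "sqrt (0 - \<beta>) = - sqrt (\<beta> - 0)" by (simp add: real_sqrt_minus)
    ultimately show ?thesis unfolding J_def by linarith
  qed
  have "(V has_integral 2 * J (Arg a) + 2 * J (Arg a + 2*pi)) {0..2*pi}"
    unfolding V_def J_def by (intro has_integral_add has_integral_mult_right has_integral_inverse_sqrt_dist)
  moreover have "2 * J (Arg a) + 2 * J (Arg a + 2*pi) \<le> circle_const"
  proof -
    have "J (Arg a) \<le> 4 * sqrt (3 * pi)" "J (Arg a + 2*pi) \<le> 4 * sqrt (3 * pi)"
      by (intro J; use Arg_bounded[of a] in linarith)+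
    then show ?thesis by (simp add: circle_const_def)
  qed
  moreover have "1 / sqrt (norm (of_real r * cis t - a)) \<le> V t"
    if r: "r \<ge> 1" and t: "t \<in> {0..2*pi}" "t \<notin> {Arg a, Arg a + 2*pi}" for r t
  proof -
    obtain \<beta> where \<beta>: "\<beta> \<in> {Arg a, Arg a + 2*pi}" "\<bar>t - \<beta>\<bar> / 4 \<le> norm (of_real r * cis t - a)"
      using circle_dist_lower[OF r t(1)] by metis
    have pos: "\<bar>t - \<beta>\<bar> > 0" using \<beta>(1) t(2) by auto
    have "1 / sqrt (norm (of_real r * cis t - a)) \<le> 1 / sqrt (\<bar>t - \<beta>\<bar> / 4)"
      using pos \<beta>(2) by (intro divide_left_mono real_sqrt_le_mono mult_pos_pos) auto
    also have "\<dots> = 2 * (1 / sqrt \<bar>t - \<beta>\<bar>)" by (simp add: real_sqrt_divide)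
    also have "\<dots> \<le> V t" using \<beta>(1) by (auto simp: V_def)
    finally show ?thesis .
  qed
  ultimately show thesis
    by (intro that[of V _ "{Arg a, Arg a + 2*pi}"]) (auto simp: V_def)
qed

text \<open>The bound passes through \<open>1 + S \<le> (1 + sqrt S)\<^sup>2\<close> for the sum \<open>S\<close>, because \<open>sqrt S\<close>, unlike
  \<open>S\<close>, has a finite mean over a circle that meets \<open>Z\<close>.\<close>

lemma circ_mean_log_plus_sum_le:
  assumes X: "circ_int r (\<lambda>z. max 0 (X z))" and r: "r \<ge> 1" and Z: "finite Z" and Q: "Q \<ge> 0" and S: "finite S"
    and le: "\<And>z. norm z = r \<Longrightarrow> z \<notin> S \<Longrightarrow> X z \<le> ln (1 + (Q + (\<Sum>a\<in>Z. real (\<nu> a) / norm (z - a))))"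
  shows "circ_mean r (\<lambda>z. max 0 (X z)) \<le> 2 * ln (1 + (sqrt Q + circle_const * real (\<Sum>a\<in>Z. \<nu> a)))"
proof -
  have "\<forall>a. \<exists>V I T. (V has_integral I) {0..2*pi} \<and> I \<le> circle_const \<and> finite T \<and> (\<forall>t. V t \<ge> 0) \<and>
    (\<forall>r t. r \<ge> 1 \<longrightarrow> t \<in> {0..2*pi} \<longrightarrow> t \<notin> T \<longrightarrow> 1 / sqrt (norm (of_real r * cis t - a)) \<le> V t)"
    using inverse_sqrt_dist_dominated by (metis (no_types, lifting))
  then obtain V I T where V: "\<And>a. (V a has_integral I a) {0..2*pi}" "\<And>a. I a \<le> circle_const"
    "\<And>a. finite (T a)" "\<And>a t. V a t \<ge> (0::real)"
    "\<And>a r t. r \<ge> 1 \<Longrightarrow> t \<in> {0..2*pi} \<Longrightarrow> t \<notin> T a \<Longrightarrow> 1 / sqrt (norm (of_real r * cis t - a)) \<le> V a t"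
    by metis
  define W where "W = (\<lambda>t. sqrt Q + (\<Sum>a\<in>Z. real (\<nu> a) * V a t))"
  define M where "M = sqrt Q + circle_const * real (\<Sum>a\<in>Z. \<nu> a)"
  have M: "M \<ge> 0" unfolding M_def using Q circle_const_nonneg
    by (intro add_nonneg_nonneg mult_nonneg_nonneg real_sqrt_ge_zero of_nat_0_le_iff)
  define E where "E = {t \<in> {0..2*pi}. of_real r * cis t \<in> S \<union> Z} \<union> (\<Union>a\<in>Z. T a)"
  have E: "finite E" unfolding E_def using finite_cis_vimage[of r "S \<union> Z"] r S Z V(3) by simp
  have Wint: "(W has_integral 2 * pi * sqrt Q + (\<Sum>a\<in>Z. real (\<nu> a) * I a)) {0..2*pi}"
    unfolding W_def using has_integral_const_real[of "sqrt Q" 0 "2*pi"]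
    by (intro has_integral_add has_integral_sum Z has_integral_mult_right V(1)) (simp add: mult_ac)
  have pw: "max 0 (X (of_real r * cis t)) \<le> 2 * (ln (1 + M) + (W t - M) / (1 + M))"
    if t: "t \<in> {0..2*pi} - E" for t
  proof -
    define z where "z = of_real r * cis t"
    have z: "norm z = r" "z \<notin> S" "z \<notin> Z" using t r by (auto simp: z_def norm_mult E_def)
    define s where "s = Q + (\<Sum>a\<in>Z. real (\<nu> a) / norm (z - a))"
    have s0: "s \<ge> 0" using Q by (auto simp: s_def intro!: add_nonneg_nonneg sum_nonneg)
    have W0: "W t \<ge> 0" unfolding W_def using Q V(4) by (intro add_nonneg_nonneg sum_nonneg mult_nonneg_nonneg) auto
    have tm: "real (\<nu> a) / norm (z - a) \<le> (real (\<nu> a) * V a t)\<^sup>2" if a: "a \<in> Z" for a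
    proof -
      have "1 / sqrt (norm (z - a)) \<le> V a t" unfolding z_def by (rule V(5)) (use a t r in \<open>auto simp: E_def\<close>)
      then have "(1 / sqrt (norm (z - a)))\<^sup>2 \<le> (V a t)\<^sup>2" by (intro power_mono) auto
      then have "1 / norm (z - a) \<le> (V a t)\<^sup>2" by (simp add: power_divide)
      \<comment> \<open>True because the multiplicity is a natural number; it lets the multiplicity
        move inside the square.\<close>
      moreover have "real (\<nu> a) \<le> (real (\<nu> a))\<^sup>2"
        unfolding of_nat_power[symmetric] of_nat_le_iff by (simp add: power2_eq_square)
      ultimately have "real (\<nu> a) * (1 / norm (z - a)) \<le> (real (\<nu> a))\<^sup>2 * (V a t)\<^sup>2"
        by (intro mult_mono) auto
      then show ?thesis by (simp add: power_mult_distrib)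
    qed
    have sumsq: "(\<Sum>a\<in>Z. (f a)\<^sup>2) \<le> (\<Sum>a\<in>Z. f a)\<^sup>2" if "\<And>a. f a \<ge> 0" for f :: "complex \<Rightarrow> real"
      using Z
    proof (induction Z)
      case (insert a Z)
      have "0 \<le> f a * (\<Sum>a\<in>Z. f a)" using that by (intro mult_nonneg_nonneg sum_nonneg)
      then show ?case using insert by (simp add: power2_sum)
    qed simp
    have "s \<le> (sqrt Q)\<^sup>2 + (\<Sum>a\<in>Z. (real (\<nu> a) * V a t)\<^sup>2)"
      unfolding s_def using tm Q by (auto intro!: add_mono sum_mono)
    also have "\<dots> \<le> (sqrt Q)\<^sup>2 + (\<Sum>a\<in>Z. real (\<nu> a) * V a t)\<^sup>2"
      using sumsq[of "\<lambda>a. real (\<nu> a) * V a t"] V(4) by simp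
    also have "\<dots> \<le> (W t)\<^sup>2"
    proof -
      have "0 \<le> sqrt Q * (\<Sum>a\<in>Z. real (\<nu> a) * V a t)" using V(4) Q by (intro mult_nonneg_nonneg sum_nonneg) auto
      then show ?thesis unfolding W_def by (simp add: power2_sum)
    qed
    finally have sW: "s \<le> (W t)\<^sup>2" .
    have "X z \<le> ln (1 + s)" using le[OF z(1,2)] by (simp add: s_def)
    moreover have "0 \<le> ln (1 + s)" using s0 by simp
    ultimately have "max 0 (X z) \<le> ln (1 + s)" by simp
    also have "\<dots> \<le> ln ((1 + W t)\<^sup>2)"
      using sW s0 W0 by (intro ln_mono) (auto simp: power2_sum)
    also have "\<dots> = 2 * ln (1 + W t)" using W0 by (simp add: ln_realpow)
    \<comment> \<open>The tangent of ln(1 + x) at \<open>M\<close> lies above the graph. Its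
      integral gives Jensen's inequality for the concave logarithm, with \<open>M\<close> an upper
      bound for the mean of \<open>W\<close>.\<close>
    also have "ln (1 + W t) \<le> ln (1 + M) + (W t - M) / (1 + M)"
    proof -
      have "ln ((1 + W t) / (1 + M)) \<le> (1 + W t) / (1 + M) - 1"
        using W0 M by (intro ln_le_minus_one) auto
      also have "\<dots> = (W t - M) / (1 + M)" using M by (simp add: field_simps)
      finally show ?thesis using W0 M by (simp add: ln_div)
    qed
    finally show ?thesis by (simp add: z_def)
  qed
  define J where "J = 2 * pi * sqrt Q + (\<Sum>a\<in>Z. real (\<nu> a) * I a)"
  have JM: "J \<le> 2 * pi * M"
  proof -
    have "(\<Sum>a\<in>Z. real (\<nu> a) * I a) \<le> (\<Sum>a\<in>Z. real (\<nu> a) * circle_const)"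
      by (intro sum_mono mult_left_mono V(2)) auto
    also have "\<dots> = circle_const * real (\<Sum>a\<in>Z. \<nu> a)" by (simp add: sum_distrib_left mult.commute)
    also have "1 * \<dots> \<le> 2 * pi * (circle_const * real (\<Sum>a\<in>Z. \<nu> a))"
      using pi_ge_two by (intro mult_right_mono mult_nonneg_nonneg circle_const_nonneg of_nat_0_le_iff) auto
    finally show ?thesis by (simp add: J_def M_def algebra_simps)
  qed
  have R: "((\<lambda>t. 2 * (ln (1 + M) + (W t - M) / (1 + M))) has_integral
      2 * (2 * pi * ln (1 + M) + (J - 2 * pi * M) / (1 + M))) {0..2*pi}"
    using has_integral_const_real[of "ln (1 + M)" 0 "2*pi"] has_integral_const_real[of M 0 "2*pi"] Wint[folded J_def]
    by (intro has_integral_mult_right has_integral_add has_integral_divide has_integral_diff) (auto simp: mult_ac)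
  have L: "((\<lambda>t. max 0 (X (of_real r * cis t))) has_integral 2 * pi * circ_mean r (\<lambda>z. max 0 (X z))) {0..2*pi}"
    using circ_int_imp_integrable[OF X] by (simp add: circ_mean_def has_integral_iff)
  have "((\<lambda>t. if t \<in> E then max 0 (X (of_real r * cis t)) else 2 * (ln (1 + M) + (W t - M) / (1 + M))) has_integral
      2 * (2 * pi * ln (1 + M) + (J - 2 * pi * M) / (1 + M))) {0..2*pi}"
    by (rule has_integral_spike_finite[OF E _ R]) auto
  then have "2 * pi * circ_mean r (\<lambda>z. max 0 (X z)) \<le> 2 * (2 * pi * ln (1 + M) + (J - 2 * pi * M) / (1 + M))"
    by (rule has_integral_le[OF L]) (use pw in auto)
  also have "(J - 2 * pi * M) / (1 + M) \<le> 0" using JM M by (intro divide_nonpos_nonneg) auto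
  finally show ?thesis by (simp add: M_def)
qed

text \<open>A zero of modulus at most \<open>R\<close> has weight at least ln 2 in the counting
  function at radius 2R; for the zero at the origin this uses R >= 1.\<close>

lemma zero_count_le_Ncount:
  assumes F: "entire_nz F" and R: "R \<ge> 1"
  shows "real (\<Sum>a | F a = 0 \<and> norm a \<le> R. zord F a) * ln 2 \<le> Ncount (zord F) (2 * R)"
proof -
  have Z: "finite {a. F a = 0 \<and> norm a \<le> 2 * R}" by (rule entire_nz_finite_zeros[OF F])
  have "real (\<Sum>a | F a = 0 \<and> norm a \<le> R. zord F a) * ln 2
      = (\<Sum>a | F a = 0 \<and> norm a \<le> R. real (zord F a) * ln 2)"
    by (simp add: sum_distrib_right)
  also have "\<dots> \<le> (\<Sum>a | F a = 0 \<and> norm a \<le> R. real (zord F a) * (if a = 0 then ln (2 * R) else ln (2 * R / norm a)))"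
  proof (intro sum_mono mult_left_mono)
    fix a assume a: "a \<in> {a. F a = 0 \<and> norm a \<le> R}"
    show "ln 2 \<le> (if a = 0 then ln (2 * R) else ln (2 * R / norm a))"
      using a R by (auto simp: field_simps intro!: ln_mono)
  qed auto
  also have "\<dots> \<le> (\<Sum>a | F a = 0 \<and> norm a \<le> 2 * R. real (zord F a) * (if a = 0 then ln (2 * R) else ln (2 * R / norm a)))"
    using R by (intro sum_mono2[OF Z] mult_nonneg_nonneg Ncount_weight_nonneg) auto
  also have "\<dots> = Ncount (zord F) (2 * R)"
    by (rule Ncount_superset[OF Z, symmetric]) (auto simp: zord_def split: if_splits)
  finally show ?thesis .
qed

text \<open>As W / (F G) = G'/G - F'/F, the mean is that of log+ of a difference of logarithmic
  derivatives. Polynomial growth bounds the number of zeros and the mean of |log|F/G|| at a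
  comparable radius by O(r^K), and the logarithm turns this into O(log r) for every
  \<open>r \<ge> 1\<close>.\<close>

lemma lemma_on_the_logarithmic_derivative:
  fixes C :: real and K :: nat
  assumes F: "entire_nz F" and G: "entire_nz G"
    and W: "entire_nz (\<lambda>z. F z * deriv G z - deriv F z * G z)"
    and growth: "\<And>r. r \<ge> 1 \<Longrightarrow> circ_mean r (\<lambda>z. max (lnorm F z) (lnorm G z)) \<le> C * r ^ K"
  obtains B where "\<And>r. r \<ge> 1 \<Longrightarrow>
    circ_mean r (\<lambda>z. max 0 (lnorm (\<lambda>z. F z * deriv G z - deriv F z * G z) z - lnorm F z - lnorm G z)) \<le> B * (1 + ln r)"
proof -
  define W' where "W' = (\<lambda>z. F z * deriv G z - deriv F z * G z)"
  have W': "entire_nz W'" using W by (simp add: W'_def)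
  obtain CF where CF: "\<And>r. r > 0 \<Longrightarrow> circ_mean r (lnorm F) = Ncount (zord F) r + CF"
    using jensen[OF F] by metis
  obtain CG where CG: "\<And>r. r > 0 \<Longrightarrow> circ_mean r (lnorm G) = Ncount (zord G) r + CG"
    using jensen[OF G] by metis
  define D where "D = \<bar>C\<bar> + \<bar>CF\<bar> + \<bar>CG\<bar>"
  have D: "D \<ge> 0" by (simp add: D_def)
  \<comment> \<open>With T = (6r)^K below, \<open>A\<close> is at most 2 D T and the number of zeros
    at most 4 D T, so Q is at most 8 * 2 D T + 4 D T = 20 D T. The inequality sqrt Q <= 1 + Q costs
    another 1, and the 2 absorbs both ones because T >= 1.\<close>
  define E where "E = 2 + 20 * D + 4 * circle_const * D"
  have E: "E \<ge> 2" using D circle_const_nonneg by (simp add: E_def)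
  define B where "B = 2 * (ln E + real K * ln 6 + real K)"
  have "circ_mean r (\<lambda>z. max 0 (lnorm W' z - lnorm F z - lnorm G z)) \<le> B * (1 + ln r)" if r: "r \<ge> 1" for r
  proof -
    \<comment> \<open>The circle of radius R must be free of zeros for the Blaschke factors, at a
      distance comparable to \<open>r\<close>, and such that 2R, where the zeros are counted, stays
      below 6r.\<close>
    have "\<exists>R. 2 * r < R \<and> R < 3 * r \<and> (\<forall>z. norm z = R \<longrightarrow> F z \<noteq> 0) \<and> (\<forall>z. norm z = R \<longrightarrow> G z \<noteq> 0)"
    proof (rule entire_nz_no_zeros_on_circle[of UNIV "\<lambda>b. if b then F else G" "2 * r" "3 * r"])
      fix R assume *: "2 * r < R" "R < 3 * r" "\<And>i z. i \<in> UNIV \<Longrightarrow> norm z = R \<Longrightarrow> (if i then F else G) z \<noteq> 0"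
      show ?thesis using *(1,2) *(3)[of True] *(3)[of False] by (intro exI[of _ R]) auto
    qed (use F G r in auto)
    then obtain R where R: "2 * r < R" "R < 3 * r"
      and nzF: "\<And>z. norm z = R \<Longrightarrow> F z \<noteq> 0" and nzG: "\<And>z. norm z = R \<Longrightarrow> G z \<noteq> 0"
      by metis
    have R1: "R \<ge> 1" using R r by simp
    define T where "T = (6 * r) ^ K"
    have T1: "T \<ge> 1" unfolding T_def using r by (intro one_le_power) simp
    have pT: "s ^ K \<le> T" if "0 \<le> s" "s \<le> 6 * r" for s
      unfolding T_def using that by (intro power_mono) auto
    have iF: "circ_int s (lnorm F)" and iG: "circ_int s (lnorm G)" and iW: "circ_int s (lnorm W')" if "s > 0" for s
      using circ_int_lnorm F G W' that by auto
    have imax: "circ_int s (\<lambda>z. max (lnorm F z) (lnorm G z))" if "s > 0" for s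
      using iF iG that by (intro circ_int_max)
    have mx: "circ_mean s (\<lambda>z. max (lnorm F z) (lnorm G z)) \<le> \<bar>C\<bar> * T" if "1 \<le> s" "s \<le> 6 * r" for s
    proof -
      have "C * s ^ K \<le> \<bar>C\<bar> * T" using that pT[of s] by (intro mult_mono) auto
      then show ?thesis using growth[OF that(1)] by linarith
    qed
    have CT: "\<bar>CF\<bar> \<le> \<bar>CF\<bar> * T" "\<bar>CG\<bar> \<le> \<bar>CG\<bar> * T" "0 \<le> \<bar>C\<bar> * T"
      using T1 mult_left_mono[of 1 T "\<bar>CF\<bar>"] mult_left_mono[of 1 T "\<bar>CG\<bar>"] by auto
    have DT: "D * T = \<bar>C\<bar> * T + \<bar>CF\<bar> * T + \<bar>CG\<bar> * T" by (simp add: D_def algebra_simps)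
    define A where "A = circ_mean R (\<lambda>w. \<bar>lnorm F w - lnorm G w\<bar>)"
    have A: "A \<le> 2 * (D * T)"
    proof -
      \<comment> \<open>The maximum is bounded by the growth hypothesis, while Jensen's formula
        bounds the two subtracted means from below by constants.\<close>
      have "(\<lambda>w. \<bar>lnorm F w - lnorm G w\<bar>) = (\<lambda>w. 2 * max (lnorm F w) (lnorm G w) - lnorm F w - lnorm G w)"
        by (auto simp: fun_eq_iff max_def)
      then have "A = 2 * circ_mean R (\<lambda>z. max (lnorm F z) (lnorm G z)) - circ_mean R (lnorm F) - circ_mean R (lnorm G)"
        unfolding A_def using R1 iF iG imax
        by (simp add: circ_mean_diff circ_int_diff circ_int_cmult circ_mean_cmult)
      also have "\<dots> \<le> 2 * (\<bar>C\<bar> * T) + \<bar>CF\<bar> + \<bar>CG\<bar>"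
        using mx[of R] R R1 r CF[of R] CG[of R] Ncount_nonneg[OF R1, of "zord F"] Ncount_nonneg[OF R1, of "zord G"]
        by (simp add: abs_if)
      finally show ?thesis using CT DT by linarith
    qed
    have A0: "A \<ge> 0"
    proof -
      have "circ_mean R (\<lambda>_. 0) \<le> A" unfolding A_def
        by (rule circ_mean_mono[OF _ _ _ finite.emptyI]) (use R1 iF iG in \<open>auto intro!: circ_int_abs circ_int_diff\<close>)
      then show ?thesis by simp
    qed
    define ZF ZG where "ZF = {a. F a = 0 \<and> norm a \<le> R}" and "ZG = {a. G a = 0 \<and> norm a \<le> R}"
    have fin: "finite ZF" "finite ZG" unfolding ZF_def ZG_def using entire_nz_finite_zeros F G by auto
    have l2: "ln (2::real) \<ge> 1 / 2" using ln2_ge_two_thirds by simp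
    have half: "x \<le> 2 * (D * T)" if "x * ln 2 \<le> D * T" "x \<ge> 0" for x
    proof -
      have "x * (1 / 2) \<le> x * ln 2" using that l2 by (intro mult_left_mono) auto
      then show ?thesis using that by simp
    qed
    have nF: "real (\<Sum>a\<in>ZF. zord F a) \<le> 2 * (D * T)"
    proof (rule half)
      have "circ_mean (2 * R) (lnorm F) \<le> circ_mean (2 * R) (\<lambda>z. max (lnorm F z) (lnorm G z))"
        by (rule circ_mean_mono[OF _ _ _ finite.emptyI]) (use R1 iF imax in auto)
      then have "Ncount (zord F) (2 * R) \<le> \<bar>C\<bar> * T + \<bar>CF\<bar>"
        using CF[of "2 * R"] mx[of "2 * R"] R R1 by (simp add: abs_if)
      then show "real (\<Sum>a\<in>ZF. zord F a) * ln 2 \<le> D * T"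
        using zero_count_le_Ncount[OF F R1] CT DT unfolding ZF_def by linarith
    qed (rule of_nat_0_le_iff)
    have nG: "real (\<Sum>a\<in>ZG. zord G a) \<le> 2 * (D * T)"
    proof (rule half)
      have "circ_mean (2 * R) (lnorm G) \<le> circ_mean (2 * R) (\<lambda>z. max (lnorm F z) (lnorm G z))"
        by (rule circ_mean_mono[OF _ _ _ finite.emptyI]) (use R1 iG imax in auto)
      then have "Ncount (zord G) (2 * R) \<le> \<bar>C\<bar> * T + \<bar>CG\<bar>"
        using CG[of "2 * R"] mx[of "2 * R"] R R1 by (simp add: abs_if)
      then show "real (\<Sum>a\<in>ZG. zord G a) * ln 2 \<le> D * T"
        using zero_count_le_Ncount[OF G R1] CT DT unfolding ZG_def by linarith
    qed (rule of_nat_0_le_iff)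
    define Z where "Z = ZF \<union> ZG"
    define \<nu> where "\<nu> = (\<lambda>a. zord F a + zord G a)"
    have Z: "finite Z" using fin by (simp add: Z_def)
    have sumF: "(\<Sum>a\<in>ZF. real (zord F a) * h a) = (\<Sum>a\<in>Z. real (zord F a) * h a)"
      and sumG: "(\<Sum>a\<in>ZG. real (zord G a) * h a) = (\<Sum>a\<in>Z. real (zord G a) * h a)" for h :: "complex \<Rightarrow> real"
      by (rule sum.mono_neutral_left; use Z in \<open>auto simp: Z_def ZF_def ZG_def zord_def\<close>)+
    have n\<nu>: "real (\<Sum>a\<in>Z. \<nu> a) = real (\<Sum>a\<in>ZF. zord F a) + real (\<Sum>a\<in>ZG. zord G a)"
      using sumF[of "\<lambda>_. 1"] sumG[of "\<lambda>_. 1"] by (simp add: \<nu>_def sum.distrib)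
    define Q where "Q = 8 * A + real (\<Sum>a\<in>Z. \<nu> a)"
    have Q: "Q \<ge> 0" unfolding Q_def using A0 by (intro add_nonneg_nonneg of_nat_0_le_iff) auto
    have "circ_mean r (\<lambda>z. max 0 (lnorm W' z - lnorm F z - lnorm G z))
      \<le> 2 * ln (1 + (sqrt Q + circle_const * real (\<Sum>a\<in>Z. \<nu> a)))"
    proof (rule circ_mean_log_plus_sum_le)
      show "circ_int r (\<lambda>z. max 0 (lnorm W' z - lnorm F z - lnorm G z))"
        using iF iG iW r by (intro circ_int_max circ_int_diff circ_int_const) auto
      show "finite ({z. F z = 0 \<and> norm z \<le> r} \<union> {z. G z = 0 \<and> norm z \<le> r} \<union> {z. W' z = 0 \<and> norm z \<le> r})"
        using entire_nz_finite_zeros F G W' by auto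
      fix z assume z: "norm z = r"
        "z \<notin> {z. F z = 0 \<and> norm z \<le> r} \<union> {z. G z = 0 \<and> norm z \<le> r} \<union> {z. W' z = 0 \<and> norm z \<le> r}"
      then have nz: "F z \<noteq> 0" "G z \<noteq> 0" "W' z \<noteq> 0" by auto
      define Y where "Y = norm (deriv F z / F z - deriv G z / G z)"
      have "W' z / (F z * G z) = - (deriv F z / F z - deriv G z / G z)"
        using nz by (simp add: W'_def field_simps)
      then have "norm (W' z) / (norm (F z) * norm (G z)) = Y"
        unfolding Y_def by (metis norm_divide norm_minus_cancel norm_mult)
      then have Y: "lnorm W' z - lnorm F z - lnorm G z = ln Y" "Y > 0"
        using nz by (auto simp: ln_div ln_mult)
      have "Y \<le> 8 * A + (\<Sum>a\<in>ZF. real (zord F a) * (1 / norm (z - a) + 1))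
           + (\<Sum>a\<in>ZG. real (zord G a) * (1 / norm (z - a) + 1))"
        unfolding Y_def A_def ZF_def ZG_def
        by (rule norm_logderiv_diff_le[OF F G z(1) r _ nzF nzG nz(1,2)]) (use R in auto)
      also have "\<dots> = Q + (\<Sum>a\<in>Z. real (\<nu> a) / norm (z - a))"
        unfolding sumF sumG by (simp add: Q_def \<nu>_def sum.distrib algebra_simps add_divide_distrib)
      finally have "Y \<le> 1 + (Q + (\<Sum>a\<in>Z. real (\<nu> a) / norm (z - a)))" by simp
      then show "lnorm W' z - lnorm F z - lnorm G z \<le> ln (1 + (Q + (\<Sum>a\<in>Z. real (\<nu> a) / norm (z - a))))"
        unfolding Y(1) using Y(2) by (intro ln_mono) auto
    qed (use r Z Q in auto)
    also have "1 + (sqrt Q + circle_const * real (\<Sum>a\<in>Z. \<nu> a)) \<le> E * T"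
    proof -
      have "sqrt Q \<le> 1 + Q"
        using Q by (intro real_le_lsqrt) (auto simp: power2_eq_square algebra_simps)
      moreover have \<nu>4: "real (\<Sum>a\<in>Z. \<nu> a) \<le> 4 * (D * T)" using n\<nu> nF nG by linarith
      moreover have "Q \<le> 20 * (D * T)" using A \<nu>4 unfolding Q_def by linarith
      moreover have "circle_const * real (\<Sum>a\<in>Z. \<nu> a) \<le> circle_const * (4 * (D * T))"
        using \<nu>4 circle_const_nonneg by (rule mult_left_mono)
      ultimately have "1 + (sqrt Q + circle_const * real (\<Sum>a\<in>Z. \<nu> a)) \<le> 2 * T + 20 * (D * T) + circle_const * (4 * (D * T))"
        using T1 by linarith
      also have "\<dots> = E * T" by (simp add: E_def algebra_simps)
      finally show ?thesis .
    qed
    then have "ln (1 + (sqrt Q + circle_const * real (\<Sum>a\<in>Z. \<nu> a))) \<le> ln (E * T)"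
    proof (intro ln_mono)
      have "0 \<le> sqrt Q + circle_const * real (\<Sum>a\<in>Z. \<nu> a)"
        using Q circle_const_nonneg by (intro add_nonneg_nonneg mult_nonneg_nonneg real_sqrt_ge_zero of_nat_0_le_iff)
      then show "0 < 1 + (sqrt Q + circle_const * real (\<Sum>a\<in>Z. \<nu> a))" by linarith
    qed
    also have "ln (E * T) = ln E + real K * (ln 6 + ln r)"
      using E r by (simp add: T_def ln_mult ln_realpow distrib_left)
    also have "2 * \<dots> \<le> B * (1 + ln r)"
    proof -
      have "0 \<le> ln E * ln r" "0 \<le> real K * ln 6 * ln r" using E r by (auto intro!: mult_nonneg_nonneg)
      then show ?thesis by (simp add: B_def algebra_simps)
    qed
    finally show ?thesis by simp
  qed
  then show thesis using that unfolding W'_def by blast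
qed

section \<open>Circle means of subharmonic functions under translation\<close>

text \<open>The logarithm of the norm of the homogeneous coordinates (g, h) of g/h; its circle mean
  is Cartan's form of the characteristic.\<close>

definition log_max :: "(complex \<Rightarrow> complex) \<Rightarrow> (complex \<Rightarrow> complex) \<Rightarrow> complex \<Rightarrow> real" where
  "log_max g h z = ln (max (norm (g z)) (norm (h z)))"

locale coprime_entire =
  fixes g h :: "complex \<Rightarrow> complex"
  assumes g: "entire_nz g" and h: "entire_nz h" and coprime: "g z \<noteq> 0 \<or> h z \<noteq> 0"
begin

abbreviation "u \<equiv> log_max g h"
abbreviation "D r \<equiv> circ_mean r u"

lemma max_pos: "max (norm (g z)) (norm (h z)) > 0"
  using coprime[of z] by (auto simp: less_max_iff_disj)

lemma continuous_u [continuous_intros]: "continuous_on A u"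
proof -
  have "continuous_on A g" "continuous_on A h"
    using g h by (auto intro: holomorphic_on_imp_continuous_on entire_nz_holomorphic)
  then show ?thesis
    unfolding log_max_def using max_pos
    by (intro continuous_on_ln continuous_on_max continuous_on_norm) (auto simp: less_imp_neq[THEN not_sym])
qed

lemma circ_int_u: "circ_int r u" and circ_int_u_shift: "circ_int r (\<lambda>z. u (z + c))"
  by (intro circ_int_continuous continuous_u)
     (intro circ_int_continuous continuous_on_compose2[OF continuous_u[of UNIV]] continuous_intros; simp)

lemma lnorm_le_u: "g z \<noteq> 0 \<Longrightarrow> lnorm g z \<le> u z" "h z \<noteq> 0 \<Longrightarrow> lnorm h z \<le> u z"
  unfolding log_max_def by (auto intro!: ln_mono)

lemma u_cases: obtains "g z \<noteq> 0" "u z = lnorm g z" | "h z \<noteq> 0" "u z = lnorm h z"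
proof (cases "norm (g z) \<le> norm (h z)")
  case True
  then have "h z \<noteq> 0" using coprime[of z] by auto
  with True show thesis using that(2) by (simp add: log_max_def max_def)
next
  case False
  then have "g z \<noteq> 0" by auto
  with False show thesis using that(1) by (simp add: log_max_def max_def)
qed

text \<open>\<open>\<Phi>\<close> is the Schwarz integral of \<open>u\<close> over the circle, so
  its real part is the Poisson integral. For F = g and F = h the Blaschke majorant Re k has boundary
  values log|F|, at most \<open>u\<close>, and is the Poisson integral of them; hence log|F| <= Re k
  <= Re \<Phi>. No boundary limits of \<open>\<Phi>\<close> are involved.\<close>

lemma harmonic_majorant:
  assumes R: "R > 0" and nz: "\<forall>z. norm z = R \<longrightarrow> g z \<noteq> 0 \<and> h z \<noteq> 0"
  obtains \<Phi> where "\<Phi> holomorphic_on ball 0 R" "\<forall>z. norm z < R \<longrightarrow> u z \<le> Re (\<Phi> z)" "Re (\<Phi> 0) = D R"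
proof -
  have nzg: "g z \<noteq> 0" and nzh: "h z \<noteq> 0" if "norm z = R" for z using nz that by auto
  define w where "w = (\<lambda>t. of_real R * cis t)"
  have w: "norm (w t) = R" for t using R by (simp add: w_def norm_mult)
  have wne: "w t \<noteq> z" if "norm z < R" for t z using w[of t] that by auto
  have wc: "continuous_on A w" for A unfolding w_def by (intro continuous_intros)
  have uc: "continuous_on A (\<lambda>t. u (w t))" for A
    by (intro continuous_on_compose2[OF continuous_u[of UNIV] wc]) auto
  define \<Psi> where "\<Psi> = (\<lambda>z. integral (cbox 0 (2*pi)) (\<lambda>t. of_real (u (w t)) * ((w t + z) / (w t - z))))"
  have c1: "continuous_on (cbox 0 (2*pi)) (\<lambda>t. complex_of_real (u (w t)) * ((w t + z) / (w t - z)))"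
    if "norm z < R" for z
    by (intro continuous_intros uc wc) (use wne[OF that] in auto)
  have hol: "\<Psi> holomorphic_on ball 0 R"
    unfolding \<Psi>_def
  proof (rule leibniz_rule_holomorphic)
    fix z :: complex and t :: real assume z: "z \<in> ball 0 R"
    show "((\<lambda>z. of_real (u (w t)) * ((w t + z) / (w t - z))) has_field_derivative
        of_real (u (w t)) * (2 * w t / (w t - z)\<^sup>2)) (at z within ball 0 R)"
      using wne[of z t] z
      by (auto intro!: derivative_eq_intros simp: power2_eq_square algebra_simps)
    show "(\<lambda>t. of_real (u (w t)) * ((w t + z) / (w t - z))) integrable_on cbox 0 (2*pi)"
      by (rule integrable_continuous[OF c1]) (use z in simp)
  next
    have "continuous_on (ball 0 R \<times> cbox 0 (2*pi)) (\<lambda>x. complex_of_real (u (w (snd x))) * (2 * w (snd x) / (w (snd x) - fst x)\<^sup>2))"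
      by (intro continuous_intros continuous_on_compose2[OF uc[of UNIV]] continuous_on_compose2[OF wc[of UNIV]])
         (use wne in auto)
    then show "continuous_on (ball 0 R \<times> cbox 0 (2*pi)) (\<lambda>(z, t). complex_of_real (u (w t)) * (2 * w t / (w t - z)\<^sup>2))"
      by (simp add: case_prod_unfold)
  qed auto
  have aux: "Re (of_real x * v) = x * Re v" for x v by simp
  have Re\<Psi>: "((\<lambda>t. u (w t) * poisson R t z) has_integral Re (\<Psi> z)) {0..2*pi}" if z: "norm z < R" for z
  proof -
    have "((\<lambda>t. of_real (u (w t)) * ((w t + z) / (w t - z))) has_integral \<Psi> z) (cbox 0 (2*pi))"
      unfolding \<Psi>_def by (rule integrable_integral[OF integrable_continuous[OF c1[OF z]]])
    from has_integral_Re[OF this] show ?thesis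
      unfolding aux poisson_def by (simp add: w_def)
  qed
  define \<Phi> where "\<Phi> = (\<lambda>z. \<Psi> z / of_real (2 * pi))"
  have Re\<Phi>: "Re (\<Phi> z) = Re (\<Psi> z) / (2 * pi)" for z
    unfolding \<Phi>_def by (rule Re_divide_of_real)
  have le: "lnorm F z \<le> Re (\<Phi> z)"
    if F: "entire_nz F" "\<And>z. norm z = R \<Longrightarrow> F z \<noteq> 0" "F z \<noteq> 0" and Fu: "\<And>z. F z \<noteq> 0 \<Longrightarrow> lnorm F z \<le> u z"
      and z: "norm z < R" for F z
  proof -
    obtain k R' where k: "R < R'" "k holomorphic_on ball 0 R'" "\<forall>z. norm z = R \<longrightarrow> Re (k z) = lnorm F z"
      "\<forall>z. norm z < R \<longrightarrow> F z \<noteq> 0 \<longrightarrow> lnorm F z \<le> Re (k z)"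
      by (rule blaschke_factorization[OF F(1) R F(2)])
    have I: "((\<lambda>t. Re (k (of_real R * cis t)) * poisson R t z) has_integral 2 * pi * Re (k z)) {0..2*pi}"
      by (rule has_integral_poisson[OF k(2,1) z])
    have "2 * pi * Re (k z) \<le> Re (\<Psi> z)"
    proof (rule has_integral_le[OF I Re\<Psi>[OF z]])
      fix t
      have "Re (k (w t)) \<le> u (w t)" using k(3) w[of t] Fu[of "w t"] F(2)[of "w t"] by simp
      then have *: "Re (k (of_real R * cis t)) \<le> u (w t)" by (simp add: w_def)
      then show "Re (k (of_real R * cis t)) * poisson R t z \<le> u (w t) * poisson R t z"
        by (intro mult_right_mono poisson_nonneg[OF z] *)
    qed
    then have "Re (k z) \<le> Re (\<Phi> z)" unfolding Re\<Phi> by (simp add: field_simps)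
    then show ?thesis using k(4) z F(3) by fastforce
  qed
  show thesis
  proof (rule that[of \<Phi>])
    show "\<Phi> holomorphic_on ball 0 R" unfolding \<Phi>_def by (intro holomorphic_intros hol) auto
    have "u z \<le> Re (\<Phi> z)" if z: "norm z < R" for z
      using u_cases[of z] le[OF g nzg _ _ z] le[OF h nzh _ _ z] lnorm_le_u by metis
    then show "\<forall>z. norm z < R \<longrightarrow> u z \<le> Re (\<Phi> z)" by blast
    have "Re (\<Psi> 0) = 2 * pi * D R"
      using integral_unique[OF Re\<Psi>[of 0]] R by (simp add: poisson_0 circ_mean_def w_def)
    then show "Re (\<Phi> 0) = D R" by (simp add: Re\<Phi>)
  qed
qed

text \<open>The circle of radius \<open>r\<close> about \<open>c\<close> lies in the disc, and the
  mean of the harmonic function Re \<Phi> over it is its value at the centre.\<close>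

lemma circ_mean_shift_le_majorant:
  assumes \<Phi>: "\<Phi> holomorphic_on ball 0 R" "\<forall>z. norm z < R \<longrightarrow> u z \<le> Re (\<Phi> z)"
    and r: "0 < r" "r + norm c < R"
  shows "circ_mean r (\<lambda>z. u (z + c)) \<le> Re (\<Phi> c)"
proof -
  have "(\<lambda>z. \<Phi> (z + c)) holomorphic_on ball 0 (R - norm c)"
  proof (rule holomorphic_on_compose_gen[OF _ \<Phi>(1), unfolded o_def])
    show "(\<lambda>z. z + c) ` ball 0 (R - norm c) \<subseteq> ball 0 R"
    proof safe
      fix z :: complex assume "z \<in> ball 0 (R - norm c)"
      then show "z + c \<in> ball 0 R" using norm_triangle_ineq[of z c] by simp
    qed
  qed (intro holomorphic_intros)
  from has_integral_mean_value[OF this _ r(1)] r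
  have I: "((\<lambda>t. Re (\<Phi> (of_real r * cis t + c))) has_integral 2 * pi * Re (\<Phi> c)) {0..2*pi}" by simp
  have J: "((\<lambda>t. u (of_real r * cis t + c)) has_integral 2 * pi * circ_mean r (\<lambda>z. u (z + c))) {0..2*pi}"
    using circ_int_imp_integrable[OF circ_int_u_shift[of r c]] by (simp add: circ_mean_def has_integral_iff)
  have "2 * pi * circ_mean r (\<lambda>z. u (z + c)) \<le> 2 * pi * Re (\<Phi> c)"
  proof (rule has_integral_le[OF J I])
    fix t
    have "norm (of_real r * cis t + c) < R"
      using norm_triangle_ineq[of "of_real r * cis t" c] r by (simp add: norm_mult)
    then show "u (of_real r * cis t + c) \<le> Re (\<Phi> (of_real r * cis t + c))" using \<Phi>(2) by blast
  qed
  then show ?thesis by simp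
qed

lemma generic_radius:
  assumes "a < b"
  obtains R where "a < R" "R < b" "\<forall>z. norm z = R \<longrightarrow> g z \<noteq> 0 \<and> h z \<noteq> 0"
proof (rule entire_nz_no_zeros_on_circle[of UNIV "\<lambda>b. if b then g else h" a b])
  fix R assume *: "a < R" "R < b" "\<And>i z. i \<in> UNIV \<Longrightarrow> norm z = R \<Longrightarrow> (if i then g else h) z \<noteq> 0"
  show thesis
    by (rule that[OF *(1,2)]) (use *(3)[of True] *(3)[of False] in auto)
qed (use g h assms in auto)

lemma continuous_D: "continuous_on UNIV D"
proof -
  have "continuous_on (UNIV \<times> cbox 0 (2*pi)) (\<lambda>(r, t). u (of_real r * cis t))"
    unfolding case_prod_unfold
    by (intro continuous_on_compose2[OF continuous_u[of UNIV]] continuous_intros) auto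
  from integral_continuous_on_param[OF this]
  have "continuous_on UNIV (\<lambda>r. integral {0..2*pi} (\<lambda>t. u (of_real r * cis t)))" by simp
  then show ?thesis unfolding circ_mean_def by (intro continuous_intros) auto
qed

lemma D_mono_generic:
  assumes "0 < r" "r < R" "\<forall>z. norm z = R \<longrightarrow> g z \<noteq> 0 \<and> h z \<noteq> 0"
  shows "D r \<le> D R"
proof -
  have R0: "R > 0" using assms by simp
  obtain \<Phi> where \<Phi>: "\<Phi> holomorphic_on ball 0 R" "\<forall>z. norm z < R \<longrightarrow> u z \<le> Re (\<Phi> z)" "Re (\<Phi> 0) = D R"
    by (rule harmonic_majorant[OF R0 assms(3)])
  show ?thesis using circ_mean_shift_le_majorant[OF \<Phi>(1,2), of r 0] assms \<Phi>(3) by simp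
qed

text \<open>Radii without zeros of \<open>g\<close> and \<open>h\<close> are dense and
  \<open>D\<close> is continuous, so a failure of monotonicity would persist at a generic radius
  just below \<open>R\<close>.\<close>

lemma D_mono:
  assumes "0 < r" "r \<le> R" shows "D r \<le> D R"
proof (cases "r = R")
  case False
  with assms have rR: "r < R" by simp
  show ?thesis
  proof (rule ccontr)
    assume "\<not> ?thesis"
    then have "D r - D R > 0" by simp
    moreover have "isCont D R" using continuous_D by (simp add: continuous_on_eq_continuous_at)
    ultimately obtain d where d: "d > 0" "\<And>x. dist x R < d \<Longrightarrow> dist (D x) (D R) < D r - D R"
      unfolding continuous_at_eps_delta by (metis dist_commute)
    have lt: "max r (R - d) < R" using rR d(1) by simp
    obtain R' where R': "max r (R - d) < R'" "R' < R" "\<forall>z. norm z = R' \<longrightarrow> g z \<noteq> 0 \<and> h z \<noteq> 0"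
      by (rule generic_radius[OF lt])
    have "D r \<le> D R'" by (rule D_mono_generic) (use assms R' in auto)
    moreover have "dist (D R') (D R) < D r - D R" using R' d(1) by (intro d(2)) (auto simp: dist_real_def)
    ultimately show False by (simp add: dist_real_def)
  qed
qed simp

text \<open>Harnack's inequality is applied on a fixed disc of radius \<open>\<rho>\<close> about 0,
  whatever \<open>r\<close> is. There the majorant is at least u >= -K, so adding \<open>K\<close>
  makes it nonnegative, and \<open>K\<close> does not depend on \<open>r\<close>.\<close>

lemma shift_mean_le:
  assumes \<epsilon>: "\<epsilon> > 0"
  obtains K r0 where "\<And>r. r \<ge> r0 \<Longrightarrow> circ_mean r (\<lambda>z. u (z + c)) \<le> (1 + \<epsilon>) * D (r + norm c + 1) + K"
proof -
  \<comment> \<open>Chosen so that the Harnack quotient (\<rho> + |c|) / (\<rho> - |c|) is at most 1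
    + \<epsilon>; the final 1 keeps \<rho> positive when c = 0.\<close>
  define \<rho> where "\<rho> = norm c * (1 + 2 / \<epsilon>) + 1"
  have "norm c * 1 \<le> norm c * (1 + 2 / \<epsilon>)" using \<epsilon> by (intro mult_left_mono) auto
  then have \<rho>: "norm c < \<rho>" "\<rho> > 0" unfolding \<rho>_def using norm_ge_zero[of c] by linarith+
  have \<rho>\<epsilon>: "(\<rho> + norm c) / (\<rho> - norm c) \<le> 1 + \<epsilon>"
  proof -
    have "\<epsilon> * \<rho> = norm c * (\<epsilon> + 2) + \<epsilon>" using \<epsilon> by (simp add: \<rho>_def field_simps)
    then have "\<rho> + norm c \<le> (1 + \<epsilon>) * (\<rho> - norm c)" using \<epsilon> by (simp add: algebra_simps)
    then show ?thesis using \<rho> by (simp add: divide_le_eq)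
  qed
  have "compact (u ` cball 0 \<rho>)" by (intro compact_continuous_image continuous_u compact_cball)
  then obtain K where "\<forall>x\<in>u ` cball 0 \<rho>. norm x \<le> K"
    using compact_imp_bounded bounded_iff by metis
  then have K: "\<bar>u z\<bar> \<le> K" if "norm z \<le> \<rho>" for z using that by auto
  have K0: "K \<ge> 0" using K[of 0] \<rho> by fastforce
  have "circ_mean r (\<lambda>z. u (z + c)) \<le> (1 + \<epsilon>) * D (r + norm c + 1) + (1 + \<epsilon>) * K" if r: "r \<ge> \<rho>" for r
  proof -
    obtain R where R: "r + norm c < R" "R < r + norm c + 1" "\<forall>z. norm z = R \<longrightarrow> g z \<noteq> 0 \<and> h z \<noteq> 0"
      by (rule generic_radius[OF less_add_one])
    have R0: "R > 0" "\<rho> < R" "r > 0" using R r \<rho> norm_ge_zero[of c] by linarith+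
    obtain \<Phi> where \<Phi>: "\<Phi> holomorphic_on ball 0 R" "\<forall>z. norm z < R \<longrightarrow> u z \<le> Re (\<Phi> z)" "Re (\<Phi> 0) = D R"
      by (rule harmonic_majorant[OF R0(1) R(3)])
    define k where "k = (\<lambda>z. \<Phi> z + of_real K)"
    have k: "k holomorphic_on ball 0 R" unfolding k_def by (intro holomorphic_intros \<Phi>(1))
    have I: "((\<lambda>t. Re (k (of_real \<rho> * cis t)) * poisson \<rho> t c) has_integral 2 * pi * Re (k c)) {0..2*pi}"
      by (rule has_integral_poisson[OF k R0(2) \<rho>(1)])
    have J: "((\<lambda>t. Re (k (of_real \<rho> * cis t)) * (1 + \<epsilon>)) has_integral 2 * pi * Re (k 0) * (1 + \<epsilon>)) {0..2*pi}"
      by (intro has_integral_mult_left has_integral_mean_value[OF k R0(2) \<rho>(2)])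
    have "2 * pi * Re (k c) \<le> 2 * pi * Re (k 0) * (1 + \<epsilon>)"
    proof (rule has_integral_le[OF I J])
      fix t
      have n: "norm (of_real \<rho> * cis t) = \<rho>" using \<rho> by (simp add: norm_mult)
      have "- K \<le> u (of_real \<rho> * cis t)" using K[of "of_real \<rho> * cis t"] n by simp
      also have "\<dots> \<le> Re (\<Phi> (of_real \<rho> * cis t))" using n R0 \<Phi>(2) by simp
      finally have "Re (k (of_real \<rho> * cis t)) \<ge> 0" by (simp add: k_def)
      moreover have "poisson \<rho> t c \<le> 1 + \<epsilon>" using poisson_le[OF \<rho>(1)] \<rho>\<epsilon> by (rule order_trans)
      ultimately show "Re (k (of_real \<rho> * cis t)) * poisson \<rho> t c \<le> Re (k (of_real \<rho> * cis t)) * (1 + \<epsilon>)"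
        by (rule mult_left_mono[rotated])
    qed
    then have "Re (k c) \<le> Re (k 0) * (1 + \<epsilon>)" by simp
    then have "Re (\<Phi> c) \<le> (1 + \<epsilon>) * D R + (1 + \<epsilon>) * K"
      using K0 \<Phi>(3) by (simp add: k_def algebra_simps)
    moreover have "circ_mean r (\<lambda>z. u (z + c)) \<le> Re (\<Phi> c)"
      by (rule circ_mean_shift_le_majorant[OF \<Phi>(1,2) R0(3) R(1)])
    moreover have "(1 + \<epsilon>) * D R \<le> (1 + \<epsilon>) * D (r + norm c + 1)"
      using R R0 \<epsilon> by (intro mult_left_mono D_mono) auto
    ultimately show ?thesis by linarith
  qed
  then show thesis by (rule that)
qed

end

section \<open>The Nevanlinna characteristic\<close>

lemma has_integral_indicator_inverse:
  assumes "0 < s" "s \<le> r"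
  shows "((\<lambda>t. if s \<le> t then 1 / t else 0) has_integral ln (r / s)) {0..r::real}"
proof -
  have "((\<lambda>t. 1 / t) has_integral (ln r - ln s)) {s..r}"
  proof (rule fundamental_theorem_of_calculus)
    fix t assume "t \<in> {s..r}"
    then have "t > 0" using assms by simp
    then have "(ln has_real_derivative 1 / t) (at t within {s..r})"
      by (auto intro!: derivative_eq_intros simp: inverse_eq_divide)
    then show "(ln has_vector_derivative 1 / t) (at t within {s..r})"
      by (simp add: has_real_derivative_iff_has_vector_derivative)
  qed (use assms in auto)
  then have "((\<lambda>t. if t \<in> {s..r} then 1 / t else 0) has_integral (ln r - ln s)) {0..r}"
    using assms by (subst has_integral_restrict) auto
  then have "((\<lambda>t. if s \<le> t then 1 / t else 0) has_integral (ln r - ln s)) {0..r}"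
    by (rule has_integral_eq[rotated]) auto
  then show ?thesis using assms by (simp add: ln_div)
qed

text \<open>n(t) - n(0) is a finite sum of indicators of t >= |a| on [0, r], and each of them
  divided by t integrates to ln(r / |a|).\<close>

lemma integrated_count_eq_Ncount:
  assumes \<nu>: "locfin \<nu>" and r: "r > 0"
    and n: "\<And>t. t \<ge> 0 \<Longrightarrow> n t = (\<Sum>a | \<nu> a \<noteq> 0 \<and> norm a \<le> t. \<nu> a)"
  shows "integrated_count n r = Ncount \<nu> r"
proof -
  define Z where "Z = {a. a \<noteq> 0 \<and> \<nu> a \<noteq> 0 \<and> norm a \<le> r}"
  have fin: "finite {a. \<nu> a \<noteq> 0 \<and> norm a \<le> t}" for t using \<nu> by (simp add: locfin_def)
  have Z: "finite Z" by (rule finite_subset[OF _ fin[of r]]) (auto simp: Z_def)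
  have n0: "n 0 = \<nu> 0"
  proof -
    have "n 0 = (\<Sum>a\<in>{0::complex}. \<nu> a)"
      unfolding n[OF order_refl] by (rule sum.mono_neutral_left) auto
    then show ?thesis by simp
  qed
  have nt: "real (n t) - real (n 0) = (\<Sum>a\<in>Z. real (\<nu> a) * (if norm a \<le> t then 1 else 0))"
    if t: "t \<in> {0..r}" for t
  proof -
    have "n t = (\<Sum>a\<in>insert 0 Z. if norm a \<le> t then \<nu> a else 0)"
    proof -
      have "(\<Sum>a | \<nu> a \<noteq> 0 \<and> norm a \<le> t. \<nu> a) = (\<Sum>a | \<nu> a \<noteq> 0 \<and> norm a \<le> t. if norm a \<le> t then \<nu> a else 0)"
        by (intro sum.cong) auto
      also have "\<dots> = (\<Sum>a\<in>insert 0 Z. if norm a \<le> t then \<nu> a else 0)"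
        by (rule sum.mono_neutral_left) (use Z t in \<open>auto simp: Z_def\<close>)
      finally show ?thesis using n[of t] t by simp
    qed
    also have "\<dots> = \<nu> 0 + (\<Sum>a\<in>Z. if norm a \<le> t then \<nu> a else 0)"
      using Z t by (subst sum.insert) (auto simp: Z_def)
    finally have "real (n t) - real (n 0) = real (\<Sum>a\<in>Z. if norm a \<le> t then \<nu> a else 0)"
      using n0 by simp
    also have "\<dots> = (\<Sum>a\<in>Z. real (\<nu> a) * (if norm a \<le> t then 1 else 0))"
      unfolding of_nat_sum by (intro sum.cong) auto
    finally show ?thesis .
  qed
  have "((\<lambda>t. \<Sum>a\<in>Z. real (\<nu> a) * (if norm a \<le> t then 1 / t else 0)) has_integral (\<Sum>a\<in>Z. real (\<nu> a) * ln (r / norm a))) {0..r}"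
    by (intro has_integral_sum Z has_integral_mult_right has_integral_indicator_inverse) (auto simp: Z_def)
  then have "((\<lambda>t. (real (n t) - real (n 0)) / t) has_integral (\<Sum>a\<in>Z. real (\<nu> a) * ln (r / norm a))) {0..r}"
    by (rule has_integral_eq[rotated]) (auto simp: nt sum_divide_distrib intro!: sum.cong)
  then have 1: "integrated_count n r = (\<Sum>a\<in>Z. real (\<nu> a) * ln (r / norm a)) + real (\<nu> 0) * ln r"
    by (simp add: integrated_count_def integral_unique n0)
  have "Ncount \<nu> r = (\<Sum>a\<in>insert 0 Z. real (\<nu> a) * (if a = 0 then ln r else ln (r / norm a)))"
    by (rule Ncount_superset) (use Z r in \<open>auto simp: Z_def\<close>)
  also have "\<dots> = real (\<nu> 0) * ln r + (\<Sum>a\<in>Z. real (\<nu> a) * (if a = 0 then ln r else ln (r / norm a)))"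
    using Z by (subst sum.insert) (auto simp: Z_def)
  also have "(\<Sum>a\<in>Z. real (\<nu> a) * (if a = 0 then ln r else ln (r / norm a))) = (\<Sum>a\<in>Z. real (\<nu> a) * ln (r / norm a))"
    by (intro sum.cong) (auto simp: Z_def)
  finally show ?thesis using 1 by simp
qed

lemma eventually_cosparse_UNIV: "eventually P (cosparse UNIV) \<longleftrightarrow> (\<forall>z. eventually P (at z))"
  by (simp add: eventually_cosparse_open_eq)

lemma finite_exceptions_on_circle:
  fixes P :: "complex \<Rightarrow> bool"
  assumes "eventually P (cosparse UNIV)" shows "finite {z. norm z = r \<and> \<not> P z}"
proof -
  have "{x. \<not> P x} sparse_in sphere 0 r"
    using assms unfolding eventually_cosparse by (rule sparse_in_subset) auto
  then have "finite (sphere 0 r \<inter> {x. \<not> P x})" by (rule sparse_in_compact_finite) simp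
  then show ?thesis by (rule finite_subset[rotated]) auto
qed

text \<open>Weierstrass factorization of \<open>f\<close> with its removable singularities repaired;
  the nowhere vanishing factor goes into the numerator. Numerator and denominator have no common
  zero because one vanishes only at zeros and the other only at poles.\<close>

lemma meromorphic_quotient_of_entire:
  assumes f: "f meromorphic_on UNIV" and nz: "\<not> (\<forall>\<^sub>\<approx>z\<in>UNIV. f z = 0)"
  obtains g h where "coprime_entire g h" "\<forall>\<^sub>\<approx>z\<in>UNIV. f z = g z / h z"
    "\<forall>z. is_pole f z \<longleftrightarrow> h z = 0" "\<forall>z. is_pole f z \<longrightarrow> nat (- zorder f z) = zord h z"
proof -
  define f' where "f' = remove_sings f"
  have f': "f' nicely_meromorphic_on UNIV"
    unfolding f'_def by (rule remove_sings_nicely_meromorphic[OF f])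
  have iso: "isolated_singularity_at f z" for z
    using meromorphic_on_subset[OF f, of "{z}"] by (simp add: meromorphic_on_isolated_singularity)
  have eq: "\<forall>\<^sub>\<approx>z\<in>UNIV. f' z = f z"
    unfolding f'_def eventually_cosparse_UNIV using eventually_remove_sings_eq_at[OF iso] by blast
  obtain k f1 f2 where k: "k holomorphic_on UNIV" "f1 holomorphic_on UNIV" "f2 holomorphic_on UNIV"
    "\<forall>z. f1 z = 0 \<longleftrightarrow> \<not> is_pole f' z \<and> f' z = 0"
    "\<forall>z. f2 z = 0 \<longleftrightarrow> is_pole f' z"
    "\<forall>z. \<not> is_pole f' z \<longrightarrow> zorder f1 z = zorder f' z"
    "\<forall>z. is_pole f' z \<longrightarrow> zorder f2 z = - zorder f' z"
    "\<forall>z. k z \<noteq> 0" "\<forall>z. f' z = k z * f1 z / f2 z"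
    by (rule weierstrass_factorization_meromorphic_UNIV[OF f'])
  have pole: "is_pole f' z \<longleftrightarrow> is_pole f z" for z unfolding f'_def using iso by simp
  define g where "g = (\<lambda>z. k z * f1 z)"
  have "\<exists>z. f2 z \<noteq> 0"
  proof (rule ccontr)
    assume "\<not> ?thesis"
    then have "f' z = 0" for z using k(9) by simp
    then have "\<forall>\<^sub>\<approx>z\<in>UNIV. f z = 0" using eq by (auto elim: eventually_mono)
    with nz show False by simp
  qed
  then have h: "entire_nz f2" using k(3) by (simp add: entire_nz_def)
  have "\<exists>z. g z \<noteq> 0"
  proof (rule ccontr)
    assume "\<not> ?thesis"
    then have "f' z = 0" for z using k(9) by (simp add: g_def)
    then have "\<forall>\<^sub>\<approx>z\<in>UNIV. f z = 0" using eq by (auto elim: eventually_mono)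
    with nz show False by simp
  qed
  then have g: "entire_nz g" using k(1,2) by (auto simp: entire_nz_def g_def intro!: holomorphic_intros)
  show thesis
  proof (rule that[of g f2])
    show "coprime_entire g f2"
      by standard (use g h k in \<open>auto simp: g_def\<close>)
    show "\<forall>\<^sub>\<approx>z\<in>UNIV. f z = g z / f2 z"
      using eq by (rule eventually_mono) (use k(9) in \<open>auto simp: g_def\<close>)
    show "\<forall>z. is_pole f z \<longleftrightarrow> f2 z = 0" using pole k(5) by simp
    show "\<forall>z. is_pole f z \<longrightarrow> nat (- zorder f z) = zord f2 z"
    proof safe
      fix z assume "is_pole f z"
      then have p: "is_pole f' z" by (simp add: pole)
      have "zorder f' z = zorder f z" unfolding f'_def using iso by simp
      with p k(5,7) show "nat (- zorder f z) = zord f2 z" by (simp add: zord_def)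
    qed
  qed
qed

text \<open>Off the exceptional points, log+|g/h| = log max(|g|,|h|) - log|h|, and by Jensen's
  formula the mean of log|h| is N(r,f) up to a constant.\<close>

lemma nevanlinna_T_eq:
  assumes "coprime_entire g h" and eq: "\<forall>\<^sub>\<approx>z\<in>UNIV. f z = g z / h z"
    and pole: "\<forall>z. is_pole f z \<longleftrightarrow> h z = 0" and ord: "\<forall>z. is_pole f z \<longrightarrow> nat (- zorder f z) = zord h z"
  obtains C where "\<forall>r>0. nevanlinna_T r f = circ_mean r (log_max g h) + C"
proof -
  interpret coprime_entire g h by fact
  obtain C where C: "\<And>r. r > 0 \<Longrightarrow> circ_mean r (lnorm h) = Ncount (zord h) r + C"
    using jensen[OF h] by metis
  have "nevanlinna_T r f = D r - C" if r: "r > 0" for r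
  proof -
    have N: "nevanlinna_N r f = Ncount (zord h) r"
      unfolding nevanlinna_N_def
    proof (rule integrated_count_eq_Ncount[OF locfin_zord[OF h] r])
      fix t :: real
      have "zord h a \<noteq> 0 \<longleftrightarrow> is_pole f a" for a using zord_pos_iff[OF h, of a] pole by simp
      then show "pole_count f t = (\<Sum>a | zord h a \<noteq> 0 \<and> norm a \<le> t. zord h a)"
        unfolding pole_count_def by (intro sum.cong) (use ord in auto)
    qed
    have fin: "finite ({z. norm z = r \<and> \<not> (f z = g z / h z)} \<union> {z. h z = 0 \<and> norm z \<le> r})"
      using finite_exceptions_on_circle[OF eq] entire_nz_finite_zeros[OF h] by simp
    have "nevanlinna_m r f = circ_mean r (\<lambda>z. max 0 (ln (norm (f z))))"
      by (simp add: nevanlinna_m_def circ_mean_def)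
    also have "\<dots> = circ_mean r (\<lambda>z. u z - lnorm h z)"
    proof (rule circ_mean_spike[OF r fin])
      fix z assume z: "norm z = r" "z \<notin> {z. norm z = r \<and> \<not> (f z = g z / h z)} \<union> {z. h z = 0 \<and> norm z \<le> r}"
      then have fz: "f z = g z / h z" and hz: "h z \<noteq> 0" by auto
      show "max 0 (ln (norm (f z))) = u z - lnorm h z"
      proof (cases "g z = 0")
        \<comment> \<open>At a zero of \<open>g\<close> the convention \<open>ln 0 = 0\<close>
          agrees with log+ 0 = 0, and \<open>u\<close> equals log|h|.\<close>
        case True
        then show ?thesis by (simp add: fz log_max_def)
      next
        case False
        have "ln (norm (f z)) = lnorm g z - lnorm h z" using False hz by (simp add: fz norm_divide ln_div)
        moreover have "u z = max (lnorm g z) (lnorm h z)"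
          using False hz by (auto simp: log_max_def max_def)
        ultimately show ?thesis by (simp add: max_def)
      qed
    qed
    also have "\<dots> = D r - (Ncount (zord h) r + C)"
      using circ_mean_diff[OF circ_int_u circ_int_lnorm[OF h r]] C[OF r] by simp
    finally show ?thesis by (simp add: nevanlinna_T_def N)
  qed
  then show thesis using that[of "- C"] by simp
qed

section \<open>Growth outside exceptional sets\<close>

lemma borel_measurable_inverse_indicator:
  assumes "E \<in> sets lebesgue"
  shows "(\<lambda>r. ennreal (1 / r) * indicator E r) \<in> borel_measurable lebesgue"
proof -
  have "(\<lambda>r. ennreal (1 / r)) \<in> borel_measurable lebesgue"
    by (rule measurable_completion) measurable
  then show ?thesis using assms by measurable
qed

lemma finite_log_measure_Un:
  assumes "finite_log_measure E" "finite_log_measure F" shows "finite_log_measure (E \<union> F)"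
proof -
  have m: "E \<in> sets lebesgue" "F \<in> sets lebesgue" using assms by (auto simp: finite_log_measure_def)
  have "(\<integral>\<^sup>+ r\<in>E \<union> F. ennreal (1 / r) \<partial>lebesgue) \<le> (\<integral>\<^sup>+ r. ennreal (1 / r) * indicator E r + ennreal (1 / r) * indicator F r \<partial>lebesgue)"
    by (intro nn_integral_mono) (auto simp: indicator_def)
  also have "\<dots> = (\<integral>\<^sup>+ r\<in>E. ennreal (1 / r) \<partial>lebesgue) + (\<integral>\<^sup>+ r\<in>F. ennreal (1 / r) \<partial>lebesgue)"
    using m by (intro nn_integral_add borel_measurable_inverse_indicator)
  also have "\<dots> < \<infinity>" using assms by (auto simp: finite_log_measure_def)
  finally show ?thesis using assms by (auto simp: finite_log_measure_def)
qed

text \<open>The logarithmic measure of the tail of \<open>E\<close> drops below 1/4. On [x, 2x] the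
  density is at least 1/(2x), so \<open>E\<close> covers a length of at most x/2 there.\<close>

lemma finite_log_measure_dyadic:
  assumes E: "finite_log_measure E"
  obtains x0 where "\<And>x. x \<ge> x0 \<Longrightarrow> measure lebesgue ({x..2*x} - E) \<ge> x / 2"
proof -
  have mE: "E \<in> sets lebesgue" and E1: "E \<subseteq> {1..}"
    and fin: "(\<integral>\<^sup>+ r. ennreal (1 / r) * indicator E r \<partial>lebesgue) < \<infinity>"
    using E by (auto simp: finite_log_measure_def)
  define M where "M = density lebesgue (\<lambda>r. ennreal (1 / r) * indicator E r)"
  have meas: "(\<lambda>r. ennreal (1 / r) * indicator E r) \<in> borel_measurable lebesgue"
    using mE by (rule borel_measurable_inverse_indicator)
  have M: "emeasure M A = (\<integral>\<^sup>+ r. (ennreal (1 / r) * indicator E r) * indicator A r \<partial>lebesgue)" if "A \<in> sets lebesgue" for A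
    unfolding M_def using meas that by (simp add: emeasure_density)
  have "(\<lambda>n::nat. emeasure M {real n..}) \<longlonglongrightarrow> emeasure M (\<Inter>n::nat. {real n..})"
  proof (rule Lim_emeasure_decseq)
    show "range (\<lambda>n::nat. {real n..}) \<subseteq> sets M" by (auto simp: M_def)
    show "decseq (\<lambda>n::nat. {real n..})" by (auto simp: decseq_def)
    show "emeasure M {real n..} \<noteq> \<infinity>" for n
    proof -
      have "emeasure M {real n..} \<le> (\<integral>\<^sup>+ r. ennreal (1 / r) * indicator E r \<partial>lebesgue)"
        by (subst M) (auto intro!: nn_integral_mono simp: indicator_def)
      with fin show ?thesis by auto
    qed
  qed
  moreover have "(\<Inter>n::nat. {real n..}) = {}"
    using reals_Archimedean2 by (auto simp: not_le[symmetric])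
  ultimately have "(\<lambda>n::nat. emeasure M {real n..}) \<longlonglongrightarrow> 0" by simp
  then have "eventually (\<lambda>n. emeasure M {real n..} < ennreal (1/4)) sequentially"
    by (rule order_tendstoD) auto
  then obtain N where N: "emeasure M {real N..} < ennreal (1/4)"
    by (auto simp: eventually_sequentially)
  have "measure lebesgue ({x..2*x} - E) \<ge> x / 2" if x: "x \<ge> max 1 (real N)" for x
  proof -
    have x1: "x \<ge> 1" "x \<ge> real N" using x by auto
    have S: "{x..2*x} \<inter> E \<in> lmeasurable"
      using mE by (intro fmeasurable_Int_fmeasurable) auto
    have "ennreal (1 / (2*x)) * emeasure lebesgue ({x..2*x} \<inter> E) = (\<integral>\<^sup>+ r. ennreal (1 / (2*x)) * indicator ({x..2*x} \<inter> E) r \<partial>lebesgue)"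
      using S by (simp add: nn_integral_cmult_indicator fmeasurableD)
    also have "\<dots> \<le> emeasure M {real N..}"
    proof (subst M)
      show "(\<integral>\<^sup>+ r. ennreal (1 / (2*x)) * indicator ({x..2*x} \<inter> E) r \<partial>lebesgue)
        \<le> (\<integral>\<^sup>+ r. ennreal (1 / r) * indicator E r * indicator {real N..} r \<partial>lebesgue)"
      proof (intro nn_integral_mono)
        fix r :: real
        show "ennreal (1 / (2*x)) * indicator ({x..2*x} \<inter> E) r \<le> ennreal (1 / r) * indicator E r * indicator {real N..} r"
        proof (cases "r \<in> {x..2*x} \<inter> E")
          case True
          then have "1 / (2*x) \<le> 1 / r" using x1 by (intro divide_left_mono) auto
          then show ?thesis using True x1 by (auto intro!: ennreal_leI)
        qed auto
      qed
    qed auto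
    finally have "ennreal (1 / (2*x)) * emeasure lebesgue ({x..2*x} \<inter> E) \<le> ennreal (1/4)"
      using N by (meson less_imp_le order_trans)
    moreover have "ennreal (1 / (2*x) * measure lebesgue ({x..2*x} \<inter> E)) = ennreal (1 / (2*x)) * emeasure lebesgue ({x..2*x} \<inter> E)"
      using x1 by (subst ennreal_mult) (auto simp: emeasure_eq_measure2[OF S])
    ultimately have "ennreal (1 / (2*x) * measure lebesgue ({x..2*x} \<inter> E)) \<le> ennreal (1/4)"
      by simp
    then have "1 / (2*x) * measure lebesgue ({x..2*x} \<inter> E) \<le> 1/4"
      by (subst (asm) ennreal_le_iff) auto
    then have *: "measure lebesgue ({x..2*x} \<inter> E) \<le> x / 2" using x1 by (simp add: field_simps)
    have "{x..2*x} - E = {x..2*x} - ({x..2*x} \<inter> E)" by auto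
    then have "measure lebesgue ({x..2*x} - E) = measure lebesgue {x..2*x} - measure lebesgue ({x..2*x} \<inter> E)"
      using S measurable_measure_Diff[of "{x..2*x}" "lebesgue" "{x..2*x} \<inter> E"] by (auto simp: fmeasurableD)
    also have "measure lebesgue {x..2*x} = x" using x1 by simp
    finally show ?thesis using * by simp
  qed
  then show thesis by (rule that)
qed

lemma finite_log_measure_avoid:
  assumes "finite_log_measure E"
  obtains x0 where "\<And>x. x \<ge> x0 \<Longrightarrow> \<exists>y\<in>{x..2*x}. y \<notin> E"
proof -
  obtain x0 where x0: "\<And>x. x \<ge> x0 \<Longrightarrow> measure lebesgue ({x..2*x} - E) \<ge> x / 2"
    using finite_log_measure_dyadic[OF assms] by metis
  have "\<exists>y\<in>{x..2*x}. y \<notin> E" if "x \<ge> max 1 x0" for x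
  proof (rule ccontr)
    assume "\<not> ?thesis"
    then have e: "{x..2*x} - E = {}" by auto
    show False using x0[of x] that unfolding e by simp
  qed
  then show thesis by (rule that)
qed

text \<open>The integral of \<open>ln D(r + \<sigma>) - ln D(r)\<close> over \<open>[x, 2x]\<close> telescopes to \<open>O(ln x)\<close>, whereas it would be
  at least of order \<open>x\<close> if \<open>D(r + \<sigma>) > (1 + \<epsilon>) D(r)\<close> off a set of finite logarithmic measure.\<close>

lemma slow_growth_outside_exceptional_set:
  fixes D :: "real \<Rightarrow> real"
  assumes E: "finite_log_measure E" and cont: "continuous_on UNIV D"
    and mono: "\<And>r s. 0 < r \<Longrightarrow> r \<le> s \<Longrightarrow> D r \<le> D s"
    and growth: "\<And>r. r \<ge> 1 \<Longrightarrow> D r \<le> A * r ^ K" and large: "eventually (\<lambda>r. D r \<ge> 1) at_top"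
    and \<sigma>: "\<sigma> > 0" and \<epsilon>: "\<epsilon> > 0"
  shows "\<exists>r\<ge>x0. r \<notin> E \<and> D (r + \<sigma>) \<le> (1 + \<epsilon>) * D r"
proof (rule ccontr)
  assume neg: "\<not> ?thesis"
  obtain x1 where x1: "\<And>x. x \<ge> x1 \<Longrightarrow> measure lebesgue ({x..2*x} - E) \<ge> x / 2"
    using finite_log_measure_dyadic[OF E] by metis
  obtain x2 where x2: "\<And>x. x \<ge> x2 \<Longrightarrow> D x \<ge> 1" using large by (auto simp: eventually_at_top_linorder)
  define \<eta> where "\<eta> = ln (1 + \<epsilon>)"
  have \<eta>: "\<eta> > 0" using \<epsilon> by (simp add: \<eta>_def)
  define \<phi> where "\<phi> = (\<lambda>r. ln (D r))"
  have mE: "E \<in> sets lebesgue" using E by (simp add: finite_log_measure_def)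
  have key: "\<eta> * (x / 2) \<le> \<sigma> * (ln (1 + \<bar>A\<bar>) + real K * ln (2 * x + \<sigma>))"
    if x: "x \<ge> max (max 1 x0) (max x1 x2)" for x
  proof -
    have D1: "D r \<ge> 1" if "r \<ge> x" for r using x2[of r] that x by simp
    have c\<phi>: "continuous_on {a..b} \<phi>" if "a \<ge> x" for a b
      unfolding \<phi>_def
    proof (intro continuous_on_ln continuous_on_subset[OF cont])
      show "\<forall>r\<in>{a..b}. D r \<noteq> 0"
      proof
        fix r assume "r \<in> {a..b}"
        then show "D r \<noteq> 0" using D1[of r] that by auto
      qed
    qed auto
    have c\<phi>': "continuous_on {a..b} (\<lambda>r. \<phi> (r + \<sigma>))" if "a \<ge> x" for a b
      by (rule continuous_on_compose2[OF c\<phi>[of "a + \<sigma>" "b + \<sigma>"]]) (use that \<sigma> in \<open>auto intro!: continuous_intros\<close>)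
    define \<psi> where "\<psi> = (\<lambda>r. \<phi> (r + \<sigma>) - \<phi> r)"
    have c\<psi>: "continuous_on {x..2*x} \<psi>" unfolding \<psi>_def by (intro continuous_intros c\<phi> c\<phi>') auto
    have \<psi>0: "\<psi> r \<ge> 0" if "r \<in> {x..2*x}" for r
    proof -
      have "D r \<le> D (r + \<sigma>)" using that x \<sigma> by (intro mono) auto
      then show ?thesis using D1[of r] that by (simp add: \<psi>_def \<phi>_def ln_mono)
    qed
    have \<psi>\<eta>: "\<psi> r \<ge> \<eta>" if r: "r \<in> {x..2*x} - E" for r
    proof -
      have "x0 \<le> r" "r \<notin> E" using r x by auto
      with neg have "(1 + \<epsilon>) * D r < D (r + \<sigma>)" by (meson not_le)
      then have "ln ((1 + \<epsilon>) * D r) \<le> ln (D (r + \<sigma>))" using D1[of r] r \<epsilon> by (intro ln_mono) auto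
      then show ?thesis using D1[of r] r \<epsilon> by (simp add: \<psi>_def \<phi>_def \<eta>_def ln_mult)
    qed
    let ?S = "{x..2*x} - E"
    have S: "?S \<in> lmeasurable" using mE by (intro fmeasurable_Diff) auto
    have aS: "\<psi> absolutely_integrable_on {x..2*x}" by (rule absolutely_integrable_continuous_real[OF c\<psi>])
    have iS: "\<psi> integrable_on ?S"
      using set_integrable_subset[OF aS, of ?S] S set_lebesgue_integral_eq_integral(1) by (auto simp: fmeasurableD)
    have "\<eta> * (x / 2) \<le> \<eta> * measure lebesgue ?S" using x1[of x] x \<eta> by (intro mult_left_mono) auto
    also have "\<dots> = integral ?S (\<lambda>_. \<eta>)"
      using lmeasure_integral[OF S] integral_mult_right[of ?S \<eta> "\<lambda>_. 1"] by simp
    also have "\<dots> \<le> integral ?S \<psi>" using S \<psi>\<eta> iS by (intro integral_le integrable_on_const) auto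
    also have "\<dots> \<le> integral {x..2*x} \<psi>"
      by (rule integral_subset_le) (use iS \<psi>0 integrable_continuous_real[OF c\<psi>] in auto)
    also have "\<dots> = integral {x..2*x} (\<lambda>r. \<phi> (r + \<sigma>)) - integral {x..2*x} \<phi>"
      unfolding \<psi>_def by (intro integral_diff integrable_continuous_real c\<phi> c\<phi>') auto
    also have "integral {x..2*x} (\<lambda>r. \<phi> (r + \<sigma>)) = integral {x+\<sigma>..2*x+\<sigma>} \<phi>"
      using integral_shift[of x \<sigma> "2*x" \<phi>] c\<phi>[of "x+\<sigma>" "2*x+\<sigma>"] \<sigma> by (simp add: add.commute o_def)
    also have "integral {x+\<sigma>..2*x+\<sigma>} \<phi> - integral {x..2*x} \<phi> = integral {2*x..2*x+\<sigma>} \<phi> - integral {x..x+\<sigma>} \<phi>"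
    proof -
      have i: "\<phi> integrable_on {x..2*x+\<sigma>}" by (intro integrable_continuous_real c\<phi>) auto
      have "integral {x..x+\<sigma>} \<phi> + integral {x+\<sigma>..2*x+\<sigma>} \<phi> = integral {x..2*x+\<sigma>} \<phi>"
        by (rule Henstock_Kurzweil_Integration.integral_combine) (use x \<sigma> i in auto)
      moreover have "integral {x..2*x} \<phi> + integral {2*x..2*x+\<sigma>} \<phi> = integral {x..2*x+\<sigma>} \<phi>"
        by (rule Henstock_Kurzweil_Integration.integral_combine) (use x \<sigma> i in auto)
      ultimately show ?thesis by simp
    qed
    also have "\<dots> \<le> integral {2*x..2*x+\<sigma>} \<phi>"
    proof -
      have "0 \<le> integral {x..x+\<sigma>} \<phi>"
        by (rule integral_nonneg) (use D1 in \<open>auto simp: \<phi>_def intro!: integrable_continuous_real c\<phi>[unfolded \<phi>_def]\<close>)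
      then show ?thesis by simp
    qed
    also have "\<dots> \<le> integral {2*x..2*x+\<sigma>} (\<lambda>_. ln (1 + \<bar>A\<bar>) + real K * ln (2 * x + \<sigma>))"
    proof (rule integral_le)
      fix r assume r: "r \<in> {2*x..2*x+\<sigma>}"
      have "D r \<le> D (2*x + \<sigma>)" using r x by (intro mono) auto
      also have "\<dots> \<le> A * (2*x + \<sigma>) ^ K" using x \<sigma> by (intro growth) auto
      also have "\<dots> \<le> (1 + \<bar>A\<bar>) * (2*x + \<sigma>) ^ K" using x \<sigma> by (intro mult_right_mono) auto
      finally have "\<phi> r \<le> ln ((1 + \<bar>A\<bar>) * (2*x + \<sigma>) ^ K)"
        unfolding \<phi>_def using D1[of r] r x by (intro ln_mono) auto
      also have "\<dots> = ln (1 + \<bar>A\<bar>) + real K * ln (2 * x + \<sigma>)"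
        using x \<sigma> by (subst ln_mult) (auto simp: ln_realpow)
      finally show "\<phi> r \<le> ln (1 + \<bar>A\<bar>) + real K * ln (2 * x + \<sigma>)" .
    qed (use x in \<open>auto intro!: integrable_continuous_real c\<phi>\<close>)
    also have "\<dots> = \<sigma> * (ln (1 + \<bar>A\<bar>) + real K * ln (2 * x + \<sigma>))" using \<sigma> by simp
    finally show ?thesis .
  qed
  \<comment> \<open>The left side of \<open>key\<close> is linear in x and its right side
    logarithmic.\<close>
  have "eventually (\<lambda>x. \<sigma> * (ln (1 + \<bar>A\<bar>) + real K * ln (2 * x + \<sigma>)) < \<eta> * (x / 2)) at_top"
    using \<sigma> \<eta> by real_asymp
  then obtain y where "\<And>x. x \<ge> y \<Longrightarrow> \<sigma> * (ln (1 + \<bar>A\<bar>) + real K * ln (2 * x + \<sigma>)) < \<eta> * (x / 2)"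
    by (auto simp: eventually_at_top_linorder)
  from this[of "max y (max (max 1 x0) (max x1 x2))"] key[of "max y (max (max 1 x0) (max x1 x2))"]
  show False by linarith
qed

section \<open>Transcendence and growth\<close>

lemma circ_mean_abs_lnorm_linear:
  assumes "norm a + 1 \<le> r"
  shows "circ_mean r (\<lambda>z. \<bar>lnorm (\<lambda>z. z - a) z\<bar>) = ln r"
proof -
  have r: "r > 0" "norm a \<le> r" using assms norm_ge_zero[of a] by linarith+
  have "circ_mean r (\<lambda>z. \<bar>lnorm (\<lambda>z. z - a) z\<bar>) = circ_mean r (lnorm (\<lambda>z. z - a))"
  proof (rule circ_mean_spike[OF r(1) finite.emptyI])
    fix z :: complex assume "norm z = r"
    then have "norm (z - a) \<ge> 1" using norm_triangle_ineq2[of z a] assms by simp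
    then show "\<bar>lnorm (\<lambda>z. z - a) z\<bar> = lnorm (\<lambda>z. z - a) z" by simp
  qed
  also have "\<dots> = ln r" by (rule circ_mean_lnorm_linear[OF r(2,1)])
  finally show ?thesis .
qed

text \<open>n zeros of modulus at most R contribute at least n (ln r - ln R), which outgrows C ln r
  + C' once n > C. Since this holds for all large \<open>r\<close>, an upper bound along a sequence
  of radii is enough.\<close>

lemma finite_zeros_if_log_growth:
  assumes F: "entire_nz F" and growth: "\<And>x. \<exists>r\<ge>x. Ncount (zord F) r \<le> C * ln r + C'"
  shows "finite {z. F z = 0}"
proof (rule ccontr)
  assume "infinite {z. F z = 0}"
  define n where "n = nat \<lceil>\<bar>C\<bar>\<rceil> + 1"
  have n: "real n > C" unfolding n_def by linarith
  obtain Z where Z: "Z \<subseteq> {z. F z = 0}" "finite Z" "card Z = n"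
    using \<open>infinite {z. F z = 0}\<close> infinite_arbitrarily_large by metis
  define R where "R = Max (insert 1 (norm ` Z))"
  have R: "R \<ge> 1" "\<And>a. a \<in> Z \<Longrightarrow> norm a \<le> R" unfolding R_def using Z by auto
  have lower: "real n * (ln r - ln R) \<le> Ncount (zord F) r" if r: "r \<ge> R" for r
  proof -
    have fin: "finite {a. F a = 0 \<and> norm a \<le> r}" by (rule entire_nz_finite_zeros[OF F])
    have r1: "r \<ge> 1" using r R by simp
    have "real n * (ln r - ln R) = (\<Sum>a\<in>Z. ln r - ln R)" using Z by simp
    also have "\<dots> \<le> (\<Sum>a\<in>Z. real (zord F a) * (if a = 0 then ln r else ln (r / norm a)))"
    proof (rule sum_mono)
      fix a assume a: "a \<in> Z"
      have "zord F a > 0" using a Z(1) zord_pos_iff[OF F] by auto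
      then have 1: "real (zord F a) \<ge> 1" by simp
      have 2: "ln r - ln R \<le> (if a = 0 then ln r else ln (r / norm a))"
        using R(1) R(2)[OF a] r1 by (auto simp: ln_div intro!: ln_mono)
      have "0 \<le> ln r - ln R" using r R by simp
      then have "1 * (ln r - ln R) \<le> real (zord F a) * (if a = 0 then ln r else ln (r / norm a))"
        using 1 2 by (intro mult_mono) auto
      then show "ln r - ln R \<le> real (zord F a) * (if a = 0 then ln r else ln (r / norm a))" by simp
    qed
    also have "\<dots> \<le> (\<Sum>a | F a = 0 \<and> norm a \<le> r. real (zord F a) * (if a = 0 then ln r else ln (r / norm a)))"
      using Z(1) R(2) r r1 by (intro sum_mono2[OF fin] mult_nonneg_nonneg Ncount_weight_nonneg) fastforce+
    also have "\<dots> = Ncount (zord F) r"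
      by (rule Ncount_superset[OF fin, symmetric]) (auto simp: zord_def split: if_splits)
    finally show ?thesis .
  qed
  have "eventually (\<lambda>r. C * ln r + C' < real n * (ln r - ln R)) at_top"
  proof -
    have "filterlim (\<lambda>r. (real n - C) * ln r) at_top at_top"
      using n by (intro filterlim_tendsto_pos_mult_at_top[OF tendsto_const] ln_at_top) auto
    then have "eventually (\<lambda>r. (real n - C) * ln r > C' + real n * ln R) at_top"
      by (simp add: filterlim_at_top_dense)
    then show ?thesis by eventually_elim (simp add: algebra_simps)
  qed
  then obtain y where y: "\<And>r. r \<ge> y \<Longrightarrow> C * ln r + C' < real n * (ln r - ln R)"
    by (auto simp: eventually_at_top_linorder)
  obtain r where r: "r \<ge> max y R" "Ncount (zord F) r \<le> C * ln r + C'" using growth by blast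
  from y[of r] lower[of r] r show False by simp
qed

section \<open>Rationality of g/h under logarithmic growth\<close>

context coprime_entire
begin

lemma circ_mean_lnorm_le_D:
  assumes "r > 0" shows "circ_mean r (lnorm g) \<le> D r" "circ_mean r (lnorm h) \<le> D r"
proof -
  show "circ_mean r (lnorm g) \<le> D r"
    by (rule circ_mean_mono[OF assms circ_int_lnorm[OF g assms] circ_int_u entire_nz_finite_zeros[OF g, of r]])
       (auto intro: lnorm_le_u)
  show "circ_mean r (lnorm h) \<le> D r"
    by (rule circ_mean_mono[OF assms circ_int_lnorm[OF h assms] circ_int_u entire_nz_finite_zeros[OF h, of r]])
       (auto intro: lnorm_le_u)
qed

text \<open>The first main theorem for the values 0 and infinity: Jensen's formula together with
  log|g|, log|h| <= u off the zeros.\<close>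

lemma Ncount_le_D:
  obtains C where "\<And>r. r > 0 \<Longrightarrow> Ncount (zord g) r \<le> D r + C" "\<And>r. r > 0 \<Longrightarrow> Ncount (zord h) r \<le> D r + C"
    "C \<ge> 0"
proof -
  obtain Cg where Cg: "\<And>r. r > 0 \<Longrightarrow> circ_mean r (lnorm g) = Ncount (zord g) r + Cg"
    using jensen[OF g] by metis
  obtain Ch where Ch: "\<And>r. r > 0 \<Longrightarrow> circ_mean r (lnorm h) = Ncount (zord h) r + Ch"
    using jensen[OF h] by metis
  show thesis
    by (rule that[of "\<bar>Cg\<bar> + \<bar>Ch\<bar>"]) (use Cg Ch circ_mean_lnorm_le_D in \<open>fastforce simp: abs_if\<close>)+
qed

lemma circ_mean_abs_log_ratio:
  assumes "r \<ge> 1"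
  shows "circ_mean r (\<lambda>z. \<bar>lnorm g z - lnorm h z\<bar>) = 2 * D r - circ_mean r (lnorm g) - circ_mean r (lnorm h)"
proof -
  have r: "r > 0" using assms by simp
  have fin: "finite ({z. g z = 0 \<and> norm z \<le> r} \<union> {z. h z = 0 \<and> norm z \<le> r})"
    using entire_nz_finite_zeros g h by simp
  have "circ_mean r (\<lambda>z. \<bar>lnorm g z - lnorm h z\<bar>) = circ_mean r (\<lambda>z. 2 * u z - lnorm g z - lnorm h z)"
  proof (rule circ_mean_spike[OF r fin])
    fix z assume "norm z = r" "z \<notin> {z. g z = 0 \<and> norm z \<le> r} \<union> {z. h z = 0 \<and> norm z \<le> r}"
    then have "g z \<noteq> 0" "h z \<noteq> 0" by auto
    then have "u z = max (lnorm g z) (lnorm h z)" by (auto simp: log_max_def max_def)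
    then show "\<bar>lnorm g z - lnorm h z\<bar> = 2 * u z - lnorm g z - lnorm h z" by (auto simp: max_def)
  qed
  then show ?thesis
    using circ_int_lnorm[OF g r] circ_int_lnorm[OF h r] circ_int_u
    by (simp add: circ_mean_diff circ_int_diff circ_int_cmult circ_mean_cmult)
qed

text \<open>If \<open>D r = O(ln r)\<close> along a sequence, then \<open>g\<close> and \<open>h\<close> have finitely many zeros, so that
  \<open>g / h = (P / Q) e\<^sup>k\<close> for polynomials \<open>P\<close>, \<open>Q\<close>, and the mean of \<open>|Re k|\<close> is \<open>O(ln r)\<close>, which forces \<open>k\<close> to be constant.\<close>

lemma rational_if_log_growth:
  assumes growth: "\<And>x. \<exists>r\<ge>x. D r \<le> C * ln r"
  shows "\<exists>P Q :: complex poly. Q \<noteq> 0 \<and> (\<forall>\<^sub>\<approx>z\<in>UNIV. g z / h z = poly P z / poly Q z)"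
proof -
  obtain C1 where C1: "\<And>r. r > 0 \<Longrightarrow> Ncount (zord g) r \<le> D r + C1" "\<And>r. r > 0 \<Longrightarrow> Ncount (zord h) r \<le> D r + C1"
    by (rule Ncount_le_D) blast
  have growth': "\<exists>r\<ge>x. r \<ge> y \<and> D r \<le> C * ln r" for x y
    using growth[of "max x y"] by auto
  define Zg Zh where "Zg = {z. g z = 0}" and "Zh = {z. h z = 0}"
  have "\<exists>r\<ge>x. Ncount (zord g) r \<le> C * ln r + C1" for x
    using growth'[of x 1] C1(1) by (meson add_right_mono less_le_trans order_trans zero_less_one)
  then have Zg: "finite Zg" unfolding Zg_def by (rule finite_zeros_if_log_growth[OF g])
  have "\<exists>r\<ge>x. Ncount (zord h) r \<le> C * ln r + C1" for x
    using growth'[of x 1] C1(2) by (meson add_right_mono less_le_trans order_trans zero_less_one)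
  then have Zh: "finite Zh" unfolding Zh_def by (rule finite_zeros_if_log_growth[OF h])
  obtain G where G: "entire_nz G" "\<And>z. g z = (\<Prod>a\<in>Zg. (z - a) ^ zord g a) * G z" "\<And>a. a \<in> Zg \<Longrightarrow> G a \<noteq> 0"
    using entire_nz_divide_zeros[OF g Zg] by metis
  obtain H where H: "entire_nz H" "\<And>z. h z = (\<Prod>a\<in>Zh. (z - a) ^ zord h a) * H z" "\<And>a. a \<in> Zh \<Longrightarrow> H a \<noteq> 0"
    using entire_nz_divide_zeros[OF h Zh] by metis
  have Gnz: "G z \<noteq> 0" for z
  proof
    assume "G z = 0"
    then have "z \<in> Zg" using G(2)[of z] by (simp add: Zg_def)
    then show False using G(3) \<open>G z = 0\<close> by blast
  qed
  have Hnz: "H z \<noteq> 0" for z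
  proof
    assume "H z = 0"
    then have "z \<in> Zh" using H(2)[of z] by (simp add: Zh_def)
    then show False using H(3) \<open>H z = 0\<close> by blast
  qed
  have "(\<lambda>z. G z / H z) holomorphic_on UNIV"
    using G(1) H(1) Hnz by (intro holomorphic_intros entire_nz_holomorphic) auto
  moreover have "contractible (UNIV :: complex set)" by (intro convex_imp_contractible) simp
  ultimately obtain k where k: "k holomorphic_on UNIV" "\<And>z. G z / H z = exp (k z)"
    using contractible_imp_holomorphic_log[of "\<lambda>z. G z / H z" UNIV] Gnz Hnz by auto
  have Rek: "Re (k z) = lnorm G z - lnorm H z" for z
  proof -
    have "ln (norm (G z / H z)) = Re (k z)" by (simp add: k(2))
    then show ?thesis using Gnz[of z] Hnz[of z] by (simp add: norm_divide ln_div)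
  qed
  define N where "N = real (\<Sum>a\<in>Zg. zord g a) + real (\<Sum>a\<in>Zh. zord h a)"
  obtain Cg where Cg: "\<And>r. r > 0 \<Longrightarrow> circ_mean r (lnorm g) = Ncount (zord g) r + Cg"
    using jensen[OF g] by metis
  obtain Ch where Ch: "\<And>r. r > 0 \<Longrightarrow> circ_mean r (lnorm h) = Ncount (zord h) r + Ch"
    using jensen[OF h] by metis
  \<comment> \<open>A circle of radius at least \<open>r0\<close> stays at distance at least 1 from
    every zero, so ln|z - a| is nonnegative on it and the mean of its absolute value is ln
    r.\<close>
  define r0 where "r0 = Max (insert 1 (norm ` (Zg \<union> Zh))) + 1"
  have r0: "r0 \<ge> 1" "\<And>a. a \<in> Zg \<union> Zh \<Longrightarrow> norm a + 1 \<le> r0"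
  proof -
    have "finite (insert 1 (norm ` (Zg \<union> Zh)))" using Zg Zh by simp
    note M = Max_ge[OF this]
    show "r0 \<ge> 1" using M[of 1] by (simp add: r0_def)
    show "norm a + 1 \<le> r0" if "a \<in> Zg \<union> Zh" for a using M[of "norm a"] that by (auto simp: r0_def)
  qed
  have mean: "circ_mean r (\<lambda>z. \<bar>Re (k z)\<bar>) \<le> 2 * D r + \<bar>Cg\<bar> + \<bar>Ch\<bar> + N * ln r" if r: "r \<ge> r0" for r
  proof -
    have r1: "r \<ge> 1" "r > 0" using r r0 by auto
    have lin: "circ_int r (\<lambda>z. \<bar>lnorm (\<lambda>z. z - a) z\<bar>)" "circ_mean r (\<lambda>z. \<bar>lnorm (\<lambda>z. z - a) z\<bar>) = ln r"
      if "a \<in> Zg \<union> Zh" for a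
    proof -
      have "norm a + 1 \<le> r" using r0(2)[OF that] r by simp
      then show "circ_int r (\<lambda>z. \<bar>lnorm (\<lambda>z. z - a) z\<bar>)" "circ_mean r (\<lambda>z. \<bar>lnorm (\<lambda>z. z - a) z\<bar>) = ln r"
        using r1 by (auto intro!: circ_int_abs circ_int_lnorm_linear circ_mean_abs_lnorm_linear)
    qed
    define Sg Sh where "Sg = (\<lambda>z. \<Sum>a\<in>Zg. real (zord g a) * \<bar>lnorm (\<lambda>z. z - a) z\<bar>)"
      and "Sh = (\<lambda>z. \<Sum>a\<in>Zh. real (zord h a) * \<bar>lnorm (\<lambda>z. z - a) z\<bar>)"
    have iS: "circ_int r Sg" "circ_int r Sh"
      unfolding Sg_def Sh_def by (intro circ_int_sum circ_int_cmult lin; simp)+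
    have mS: "circ_mean r Sg = real (\<Sum>a\<in>Zg. zord g a) * ln r" "circ_mean r Sh = real (\<Sum>a\<in>Zh. zord h a) * ln r"
    proof -
      have "circ_mean r Sg = (\<Sum>a\<in>Zg. circ_mean r (\<lambda>z. real (zord g a) * \<bar>lnorm (\<lambda>z. z - a) z\<bar>))"
        unfolding Sg_def by (intro circ_mean_sum circ_int_cmult lin) simp
      also have "\<dots> = (\<Sum>a\<in>Zg. real (zord g a) * ln r)"
        unfolding circ_mean_cmult by (intro sum.cong refl, subst lin) auto
      finally show "circ_mean r Sg = real (\<Sum>a\<in>Zg. zord g a) * ln r" by (simp add: sum_distrib_right)
      have "circ_mean r Sh = (\<Sum>a\<in>Zh. circ_mean r (\<lambda>z. real (zord h a) * \<bar>lnorm (\<lambda>z. z - a) z\<bar>))"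
        unfolding Sh_def by (intro circ_mean_sum circ_int_cmult lin) simp
      also have "\<dots> = (\<Sum>a\<in>Zh. real (zord h a) * ln r)"
        unfolding circ_mean_cmult by (intro sum.cong refl, subst lin) auto
      finally show "circ_mean r Sh = real (\<Sum>a\<in>Zh. zord h a) * ln r" by (simp add: sum_distrib_right)
    qed
    have igh: "circ_int r (\<lambda>z. \<bar>lnorm g z - lnorm h z\<bar>)"
      by (intro circ_int_abs circ_int_diff circ_int_lnorm g h r1)
    have "circ_mean r (\<lambda>z. \<bar>Re (k z)\<bar>) \<le> circ_mean r (\<lambda>z. \<bar>lnorm g z - lnorm h z\<bar> + (Sg z + Sh z))"
    proof (rule circ_mean_mono[OF r1(2)])
      show "circ_int r (\<lambda>z. \<bar>Re (k z)\<bar>)"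
        by (intro circ_int_abs circ_int_continuous continuous_intros holomorphic_on_imp_continuous_on k)
      show "circ_int r (\<lambda>z. \<bar>lnorm g z - lnorm h z\<bar> + (Sg z + Sh z))"
        by (intro circ_int_add igh iS)
      show "finite (Zg \<union> Zh)" using Zg Zh by simp
      fix z assume "norm z = r" "z \<notin> Zg \<union> Zh"
      then have nz: "g z \<noteq> 0" "h z \<noteq> 0" by (auto simp: Zg_def Zh_def)
      have eg: "lnorm g z = (\<Sum>a\<in>Zg. real (zord g a) * lnorm (\<lambda>z. z - a) z) + lnorm G z"
        by (rule lnorm_factorization[OF G(2) Zg nz(1)])
      have eh: "lnorm h z = (\<Sum>a\<in>Zh. real (zord h a) * lnorm (\<lambda>z. z - a) z) + lnorm H z"
        by (rule lnorm_factorization[OF H(2) Zh nz(2)])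
      have "\<bar>\<Sum>a\<in>Zg. real (zord g a) * lnorm (\<lambda>z. z - a) z\<bar> \<le> Sg z"
        unfolding Sg_def by (rule order_trans[OF sum_abs]) (simp add: abs_mult)
      moreover have "\<bar>\<Sum>a\<in>Zh. real (zord h a) * lnorm (\<lambda>z. z - a) z\<bar> \<le> Sh z"
        unfolding Sh_def by (rule order_trans[OF sum_abs]) (simp add: abs_mult)
      ultimately show "\<bar>Re (k z)\<bar> \<le> \<bar>lnorm g z - lnorm h z\<bar> + (Sg z + Sh z)"
        using eg eh Rek[of z] by linarith
    qed
    also have "\<dots> = 2 * D r - circ_mean r (lnorm g) - circ_mean r (lnorm h) + N * ln r"
      using circ_mean_abs_log_ratio[OF r1(1)] igh iS mS
      by (simp add: circ_mean_add circ_int_add N_def algebra_simps)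
    also have "\<dots> \<le> 2 * D r + \<bar>Cg\<bar> + \<bar>Ch\<bar> + N * ln r"
      using Cg[OF r1(2)] Ch[OF r1(2)] Ncount_nonneg[OF r1(1), of "zord g"] Ncount_nonneg[OF r1(1), of "zord h"]
      by linarith
    finally show ?thesis .
  qed
  have dk: "deriv k z = 0" for z
  proof (rule ccontr)
    assume "deriv k z \<noteq> 0"
    define d where "d = norm (deriv k z)"
    have d: "d > 0" using \<open>deriv k z \<noteq> 0\<close> by (simp add: d_def)
    \<comment> \<open>Along the sequence the mean of |Re k| is O(ln r), so the derivative estimate
      yields |k'(z)| = O(ln r / r), which tends to 0.\<close>
    have "eventually (\<lambda>r. 2 * r / (r - norm z)\<^sup>2 * (2 * (C * ln r) + \<bar>Cg\<bar> + \<bar>Ch\<bar> + N * ln r) < d) at_top"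
    proof -
      have "((\<lambda>r. 2 * r / (r - norm z)\<^sup>2 * (2 * (C * ln r) + \<bar>Cg\<bar> + \<bar>Ch\<bar> + N * ln r)) \<longlongrightarrow> 0) at_top"
        by real_asymp
      then show ?thesis using d by (rule order_tendstoD)
    qed
    then obtain y where y: "\<And>r. r \<ge> y \<Longrightarrow> 2 * r / (r - norm z)\<^sup>2 * (2 * (C * ln r) + \<bar>Cg\<bar> + \<bar>Ch\<bar> + N * ln r) < d"
      by (auto simp: eventually_at_top_linorder)
    obtain r where r: "r \<ge> max y r0" "r \<ge> norm z + 1" "D r \<le> C * ln r"
      using growth'[of "max y r0" "norm z + 1"] by blast
    have kr: "k holomorphic_on ball 0 (r + 1)" using k(1) by (rule holomorphic_on_subset) simp
    have zr: "norm z < r" using r by simp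
    have "d \<le> 2 * r / (r - norm z)\<^sup>2 * circ_mean r (\<lambda>z. \<bar>Re (k z)\<bar>)"
      unfolding d_def by (rule norm_deriv_le_circle_mean[OF kr _ zr]) simp
    also have "\<dots> \<le> 2 * r / (r - norm z)\<^sup>2 * (2 * (C * ln r) + \<bar>Cg\<bar> + \<bar>Ch\<bar> + N * ln r)"
      using mean[of r] r r0 by (intro mult_left_mono) auto
    also have "\<dots> < d" using y[of r] r by simp
    finally show False by simp
  qed
  have "\<exists>c. \<forall>z. k z = c"
  proof -
    have "(k has_field_derivative 0) (at z)" for z
      using holomorphic_derivI[OF k(1) open_UNIV UNIV_I, of z] dk[of z] by simp
    then have "k constant_on UNIV"
      using has_field_derivative_0_imp_constant_on[of UNIV k] by auto
    then show ?thesis by (auto simp: constant_on_def)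
  qed
  then obtain c where c: "\<And>z. k z = c" by blast
  define P where "P = smult (exp c) (\<Prod>a\<in>Zg. [:- a, 1:] ^ zord g a)"
  define Q where "Q = (\<Prod>a\<in>Zh. [:- a, 1:] ^ zord h a)"
  have "Q \<noteq> 0" unfolding Q_def using Zh by simp
  moreover have "g z / h z = poly P z / poly Q z" for z
  proof -
    have "G z = exp c * H z" using k(2)[of z] c Hnz[of z] by (simp add: field_simps)
    moreover have "poly P z = exp c * (\<Prod>a\<in>Zg. (z - a) ^ zord g a)" by (simp add: P_def poly_prod)
    moreover have "poly Q z = (\<Prod>a\<in>Zh. (z - a) ^ zord h a)" by (simp add: Q_def poly_prod)
    ultimately show ?thesis using G(2)[of z] H(2)[of z] Hnz[of z] by simp
  qed
  ultimately show ?thesis by (intro exI[of _ P] exI[of _ Q]) simp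
qed

end

section \<open>The truncated second main theorem\<close>

lemma not_entire_nz:
  assumes "F holomorphic_on UNIV" "\<not> entire_nz F" shows "F z = 0"
  using assms by (auto simp: entire_nz_def)

text \<open>Near a point with \<open>B\<close> nonzero the derivative of A/B vanishes, and the
  identity theorem extends A = cB to the whole plane.\<close>

lemma wronskian_zero_imp_proportional:
  assumes A: "entire_nz A" and B: "entire_nz B" and W: "\<And>z. A z * deriv B z - deriv A z * B z = 0"
  obtains c where "c \<noteq> 0" "\<And>z. A z = c * B z"
proof -
  obtain z0 where z0: "B z0 \<noteq> 0" using B by (auto simp: entire_nz_def)
  have "continuous (at z0) B"
    using entire_nz_holomorphic[OF B, of UNIV] holomorphic_on_imp_continuous_on
      continuous_on_eq_continuous_at[of UNIV] by blast
  then have "eventually (\<lambda>z. B z \<noteq> 0) (nhds z0)"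
    using z0 tendsto_imp_eventually_ne[of B "B z0" "at z0" 0]
    by (auto simp: continuous_at eventually_at_filter elim: eventually_mono)
  then obtain e where e: "e > 0" "\<And>z. z \<in> ball z0 e \<Longrightarrow> B z \<noteq> 0"
    by (auto simp: eventually_nhds_metric dist_commute)
  have "(\<lambda>z. A z / B z) constant_on ball z0 e"
  proof (rule has_field_derivative_0_imp_constant_on)
    fix z assume z: "z \<in> ball z0 e"
    have "(A has_field_derivative deriv A z) (at z)" "(B has_field_derivative deriv B z) (at z)"
      using holomorphic_derivI[OF entire_nz_holomorphic[OF A] open_UNIV, of z]
        holomorphic_derivI[OF entire_nz_holomorphic[OF B] open_UNIV, of z] by simp_all
    then have "((\<lambda>z. A z / B z) has_field_derivative (deriv A z * B z - A z * deriv B z) / (B z * B z)) (at z)"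
      using e(2)[OF z] by (rule DERIV_divide)
    moreover have "deriv A z * B z - A z * deriv B z = 0" using W[of z] by simp
    ultimately show "((\<lambda>z. A z / B z) has_field_derivative 0) (at z)" by simp
  qed auto
  then obtain c where c: "\<And>z. z \<in> ball z0 e \<Longrightarrow> A z / B z = c" by (auto simp: constant_on_def)
  define G where "G = (\<lambda>z. A z - c * B z)"
  have G0: "G z = 0" if "z \<in> ball z0 e" for z
    using c[OF that] e(2)[OF that] by (simp add: G_def field_simps)
  have "G z = 0" for z
  proof (rule not_entire_nz[of G])
    show "G holomorphic_on UNIV" unfolding G_def
      by (intro holomorphic_intros entire_nz_holomorphic A B)
    show "\<not> entire_nz G"
    proof
      assume "entire_nz G"
      then have "eventually (\<lambda>z. G z \<noteq> 0) (at z0)" by (rule entire_nz_eventually)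
      moreover have "eventually (\<lambda>z. z \<in> ball z0 e) (at z0)"
        using e(1) by (intro eventually_at_in_open') auto
      ultimately have "eventually (\<lambda>z. False) (at z0)"
        by eventually_elim (use G0 in blast)
      then show False by simp
    qed
  qed
  then have eq: "A z = c * B z" for z by (simp add: G_def)
  moreover have "c \<noteq> 0" using eq A by (auto simp: entire_nz_def)
  ultimately show thesis using that by blast
qed

text \<open>Common zeros of \<open>A\<close> and \<open>B\<close> are allowed: \<open>\<mu>\<close> bounds their order, so that \<open>Ncount \<mu>\<close> accounts for
  the common factor by which one would otherwise divide.\<close>

lemma truncated_second_main_theorem:
  fixes C :: real and K :: nat and \<nu> \<mu> :: "complex \<Rightarrow> nat"
  assumes A: "entire_nz A" and B: "entire_nz B"
    and growth: "\<And>r. r \<ge> 1 \<Longrightarrow> circ_mean r (\<lambda>z. max (lnorm A z) (lnorm B z)) \<le> C * r ^ K"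
    and \<mu>: "locfin \<mu>" and \<nu>: "locfin \<nu>" and common: "\<And>a. zord A a \<le> \<mu> a \<or> zord B a \<le> \<mu> a"
    and trunc: "\<And>a. entire_nz (\<lambda>z. A z + B z) \<Longrightarrow> A a = 0 \<or> B a = 0 \<or> A a + B a = 0 \<Longrightarrow> 1 \<le> \<nu> a"
  obtains C' where
    "\<And>r. r \<ge> 1 \<Longrightarrow> circ_mean r (\<lambda>z. max (lnorm A z) (lnorm B z)) \<le> Ncount \<mu> r + Ncount \<nu> r + C' * (1 + ln r)"
proof -
  define P where "P = (\<lambda>z. A z + B z)"
  define W where "W = (\<lambda>z. A z * deriv B z - deriv A z * B z)"
  have iA: "circ_int r (lnorm A)" and iB: "circ_int r (lnorm B)" if "r > 0" for r
    using circ_int_lnorm A B that by auto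
  obtain CA where CA: "\<And>r. r > 0 \<Longrightarrow> circ_mean r (lnorm A) = Ncount (zord A) r + CA"
    using jensen[OF A] by metis
  obtain CB where CB: "\<And>r. r > 0 \<Longrightarrow> circ_mean r (lnorm B) = Ncount (zord B) r + CB"
    using jensen[OF B] by metis
  have Whol: "W holomorphic_on UNIV"
    unfolding W_def by (intro holomorphic_intros entire_nz_holomorphic A B open_UNIV)
  have dP: "deriv P z = deriv A z + deriv B z" for z
    unfolding P_def
    by (rule DERIV_imp_deriv[OF DERIV_add[OF holomorphic_derivI[OF entire_nz_holomorphic[OF A] open_UNIV UNIV_I]
        holomorphic_derivI[OF entire_nz_holomorphic[OF B] open_UNIV UNIV_I]]])
  show thesis
  proof (cases "entire_nz W")
    \<comment> \<open>In the degenerate case A = cB the two divisors coincide and are bounded by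
      \<open>\<mu>\<close>, so Jensen's formula alone gives the estimate.\<close>
    case False
    then have "A z * deriv B z - deriv A z * B z = 0" for z
      using not_entire_nz[OF Whol] by (simp add: W_def)
    then obtain c where c: "c \<noteq> 0" "\<And>z. A z = c * B z"
      using wronskian_zero_imp_proportional[OF A B] by metis
    have zAB: "zord A a = zord B a" for a
    proof -
      have "A = (\<lambda>z. c * B z)" using c by auto
      then have "zord A a = zord (\<lambda>_. c) a + zord B a"
        using zord_mult[of "\<lambda>_. c" B a] c(1) B by simp
      then show ?thesis using c(1) by simp
    qed
    define c' where "c' = \<bar>CA\<bar> + \<bar>ln (norm c)\<bar>"
    have le: "circ_mean r (\<lambda>z. max (lnorm A z) (lnorm B z)) \<le> Ncount \<mu> r + Ncount \<nu> r + c' * (1 + ln r)"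
      if r: "r \<ge> 1" for r
    proof -
      have r0: "r > 0" using r by simp
      have "circ_mean r (\<lambda>z. max (lnorm A z) (lnorm B z)) \<le> circ_mean r (\<lambda>z. lnorm A z + \<bar>ln (norm c)\<bar>)"
      proof (rule circ_mean_mono[OF r0])
        fix z assume "norm z = r" "z \<notin> {z. B z = 0 \<and> norm z \<le> r}"
        then have "lnorm A z = ln (norm c) + lnorm B z"
          using c by (simp add: norm_mult ln_mult)
        then show "max (lnorm A z) (lnorm B z) \<le> lnorm A z + \<bar>ln (norm c)\<bar>" by simp
      qed (intro circ_int_max circ_int_add circ_int_const iA iB r0 entire_nz_finite_zeros B)+
      also have "\<dots> = Ncount (zord A) r + CA + \<bar>ln (norm c)\<bar>"
        by (subst circ_mean_add[OF iA[OF r0] circ_int_const]) (simp add: CA[OF r0])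
      also have "Ncount (zord A) r \<le> Ncount \<mu> r"
      proof (rule Ncount_mono[OF \<mu> _ r])
        show "zord A a \<le> \<mu> a" for a using common[of a] zAB[of a] by auto
      qed
      finally have "circ_mean r (\<lambda>z. max (lnorm A z) (lnorm B z)) \<le> Ncount \<mu> r + c'"
        unfolding c'_def by linarith
      moreover have "0 \<le> Ncount \<nu> r" by (rule Ncount_nonneg[OF r])
      moreover have "c' * 1 \<le> c' * (1 + ln r)"
        using r by (intro mult_left_mono) (auto simp: c'_def)
      ultimately show ?thesis by linarith
    qed
    show thesis using le by (rule that)
  next
    case True
    have P: "entire_nz P"
    proof (rule ccontr)
      assume "\<not> entire_nz P"
      moreover have "P holomorphic_on UNIV"
        unfolding P_def by (intro holomorphic_intros entire_nz_holomorphic A B)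
      ultimately have P0: "P z = 0" for z using not_entire_nz by blast
      then have "deriv P z = 0" for z
        by (metis (no_types, lifting) DERIV_const DERIV_imp_deriv ext)
      then have d: "deriv B z = - deriv A z" for z using dP[of z] by (metis add.commute add_eq_0_iff)
      have "B z = - A z" for z using P0[of z] by (simp add: P_def add_eq_0_iff)
      then have "W z = 0" for z using d by (simp add: W_def)
      then show False using True by (simp add: entire_nz_def)
    qed
    have iP: "circ_int r (lnorm P)" and iW: "circ_int r (lnorm W)" if "r > 0" for r
      using circ_int_lnorm P True that by auto
    obtain CP where CP: "\<And>r. r > 0 \<Longrightarrow> circ_mean r (lnorm P) = Ncount (zord P) r + CP"
      using jensen[OF P] by metis
    obtain CW where CW: "\<And>r. r > 0 \<Longrightarrow> circ_mean r (lnorm W) = Ncount (zord W) r + CW"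
      using jensen[OF True] by metis
    have Pz: "P z = A z + B z" for z by (simp add: P_def)
    \<comment> \<open>The Wronskian is bilinear and alternating, so the pairs (A, A + B) and (B, A +
      B) have the Wronskians W and -W; one function serves all three pairs.\<close>
    have WAP: "(\<lambda>z. A z * deriv P z - deriv A z * P z) = W"
      unfolding dP W_def by (simp add: Pz algebra_simps fun_eq_iff)
    have WBP: "(\<lambda>z. B z * deriv P z - deriv B z * P z) = (\<lambda>z. - W z)"
      unfolding dP W_def by (simp add: Pz algebra_simps fun_eq_iff)
    have nW: "entire_nz (\<lambda>z. - W z)" using True by (auto simp: entire_nz_def intro: holomorphic_intros)
    have lnP: "lnorm P z \<le> max (lnorm A z) (lnorm B z) + ln 2" if "A z \<noteq> 0" "B z \<noteq> 0" "P z \<noteq> 0" for z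
    proof -
      have "norm (P z) \<le> 2 * max (norm (A z)) (norm (B z))"
        using norm_triangle_ineq[of "A z" "B z"] by (simp add: P_def)
      then have "lnorm P z \<le> ln (2 * max (norm (A z)) (norm (B z)))"
        using that by (intro ln_mono) auto
      also have "\<dots> = ln 2 + ln (max (norm (A z)) (norm (B z)))"
      proof -
        have "0 < norm (A z)" using that by simp
        then have "0 < max (norm (A z)) (norm (B z))" by (rule less_le_trans) simp
        then show ?thesis by (simp add: ln_mult)
      qed
      also have "ln (max (norm (A z)) (norm (B z))) = max (lnorm A z) (lnorm B z)"
        using that by (auto simp: max_def)
      finally show ?thesis by simp
    qed
    have growthP: "circ_mean r (\<lambda>z. max (lnorm F z) (lnorm P z)) \<le> (C + ln 2) * r ^ K"
      if r: "r \<ge> 1" and F: "F = A \<or> F = B" for r F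
    proof -
      have r0: "r > 0" using r by simp
      have iF: "circ_int r (lnorm F)" using F iA[OF r0] iB[OF r0] by auto
      have fin: "finite ({z. A z = 0 \<and> norm z \<le> r} \<union> {z. B z = 0 \<and> norm z \<le> r} \<union> {z. P z = 0 \<and> norm z \<le> r})"
        using entire_nz_finite_zeros A B P by auto
      have "circ_mean r (\<lambda>z. max (lnorm F z) (lnorm P z)) \<le> circ_mean r (\<lambda>z. max (lnorm A z) (lnorm B z) + ln 2)"
      proof (rule circ_mean_mono[OF r0 _ _ fin])
        show "circ_int r (\<lambda>z. max (lnorm F z) (lnorm P z))" by (intro circ_int_max iF iP r0)
        show "circ_int r (\<lambda>z. max (lnorm A z) (lnorm B z) + ln 2)"
          by (intro circ_int_max circ_int_add circ_int_const iA iB r0)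
        fix z assume z: "norm z = r"
          "z \<notin> {z. A z = 0 \<and> norm z \<le> r} \<union> {z. B z = 0 \<and> norm z \<le> r} \<union> {z. P z = 0 \<and> norm z \<le> r}"
        have "lnorm F z \<le> max (lnorm A z) (lnorm B z) + ln 2"
          using F by (auto simp: le_max_iff_disj intro: add_increasing2)
        then show "max (lnorm F z) (lnorm P z) \<le> max (lnorm A z) (lnorm B z) + ln 2"
          using lnP[of z] z by simp
      qed
      also have "\<dots> = circ_mean r (\<lambda>z. max (lnorm A z) (lnorm B z)) + ln 2"
        by (subst circ_mean_add[OF circ_int_max[OF iA[OF r0] iB[OF r0]] circ_int_const]) simp
      also have "\<dots> \<le> C * r ^ K + ln 2 * r ^ K"
      proof (rule add_mono[OF growth[OF r]])
        have "1 \<le> r ^ K" using r by (rule one_le_power)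
        then show "ln 2 \<le> ln 2 * r ^ K" by simp
      qed
      finally show ?thesis by (simp add: algebra_simps)
    qed
    obtain B1 where B1: "\<And>r. r \<ge> 1 \<Longrightarrow> circ_mean r (\<lambda>z. max 0 (lnorm W z - lnorm A z - lnorm B z)) \<le> B1 * (1 + ln r)"
      proof (rule lemma_on_the_logarithmic_derivative[OF A B True[unfolded W_def] growth])
      fix B1 assume "\<And>r. 1 \<le> r \<Longrightarrow> circ_mean r (\<lambda>z. max 0 (lnorm (\<lambda>z. A z * deriv B z - deriv A z * B z) z - lnorm A z - lnorm B z)) \<le> B1 * (1 + ln r)"
      then show thesis by (intro that[of B1]) (simp add: W_def)
    qed
    obtain B2 where B2: "\<And>r. r \<ge> 1 \<Longrightarrow> circ_mean r (\<lambda>z. max 0 (lnorm W z - lnorm A z - lnorm P z)) \<le> B2 * (1 + ln r)"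
    proof (rule lemma_on_the_logarithmic_derivative[OF A P])
      show "entire_nz (\<lambda>z. A z * deriv P z - deriv A z * P z)" unfolding WAP by (rule True)
      show "circ_mean r (\<lambda>z. max (lnorm A z) (lnorm P z)) \<le> (C + ln 2) * r ^ K" if "r \<ge> 1" for r
        using growthP[OF that] by simp
      fix B2 assume "\<And>r. 1 \<le> r \<Longrightarrow> circ_mean r (\<lambda>z. max 0 (lnorm (\<lambda>z. A z * deriv P z - deriv A z * P z) z - lnorm A z - lnorm P z)) \<le> B2 * (1 + ln r)"
      then have "\<And>r. r \<ge> 1 \<Longrightarrow> circ_mean r (\<lambda>z. max 0 (lnorm W z - lnorm A z - lnorm P z)) \<le> B2 * (1 + ln r)"
        unfolding fun_cong[OF WAP] .
      then show thesis by (rule that)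
    qed
    obtain B3 where B3: "\<And>r. r \<ge> 1 \<Longrightarrow> circ_mean r (\<lambda>z. max 0 (lnorm W z - lnorm B z - lnorm P z)) \<le> B3 * (1 + ln r)"
    proof (rule lemma_on_the_logarithmic_derivative[OF B P])
      show "entire_nz (\<lambda>z. B z * deriv P z - deriv B z * P z)" unfolding WBP by (rule nW)
      show "circ_mean r (\<lambda>z. max (lnorm B z) (lnorm P z)) \<le> (C + ln 2) * r ^ K" if "r \<ge> 1" for r
        using growthP[OF that] by simp
      fix B3 assume "\<And>r. 1 \<le> r \<Longrightarrow> circ_mean r (\<lambda>z. max 0 (lnorm (\<lambda>z. B z * deriv P z - deriv B z * P z) z - lnorm B z - lnorm P z)) \<le> B3 * (1 + ln r)"
      then have "\<And>r. r \<ge> 1 \<Longrightarrow> circ_mean r (\<lambda>z. max 0 (lnorm W z - lnorm B z - lnorm P z)) \<le> B3 * (1 + ln r)"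
        unfolding fun_cong[OF WBP] norm_minus_cancel .
      then show thesis by (rule that)
    qed
    \<comment> \<open>If \<open>\<mu>\<close> bounds the order of \<open>A\<close>, then the orders
      of \<open>B\<close> and \<open>P\<close> together exceed that of \<open>W\<close> by at most
      1, which \<open>\<nu>\<close> pays; otherwise \<open>A\<close> and \<open>B\<close> exchange
      roles.\<close>
    have ord: "zord A a + zord B a + zord P a \<le> zord W a + (\<mu> a + \<nu> a)" for a
    proof (cases "A a = 0 \<or> B a = 0 \<or> P a = 0")
      case False
      then show ?thesis by simp
    next
      case True
      then have \<nu>1: "1 \<le> \<nu> a" using trunc[of a] P by (simp add: P_def)
      have 1: "zord A a + zord P a \<le> Suc (zord W a)"
        using zord_wronskian_ge[OF A P, of a] \<open>entire_nz W\<close> unfolding WAP by simp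
      have 2: "zord B a + zord P a \<le> Suc (zord W a)"
        using zord_wronskian_ge[OF B P, of a] nW zord_minus[of W a] unfolding WBP by simp
      show ?thesis using common[of a] 1 2 \<nu>1 by linarith
    qed
    define C' where "C' = \<bar>CA\<bar> + \<bar>CB\<bar> + \<bar>CP\<bar> + \<bar>CW\<bar> + (B1 + B2 + B3)"
    have "circ_mean r (\<lambda>z. max (lnorm A z) (lnorm B z)) \<le> Ncount \<mu> r + Ncount \<nu> r + C' * (1 + ln r)"
      if r: "r \<ge> 1" for r
    proof -
      have r0: "r > 0" using r by simp
      define L where "L = (\<lambda>F G z. max 0 (lnorm W z - lnorm F z - lnorm G z))"
      have iL: "circ_int r (L A B)" "circ_int r (L A P)" "circ_int r (L B P)"
        unfolding L_def by (intro circ_int_max circ_int_diff circ_int_const iA iB iP iW r0)+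
      \<comment> \<open>With x = log|A| and y = log|B|, max(x, y) = x + y - min(x, y). Here -min(x,
        y) is at most log|P| - log|W| plus the term \<open>L\<close> of \<open>P\<close> paired with
        the function that has the smaller value.\<close>
      have "circ_mean r (\<lambda>z. max (lnorm A z) (lnorm B z)) \<le>
         circ_mean r (\<lambda>z. ((lnorm A z + lnorm B z) + lnorm P z - lnorm W z) + (L A B z + L A P z + L B P z))"
      proof (rule circ_mean_mono[OF r0 _ _ finite.emptyI])
        show "circ_int r (\<lambda>z. max (lnorm A z) (lnorm B z))" by (intro circ_int_max iA iB r0)
        show "circ_int r (\<lambda>z. ((lnorm A z + lnorm B z) + lnorm P z - lnorm W z) + (L A B z + L A P z + L B P z))"
          by (intro circ_int_add circ_int_diff iA iB iP iW r0 iL)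
        fix z
        have "L A B z \<ge> 0" "L A P z \<ge> 0" "L B P z \<ge> 0" "L A P z \<ge> lnorm W z - lnorm A z - lnorm P z"
          "L B P z \<ge> lnorm W z - lnorm B z - lnorm P z" by (simp_all add: L_def)
        then show "max (lnorm A z) (lnorm B z) \<le> ((lnorm A z + lnorm B z) + lnorm P z - lnorm W z) + (L A B z + L A P z + L B P z)"
          by linarith
      qed
      also have "\<dots> = (Ncount (zord A) r + CA + (Ncount (zord B) r + CB) + (Ncount (zord P) r + CP) - (Ncount (zord W) r + CW))
          + (circ_mean r (L A B) + circ_mean r (L A P) + circ_mean r (L B P))"
        using iA[OF r0] iB[OF r0] iP[OF r0] iW[OF r0] iL CA[OF r0] CB[OF r0] CP[OF r0] CW[OF r0]
        by (simp add: circ_mean_add circ_mean_diff circ_int_add circ_int_diff)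
      finally have 1: "circ_mean r (\<lambda>z. max (lnorm A z) (lnorm B z)) \<le> \<dots>" .
      have lW: "locfin (zord W)" by (rule locfin_zord[OF True])
      have "Ncount (\<lambda>a. zord A a + zord B a + zord P a) r \<le> Ncount (\<lambda>a. zord W a + (\<mu> a + \<nu> a)) r"
        by (rule Ncount_mono[OF locfin_add[OF lW locfin_add[OF \<mu> \<nu>]] ord r])
      then have 2: "Ncount (zord A) r + Ncount (zord B) r + Ncount (zord P) r \<le> Ncount (zord W) r + (Ncount \<mu> r + Ncount \<nu> r)"
        by (simp add: Ncount_add locfin_add locfin_zord A B P lW \<mu> \<nu>)
      have 3: "circ_mean r (L A B) + circ_mean r (L A P) + circ_mean r (L B P) \<le> (B1 + B2 + B3) * (1 + ln r)"
        using B1[OF r] B2[OF r] B3[OF r] unfolding L_def by (simp add: algebra_simps)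
      have "(\<bar>CA\<bar> + \<bar>CB\<bar> + \<bar>CP\<bar> + \<bar>CW\<bar>) * 1 \<le> (\<bar>CA\<bar> + \<bar>CB\<bar> + \<bar>CP\<bar> + \<bar>CW\<bar>) * (1 + ln r)"
        using r by (intro mult_left_mono) auto
      then have 4: "\<bar>CA\<bar> + \<bar>CB\<bar> + \<bar>CP\<bar> + \<bar>CW\<bar> + (B1 + B2 + B3) * (1 + ln r) \<le> C' * (1 + ln r)"
        by (simp add: C'_def algebra_simps)
      have "CA \<le> \<bar>CA\<bar>" "CB \<le> \<bar>CB\<bar>" "CP \<le> \<bar>CP\<bar>" "- CW \<le> \<bar>CW\<bar>" by auto
      then show ?thesis using 1 2 3 4 by linarith
    qed
    then show thesis by (rule that)
  qed
qed

text \<open>\<open>X\<close> and \<open>Y\<close> need not be coprime. Since \<open>g\<close> or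
  \<open>h\<close> is nonzero at each point, the order of \<open>A\<close> or of \<open>B\<close>
  there is at most that of q1 q2 X^n Y^n, whose divisor is taken as \<open>\<mu>\<close>.\<close>

lemma power_sum_equation_inequality:
  fixes C :: real and K m n :: nat and \<nu> :: "complex \<Rightarrow> nat"
  assumes "coprime_entire g h" "coprime_entire q1 q2" and X: "entire_nz X" and Y: "entire_nz Y"
    and growth: "\<And>r. r \<ge> 1 \<Longrightarrow> circ_mean r (log_max g h) \<le> C * r ^ K"
      "\<And>r. r \<ge> 1 \<Longrightarrow> circ_mean r (log_max q1 q2) \<le> C * r ^ K"
      "\<And>r. r \<ge> 1 \<Longrightarrow> circ_mean r (\<lambda>z. max (lnorm X z) (lnorm Y z)) \<le> C * r ^ K"
    and \<nu>: "locfin \<nu>"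
    and trunc: "\<And>a. entire_nz (\<lambda>z. g z ^ m * q2 z * Y z ^ n + h z ^ m * q1 z * X z ^ n) \<Longrightarrow>
      g a ^ m * q2 a * Y a ^ n = 0 \<or> h a ^ m * q1 a * X a ^ n = 0 \<or>
      g a ^ m * q2 a * Y a ^ n + h a ^ m * q1 a * X a ^ n = 0 \<Longrightarrow> 1 \<le> \<nu> a"
  obtains C' where "\<And>r. r \<ge> 1 \<Longrightarrow> real m * circ_mean r (log_max g h) \<le>
      Ncount \<nu> r + circ_mean r (log_max q1 q2) + real n * circ_mean r (\<lambda>z. max (lnorm X z) (lnorm Y z)) + C' * (1 + ln r)"
proof -
  interpret f: coprime_entire g h by fact
  interpret q: coprime_entire q1 q2 by fact
  note nz = f.g f.h q.g q.h
  define A where "A = (\<lambda>z. g z ^ m * q2 z * Y z ^ n)"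
  define B where "B = (\<lambda>z. h z ^ m * q1 z * X z ^ n)"
  have A: "entire_nz A" and B: "entire_nz B"
    unfolding A_def B_def by (intro entire_nz_mult entire_nz_power nz X Y)+
  have zA: "zord A a = m * zord g a + zord q2 a + n * zord Y a"
    and zB: "zord B a = m * zord h a + zord q1 a + n * zord X a" for a
    unfolding A_def B_def by (simp_all add: zord_mult zord_power entire_nz_mult entire_nz_power nz X Y)
  define \<mu> where "\<mu> = (\<lambda>a. (zord q1 a + zord q2 a) + (n * zord X a + n * zord Y a))"
  have \<mu>: "locfin \<mu>" unfolding \<mu>_def
    by (intro locfin_add locfin_cmult locfin_zord nz X Y)
  have common: "zord A a \<le> \<mu> a \<or> zord B a \<le> \<mu> a" for a
    using f.coprime[of a] by (auto simp: zA zB \<mu>_def)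
  have lnA: "lnorm A z = real m * lnorm g z + lnorm q2 z + real n * lnorm Y z"
    if "g z \<noteq> 0" "q2 z \<noteq> 0" "Y z \<noteq> 0" for z
    using that by (simp add: A_def norm_mult norm_power ln_mult ln_realpow)
  have lnB: "lnorm B z = real m * lnorm h z + lnorm q1 z + real n * lnorm X z"
    if "h z \<noteq> 0" "q1 z \<noteq> 0" "X z \<noteq> 0" for z
    using that by (simp add: B_def norm_mult norm_power ln_mult ln_realpow)
  define M where "M = (\<lambda>r. circ_mean r (\<lambda>z. max (lnorm A z) (lnorm B z)))"
  define MXY where "MXY = (\<lambda>r. circ_mean r (\<lambda>z. max (lnorm X z) (lnorm Y z)))"
  have int: "circ_int r (lnorm F)" if "r > 0" "F \<in> {g, h, q1, q2, X, Y, A, B}" for r F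
    using that circ_int_lnorm nz X Y A B by auto
  have iM: "circ_int r (\<lambda>z. max (lnorm A z) (lnorm B z))" "circ_int r (\<lambda>z. max (lnorm X z) (lnorm Y z))" if "r > 0" for r
    using that by (intro circ_int_max int; simp)+
  define S where "S = (\<lambda>r::real. \<Union>F\<in>{g, h, q1, q2, X, Y}. {z. F z = 0 \<and> norm z \<le> r})"
  have S: "finite (S r)" for r unfolding S_def using entire_nz_finite_zeros nz X Y by auto
  have Snz: "g z \<noteq> 0" "h z \<noteq> 0" "q1 z \<noteq> 0" "q2 z \<noteq> 0" "X z \<noteq> 0" "Y z \<noteq> 0" if "norm z = r" "z \<notin> S r" for z r
    using that by (auto simp: S_def)
  have rhs: "circ_int r (\<lambda>z. real m * f.u z + q.u z + real n * max (lnorm X z) (lnorm Y z))"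
     "circ_mean r (\<lambda>z. real m * f.u z + q.u z + real n * max (lnorm X z) (lnorm Y z)) = real m * f.D r + q.D r + real n * MXY r"
     if "r > 0" for r
    using iM(2)[OF that] unfolding MXY_def
    by (simp_all add: circ_mean_add circ_int_add circ_int_cmult circ_mean_cmult f.circ_int_u q.circ_int_u)
  have upper: "M r \<le> real m * f.D r + q.D r + real n * MXY r" if r: "r > 0" for r
    unfolding M_def rhs(2)[OF r, symmetric]
  proof (rule circ_mean_mono[OF r iM(1)[OF r] rhs(1)[OF r] S])
    fix z assume z: "norm z = r" "z \<notin> S r"
    note nzz = Snz[OF z]
    have "real m * lnorm g z \<le> real m * f.u z" "real m * lnorm h z \<le> real m * f.u z"
      using f.lnorm_le_u nzz by (auto intro!: mult_left_mono)
    moreover have "lnorm q1 z \<le> q.u z" "lnorm q2 z \<le> q.u z" using q.lnorm_le_u nzz by auto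
    moreover have "real n * lnorm X z \<le> real n * max (lnorm X z) (lnorm Y z)"
      "real n * lnorm Y z \<le> real n * max (lnorm X z) (lnorm Y z)" by (auto intro!: mult_left_mono)
    ultimately show "max (lnorm A z) (lnorm B z) \<le> real m * f.u z + q.u z + real n * max (lnorm X z) (lnorm Y z)"
      using lnA[of z] lnB[of z] nzz by auto
  qed
  have growthM: "circ_mean r (\<lambda>z. max (lnorm A z) (lnorm B z)) \<le> (real m + 1 + real n) * C * r ^ K" if r: "r \<ge> 1" for r
  proof -
    have "real m * f.D r + q.D r + real n * MXY r \<le> real m * (C * r ^ K) + C * r ^ K + real n * (C * r ^ K)"
      using growth[OF r] unfolding MXY_def by (intro add_mono mult_left_mono) auto
    also have "\<dots> = (real m + 1 + real n) * C * r ^ K" by (simp add: algebra_simps)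
    finally show ?thesis using upper[of r] r by (simp add: M_def)
  qed
  obtain C1 where C1: "\<And>r. r \<ge> 1 \<Longrightarrow> M r \<le> Ncount \<mu> r + Ncount \<nu> r + C1 * (1 + ln r)"
  proof (rule truncated_second_main_theorem[OF A B growthM \<mu> \<nu> common])
    show "1 \<le> \<nu> a" if "entire_nz (\<lambda>z. A z + B z)" "A a = 0 \<or> B a = 0 \<or> A a + B a = 0" for a
      using that unfolding A_def B_def by (rule trunc)
    fix C1 assume "\<And>r. 1 \<le> r \<Longrightarrow> circ_mean r (\<lambda>z. max (lnorm A z) (lnorm B z)) \<le> Ncount \<mu> r + Ncount \<nu> r + C1 * (1 + ln r)"
    then show thesis by (intro that) (simp add: M_def)
  qed
  have "\<exists>C. \<forall>r>0. circ_mean r (lnorm F) = Ncount (zord F) r + C" if "entire_nz F" for F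
    using jensen[OF that] by metis
  then obtain CJ where CJ: "\<And>F r. entire_nz F \<Longrightarrow> r > 0 \<Longrightarrow> circ_mean r (lnorm F) = Ncount (zord F) r + CJ F"
    by metis
  define c where "c = \<bar>CJ q1\<bar> + \<bar>CJ q2\<bar> + real n * \<bar>CJ X\<bar> + real n * \<bar>CJ Y\<bar>"
  have "real m * f.D r \<le> Ncount \<nu> r + q.D r + real n * MXY r + (C1 + c) * (1 + ln r)" if r: "r \<ge> 1" for r
  proof -
    have r0: "r > 0" using r by simp
    have i: "circ_int r (lnorm q1)" "circ_int r (lnorm q2)" "circ_int r (lnorm X)" "circ_int r (lnorm Y)"
      by (intro int r0; simp)+
    \<comment> \<open>If u = log|g|, then m u + log|q2| + n log|Y| = log|A|, and log|q1| + n log|X|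
      is bounded by the two maxima; the case u = log|h| is symmetric. By Jensen's formula the terms
      added on the left are \<open>Ncount \<mu> r\<close> up to a constant, and this cancels the
      loss in the second main theorem.\<close>
    have "real m * f.D r + (circ_mean r (lnorm q1) + circ_mean r (lnorm q2) + (real n * circ_mean r (lnorm X) + real n * circ_mean r (lnorm Y)))
        = circ_mean r (\<lambda>z. real m * f.u z + (lnorm q1 z + lnorm q2 z + (real n * lnorm X z + real n * lnorm Y z)))"
      using i by (simp add: circ_mean_add circ_int_add circ_int_cmult circ_mean_cmult f.circ_int_u)
    also have "\<dots> \<le> circ_mean r (\<lambda>z. max (lnorm A z) (lnorm B z) + (q.u z + real n * max (lnorm X z) (lnorm Y z)))"
    proof (rule circ_mean_mono[OF r0 _ _ S])
      show "circ_int r (\<lambda>z. real m * f.u z + (lnorm q1 z + lnorm q2 z + (real n * lnorm X z + real n * lnorm Y z)))"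
        by (intro circ_int_add circ_int_cmult f.circ_int_u i)
      show "circ_int r (\<lambda>z. max (lnorm A z) (lnorm B z) + (q.u z + real n * max (lnorm X z) (lnorm Y z)))"
        by (intro circ_int_add circ_int_cmult q.circ_int_u iM r0)
      fix z assume z: "norm z = r" "z \<notin> S r"
      note nzz = Snz[OF z]
      have q: "lnorm q1 z \<le> q.u z" "lnorm q2 z \<le> q.u z" using q.lnorm_le_u nzz by auto
      have xy: "real n * lnorm X z \<le> real n * max (lnorm X z) (lnorm Y z)"
        "real n * lnorm Y z \<le> real n * max (lnorm X z) (lnorm Y z)" by (auto intro!: mult_left_mono)
      consider "f.u z = lnorm g z" | "f.u z = lnorm h z" using f.u_cases[of z] by metis
      then show "real m * f.u z + (lnorm q1 z + lnorm q2 z + (real n * lnorm X z + real n * lnorm Y z))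
          \<le> max (lnorm A z) (lnorm B z) + (q.u z + real n * max (lnorm X z) (lnorm Y z))"
      proof cases
        case 1
        then show ?thesis using q xy lnA[of z] nzz by auto
      next
        case 2
        then show ?thesis using q xy lnB[of z] nzz by auto
      qed
    qed
    also have "\<dots> = M r + (q.D r + real n * MXY r)"
      using iM[OF r0] unfolding M_def MXY_def
      by (simp add: circ_mean_add circ_int_add circ_int_cmult circ_mean_cmult q.circ_int_u)
    finally have 1: "real m * f.D r + (circ_mean r (lnorm q1) + circ_mean r (lnorm q2) + (real n * circ_mean r (lnorm X) + real n * circ_mean r (lnorm Y)))
      \<le> M r + (q.D r + real n * MXY r)" .
    have "Ncount \<mu> r = Ncount (zord q1) r + Ncount (zord q2) r + (real n * Ncount (zord X) r + real n * Ncount (zord Y) r)"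
      unfolding \<mu>_def by (simp add: Ncount_add Ncount_cmult locfin_add locfin_cmult locfin_zord nz X Y)
    moreover have "circ_mean r (lnorm q1) + circ_mean r (lnorm q2) + (real n * circ_mean r (lnorm X) + real n * circ_mean r (lnorm Y))
      = Ncount (zord q1) r + Ncount (zord q2) r + (real n * Ncount (zord X) r + real n * Ncount (zord Y) r)
        + (CJ q1 + CJ q2 + (real n * CJ X + real n * CJ Y))"
      using CJ[OF _ r0] nz X Y by (simp add: algebra_simps)
    moreover have "- c \<le> CJ q1 + CJ q2 + (real n * CJ X + real n * CJ Y)"
    proof -
      have "- (real n * \<bar>CJ X\<bar>) \<le> real n * CJ X" "- (real n * \<bar>CJ Y\<bar>) \<le> real n * CJ Y"
        unfolding mult_minus_right[symmetric] by (intro mult_left_mono; simp)+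
      then show ?thesis unfolding c_def by linarith
    qed
    moreover have "c * 1 \<le> c * (1 + ln r)" using r by (intro mult_left_mono) (auto simp: c_def)
    ultimately have "real m * f.D r \<le> Ncount \<nu> r + C1 * (1 + ln r) + c * (1 + ln r) + (q.D r + real n * MXY r)"
      using 1 C1[OF r] by linarith
    then show ?thesis by (simp add: algebra_simps)
  qed
  then show thesis using that unfolding MXY_def by blast
qed

section \<open>The difference equation\<close>

lemma small_wrtD:
  assumes "small_wrt G f"
  obtains E where "finite_log_measure E"
    "\<And>\<epsilon>. \<epsilon> > 0 \<Longrightarrow> eventually (\<lambda>r. r \<notin> E \<longrightarrow> \<bar>G r\<bar> \<le> \<epsilon> * \<bar>nevanlinna_T r f\<bar>) at_top"
proof -
  obtain E where E: "finite_log_measure E" "G \<in> o[inf at_top (principal (- E))](\<lambda>r. nevanlinna_T r f)"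
    using assms by (auto simp: small_wrt_def)
  have "eventually (\<lambda>r. r \<notin> E \<longrightarrow> \<bar>G r\<bar> \<le> \<epsilon> * \<bar>nevanlinna_T r f\<bar>) at_top" if "\<epsilon> > 0" for \<epsilon>
    using landau_o.smallD[OF E(2) that] by (simp add: eventually_inf_principal)
  with E(1) show thesis by (rule that)
qed

lemma eventually_at_shift:
  fixes P :: "complex \<Rightarrow> bool"
  assumes "eventually P (at (z + d))" shows "eventually (\<lambda>w. P (w + d)) (at z)"
proof -
  have "at (z + d) = filtermap (\<lambda>w. w + d) (at z)"
    using filtermap_at_shift[of "- d" z] by simp
  with assms show ?thesis by (simp add: eventually_filtermap)
qed

section \<open>Polynomial growth of circle means\<close>

definition poly_growth :: "nat \<Rightarrow> (real \<Rightarrow> real) \<Rightarrow> bool" where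
  "poly_growth K F \<longleftrightarrow> (\<exists>C\<ge>0. \<forall>r\<ge>1. F r \<le> C * r ^ K)"

text \<open>Monotonicity covers the bounded range before the eventual estimate sets in, because
  \<open>r ^ K\<close> is at least 1 there.\<close>

lemma poly_growthI:
  assumes mono: "\<And>r s. 0 < r \<Longrightarrow> r \<le> s \<Longrightarrow> F r \<le> F s"
    and ev: "eventually (\<lambda>r. F r \<le> C * r ^ K) at_top"
  shows "poly_growth K F"
proof -
  obtain x0 where x0: "\<And>r. r \<ge> x0 \<Longrightarrow> F r \<le> C * r ^ K" using ev by (auto simp: eventually_at_top_linorder)
  define x1 where "x1 = max 1 x0"
  have "F r \<le> (\<bar>C\<bar> + \<bar>F x1\<bar>) * r ^ K" if r: "r \<ge> 1" for r
  proof -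
    have rK: "1 \<le> r ^ K" using r by (rule one_le_power)
    have 1: "C * r ^ K \<le> \<bar>C\<bar> * r ^ K" using rK by (intro mult_right_mono) auto
    have 2: "\<bar>F x1\<bar> * 1 \<le> \<bar>F x1\<bar> * r ^ K" using rK by (intro mult_left_mono) auto
    have 3: "0 \<le> \<bar>C\<bar> * r ^ K" using rK by simp
    show ?thesis
    proof (cases "r \<ge> x1")
      case True
      then have "F r \<le> C * r ^ K" by (intro x0) (simp add: x1_def)
      then show ?thesis using 1 2 by (simp add: distrib_right)
    next
      case False
      then have "F r \<le> F x1" using r by (intro mono) auto
      then show ?thesis using 2 3 by (simp add: distrib_right)
    qed
  qed
  then show ?thesis unfolding poly_growth_def by (intro exI[of _ "\<bar>C\<bar> + \<bar>F x1\<bar>"]) auto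
qed

lemma poly_growth_add:
  assumes "poly_growth K F" "poly_growth K G" shows "poly_growth K (\<lambda>r. F r + G r)"
proof -
  obtain C C' where "C \<ge> 0" "C' \<ge> 0" "\<forall>r\<ge>1. F r \<le> C * r ^ K" "\<forall>r\<ge>1. G r \<le> C' * r ^ K"
    using assms by (auto simp: poly_growth_def)
  then show ?thesis unfolding poly_growth_def
    by (intro exI[of _ "C + C'"]) (auto simp: distrib_right intro: add_mono)
qed

lemma poly_growth_const: "poly_growth K (\<lambda>_. c)"
  unfolding poly_growth_def
proof (intro exI[of _ "\<bar>c\<bar>"] conjI allI impI)
  fix r :: real assume "r \<ge> 1"
  then have "\<bar>c\<bar> * 1 \<le> \<bar>c\<bar> * r ^ K" by (intro mult_left_mono one_le_power) auto
  then show "c \<le> \<bar>c\<bar> * r ^ K" by simp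
qed simp

lemma poly_growth_sum:
  assumes "\<And>i. i \<in> I \<Longrightarrow> poly_growth K (F i)" shows "poly_growth K (\<lambda>r. \<Sum>i\<in>I. F i r)"
  using assms
  by (induction I rule: infinite_finite_induct) (auto intro: poly_growth_add poly_growth_const)

lemma poly_growth_mono:
  assumes "poly_growth K G" "\<And>r. r \<ge> 1 \<Longrightarrow> F r \<le> G r" shows "poly_growth K F"
  using assms unfolding poly_growth_def by (meson order_trans)

lemma poly_growth_common_constant:
  assumes "poly_growth K F" "poly_growth K G" "poly_growth K H"
  obtains C where "\<And>r. r \<ge> 1 \<Longrightarrow> F r \<le> C * r ^ K" "\<And>r. r \<ge> 1 \<Longrightarrow> G r \<le> C * r ^ K"
    "\<And>r. r \<ge> 1 \<Longrightarrow> H r \<le> C * r ^ K"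
proof -
  obtain C1 C2 C3 where C: "C1 \<ge> 0" "C2 \<ge> 0" "C3 \<ge> 0" "\<forall>r\<ge>1. F r \<le> C1 * r ^ K" "\<forall>r\<ge>1. G r \<le> C2 * r ^ K" "\<forall>r\<ge>1. H r \<le> C3 * r ^ K"
    using assms by (auto simp: poly_growth_def)
  have le: "Ci * r ^ K \<le> (C1 + C2 + C3) * r ^ K" if "r \<ge> 1" "Ci \<in> {C1, C2, C3}" for r Ci :: real
    using that C(1-3) by (intro mult_right_mono) auto
  show thesis
    by (rule that[of "C1 + C2 + C3"]) (use C(4-6) le in \<open>blast intro: order_trans\<close>)+
qed

context coprime_entire
begin

lemma coprime_entire_shift: "coprime_entire (\<lambda>z. g (z + d)) (\<lambda>z. h (z + d))"
  by standard (use g h coprime in \<open>auto intro: entire_nz_shift\<close>)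

lemma shift_mean_mono:
  assumes "0 < r" "r \<le> s" shows "circ_mean r (\<lambda>z. u (z + d)) \<le> circ_mean s (\<lambda>z. u (z + d))"
proof -
  interpret s: coprime_entire "\<lambda>z. g (z + d)" "\<lambda>z. h (z + d)" by (rule coprime_entire_shift)
  have "s.u = (\<lambda>z. u (z + d))" by (simp add: log_max_def fun_eq_iff)
  then show ?thesis using s.D_mono[OF assms] by simp
qed

text \<open>The translation estimate with \<open>\<epsilon> = 1\<close> suffices: r + |d| + 1 is
  eventually at most 2r, so the exponent \<open>K\<close> is kept and only the constant
  grows.\<close>

lemma poly_growth_shift_mean:
  assumes "poly_growth K D" shows "poly_growth K (\<lambda>r. circ_mean r (\<lambda>z. u (z + d)))"
proof -
  obtain C where C: "C \<ge> 0" "\<And>r. r \<ge> 1 \<Longrightarrow> D r \<le> C * r ^ K"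
    using assms by (auto simp: poly_growth_def)
  obtain K' r0 where K': "\<And>r. r \<ge> r0 \<Longrightarrow> circ_mean r (\<lambda>z. u (z + d)) \<le> (1 + 1) * D (r + norm d + 1) + K'"
    using shift_mean_le[OF zero_less_one, of d] by metis
  show ?thesis
  proof (rule poly_growthI)
    show "eventually (\<lambda>r. circ_mean r (\<lambda>z. u (z + d)) \<le> (2 * C * 2 ^ K + \<bar>K'\<bar>) * r ^ K) at_top"
      using eventually_ge_at_top[of "max r0 (norm d + 1)"]
    proof eventually_elim
      case (elim r)
      have r1: "r \<ge> 1" using elim norm_ge_zero[of d] by linarith
      have "D (r + norm d + 1) \<le> C * (r + norm d + 1) ^ K" using r1 by (intro C) auto
      also have "\<dots> \<le> C * (2 * r) ^ K" using elim r1 C(1) by (intro mult_left_mono power_mono) auto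
      finally have "2 * D (r + norm d + 1) \<le> 2 * C * 2 ^ K * r ^ K" by (simp add: power_mult_distrib)
      moreover have "K' \<le> \<bar>K'\<bar> * r ^ K"
      proof -
        have "\<bar>K'\<bar> * 1 \<le> \<bar>K'\<bar> * r ^ K" using r1 by (intro mult_left_mono one_le_power) auto
        then show ?thesis by simp
      qed
      ultimately show ?case using K'[of r] elim by (simp add: distrib_right)
    qed
  qed (rule shift_mean_mono)
qed

section \<open>Numerator and denominator of L_c(z,f)\<close>

definition shift_den :: "nat \<Rightarrow> complex \<Rightarrow> complex \<Rightarrow> complex" where
  "shift_den \<tau> c z = (\<Prod>j\<le>\<tau>. h (z + of_nat j * c))"

text \<open>The sum over a common denominator, without reduction to lowest terms. The full product
  is kept below so that its factor for j = 0 makes it vanish wherever \<open>h\<close> does.\<close>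

definition shift_num :: "nat \<Rightarrow> (nat \<Rightarrow> complex) \<Rightarrow> complex \<Rightarrow> complex \<Rightarrow> complex" where
  "shift_num \<tau> a c z = (\<Sum>j\<le>\<tau>. a j * (g (z + of_nat j * c) * (\<Prod>i\<in>{..\<tau>} - {j}. h (z + of_nat i * c))))"

lemma entire_nz_shift_den: "entire_nz (shift_den \<tau> c)"
  unfolding shift_den_def[abs_def] by (intro entire_nz_prod entire_nz_shift h)

lemma shift_num_holomorphic: "shift_num \<tau> a c holomorphic_on UNIV"
  unfolding shift_num_def[abs_def]
  by (intro holomorphic_intros entire_nz_holomorphic entire_nz_shift entire_nz_prod g h)

lemma shift_den_zero: "h z = 0 \<Longrightarrow> shift_den \<tau> c z = 0"
  unfolding shift_den_def by (rule prod_zero[OF _ bexI[of _ 0]]) auto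

lemma shift_num_div_den:
  assumes "shift_den \<tau> c z \<noteq> 0"
  shows "shift_num \<tau> a c z / shift_den \<tau> c z = shift_op \<tau> a c (\<lambda>z. g z / h z) z"
proof -
  have nz: "h (z + of_nat j * c) \<noteq> 0" if "j \<le> \<tau>" for j
    using assms that by (auto simp: shift_den_def)
  have "a j * (g (z + of_nat j * c) * (\<Prod>i\<in>{..\<tau>} - {j}. h (z + of_nat i * c))) / shift_den \<tau> c z
      = a j * (g (z + of_nat j * c) / h (z + of_nat j * c))" if j: "j \<in> {..\<tau>}" for j
  proof -
    have d: "shift_den \<tau> c z = h (z + of_nat j * c) * (\<Prod>i\<in>{..\<tau>} - {j}. h (z + of_nat i * c))"
      unfolding shift_den_def by (rule prod.remove) (use j in auto)
    then have "(\<Prod>i\<in>{..\<tau>} - {j}. h (z + of_nat i * c)) \<noteq> 0" using assms by auto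
    then show ?thesis unfolding d using nz[of j] j by simp
  qed
  then show ?thesis
    unfolding shift_num_def shift_op_def sum_divide_distrib by (intro sum.cong) auto
qed

lemma eventually_shift_op_eq:
  assumes f: "\<forall>\<^sub>\<approx>z\<in>UNIV. f z = g z / h z"
  shows "eventually (\<lambda>z. shift_op \<tau> a c f z = shift_num \<tau> a c z / shift_den \<tau> c z) (at z0)"
proof -
  have "eventually (\<lambda>z. f (z + of_nat j * c) = g (z + of_nat j * c) / h (z + of_nat j * c)) (at z0)" for j
    using f unfolding eventually_cosparse_UNIV by (intro eventually_at_shift) blast
  then have "eventually (\<lambda>z. \<forall>j\<in>{..\<tau>}. f (z + of_nat j * c) = g (z + of_nat j * c) / h (z + of_nat j * c)) (at z0)"
    by (intro eventually_ball_finite) auto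
  with entire_nz_eventually[OF entire_nz_shift_den[of \<tau> c], of z0]
  show ?thesis
  proof eventually_elim
    case (elim z)
    then have "shift_op \<tau> a c f z = shift_op \<tau> a c (\<lambda>z. g z / h z) z"
      unfolding shift_op_def by (intro sum.cong) auto
    then show ?case using shift_num_div_den[OF elim(1)] by simp
  qed
qed

lemma exp_u: "exp (u z) = max (norm (g z)) (norm (h z))"
  unfolding log_max_def by (rule exp_ln[OF max_pos])

text \<open>Each product in the numerator and in the denominator has exactly one factor per shift,
  of modulus at most exp(u) at the shifted point. So both together cost one log max per shift rather
  than separate terms for \<open>g\<close> and \<open>h\<close>. The 1 inside the logarithm covers
  the denominator.\<close>

lemma circ_mean_shift_num_den_le:
  assumes X: "entire_nz (shift_num \<tau> a c)" and r: "r > 0"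
  shows "circ_mean r (\<lambda>z. max (lnorm (shift_num \<tau> a c) z) (lnorm (shift_den \<tau> c) z)) \<le>
     ln (1 + (\<Sum>j\<le>\<tau>. norm (a j))) + (\<Sum>j\<le>\<tau>. circ_mean r (\<lambda>z. u (z + of_nat j * c)))"
proof -
  define S where "S = 1 + (\<Sum>j\<le>\<tau>. norm (a j))"
  have S: "S \<ge> 1" unfolding S_def by (simp add: sum_nonneg)
  note Y = entire_nz_shift_den[of \<tau> c]
  let ?U = "\<lambda>z. \<Sum>j\<le>\<tau>. u (z + of_nat j * c)"
  have "circ_mean r (\<lambda>z. max (lnorm (shift_num \<tau> a c) z) (lnorm (shift_den \<tau> c) z)) \<le> circ_mean r (\<lambda>z. ln S + ?U z)"
  proof (rule circ_mean_mono[OF r])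
    show "circ_int r (\<lambda>z. max (lnorm (shift_num \<tau> a c) z) (lnorm (shift_den \<tau> c) z))"
      by (intro circ_int_max circ_int_lnorm X Y r)
    show "circ_int r (\<lambda>z. ln S + ?U z)" by (intro circ_int_add circ_int_const circ_int_sum circ_int_u_shift)
    show "finite ({z. shift_num \<tau> a c z = 0 \<and> norm z \<le> r} \<union> {z. shift_den \<tau> c z = 0 \<and> norm z \<le> r})"
      using entire_nz_finite_zeros[OF X] entire_nz_finite_zeros[OF Y] by simp
    fix z assume "norm z = r" "z \<notin> {z. shift_num \<tau> a c z = 0 \<and> norm z \<le> r} \<union> {z. shift_den \<tau> c z = 0 \<and> norm z \<le> r}"
    then have nz: "shift_num \<tau> a c z \<noteq> 0" "shift_den \<tau> c z \<noteq> 0" by auto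
    define e where "e = (\<lambda>j. exp (u (z + of_nat j * c)))"
    have e: "norm (g (z + of_nat j * c)) \<le> e j" "norm (h (z + of_nat j * c)) \<le> e j" for j
      by (auto simp: e_def exp_u)
    have e0: "e j \<ge> 0" for j by (simp add: e_def)
    have den: "norm (shift_den \<tau> c z) \<le> (\<Prod>j\<le>\<tau>. e j)"
      unfolding shift_den_def prod_norm[symmetric] by (intro prod_mono conjI e) auto
    have "norm (shift_num \<tau> a c z) \<le> (\<Sum>j\<le>\<tau>. norm (a j) * (\<Prod>j\<le>\<tau>. e j))"
      unfolding shift_num_def
    proof (rule sum_norm_le)
      fix j assume j: "j \<in> {..\<tau>}"
      have "norm (\<Prod>i\<in>{..\<tau>} - {j}. h (z + of_nat i * c)) \<le> (\<Prod>i\<in>{..\<tau>} - {j}. e i)"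
        unfolding prod_norm[symmetric] by (intro prod_mono conjI e) auto
      then have "norm (g (z + of_nat j * c)) * norm (\<Prod>i\<in>{..\<tau>} - {j}. h (z + of_nat i * c)) \<le> e j * (\<Prod>i\<in>{..\<tau>} - {j}. e i)"
        using e(1)[of j] e0 by (intro mult_mono) auto
      also have "\<dots> = (\<Prod>j\<le>\<tau>. e j)" by (rule prod.remove[symmetric]) (use j in auto)
      finally show "norm (a j * (g (z + of_nat j * c) * (\<Prod>i\<in>{..\<tau>} - {j}. h (z + of_nat i * c)))) \<le> norm (a j) * (\<Prod>j\<le>\<tau>. e j)"
        unfolding norm_mult by (intro mult_left_mono) auto
    qed
    also have "\<dots> \<le> S * (\<Prod>j\<le>\<tau>. e j)"
      unfolding sum_distrib_right[symmetric] S_def using e0 by (intro mult_right_mono prod_nonneg) auto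
    finally have num: "norm (shift_num \<tau> a c z) \<le> S * (\<Prod>j\<le>\<tau>. e j)" .
    have p: "(\<Prod>j\<le>\<tau>. e j) = exp (?U z)" unfolding e_def by (simp add: exp_sum)
    have "1 * exp (?U z) \<le> S * exp (?U z)" using S by (intro mult_right_mono) auto
    then have den': "norm (shift_den \<tau> c z) \<le> S * exp (?U z)" using den p by linarith
    have lnS: "ln (S * exp (?U z)) = ln S + ?U z" using S by (simp add: ln_mult)
    have "lnorm (shift_num \<tau> a c) z \<le> ln (S * exp (?U z))" using nz num p by (intro ln_mono) auto
    moreover have "lnorm (shift_den \<tau> c) z \<le> ln (S * exp (?U z))" using nz den' by (intro ln_mono) auto
    ultimately show "max (lnorm (shift_num \<tau> a c) z) (lnorm (shift_den \<tau> c) z) \<le> ln S + ?U z"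
      unfolding lnS by simp
  qed
  also have "\<dots> = ln S + (\<Sum>j\<le>\<tau>. circ_mean r (\<lambda>z. u (z + of_nat j * c)))"
    by (simp add: circ_mean_add circ_int_sum circ_int_u_shift circ_mean_sum)
  finally show ?thesis by (simp add: S_def)
qed

text \<open>All shifts are compared at the same radius, so that a single instance of slow growth
  later handles them together.\<close>

lemma shift_means_le:
  assumes "\<epsilon> > 0"
  obtains K where "eventually (\<lambda>r. (\<Sum>j\<le>\<tau>. circ_mean r (\<lambda>z. u (z + of_nat j * c)))
      \<le> real (\<tau> + 1) * ((1 + \<epsilon>) * D (r + (real \<tau> * norm c + 1))) + K) at_top"
proof -
  have "\<exists>K r0. \<forall>r\<ge>r0. circ_mean r (\<lambda>z. u (z + of_nat j * c)) \<le> (1 + \<epsilon>) * D (r + norm (of_nat j * c) + 1) + K" for j :: nat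
    using shift_mean_le[OF assms, of "of_nat j * c"] by metis
  then obtain K r0 where K: "\<And>j r. r \<ge> r0 j \<Longrightarrow> circ_mean r (\<lambda>z. u (z + of_nat j * c)) \<le> (1 + \<epsilon>) * D (r + norm (of_nat j * c) + 1) + K j"
    by metis
  have "eventually (\<lambda>r. (\<Sum>j\<le>\<tau>. circ_mean r (\<lambda>z. u (z + of_nat j * c)))
      \<le> real (\<tau> + 1) * ((1 + \<epsilon>) * D (r + (real \<tau> * norm c + 1))) + (\<Sum>j\<le>\<tau>. K j)) at_top"
    using eventually_ge_at_top[of "max 1 (Max (r0 ` {..\<tau>}))"]
  proof eventually_elim
    case (elim r)
    have "(\<Sum>j\<le>\<tau>. circ_mean r (\<lambda>z. u (z + of_nat j * c))) \<le> (\<Sum>j\<le>\<tau>. (1 + \<epsilon>) * D (r + (real \<tau> * norm c + 1)) + K j)"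
    proof (rule sum_mono)
      fix j assume j: "j \<in> {..\<tau>}"
      have "r0 j \<le> Max (r0 ` {..\<tau>})" using j by (intro Max_ge) auto
      then have 1: "circ_mean r (\<lambda>z. u (z + of_nat j * c)) \<le> (1 + \<epsilon>) * D (r + norm (of_nat j * c) + 1) + K j"
        using elim j by (intro K) auto
      have "norm (of_nat j * c) \<le> real \<tau> * norm c" using j by (auto simp: norm_mult intro!: mult_right_mono)
      then have "D (r + norm (of_nat j * c) + 1) \<le> D (r + (real \<tau> * norm c + 1))"
        using elim norm_ge_zero[of "of_nat j * c"] by (intro D_mono) linarith+
      then have "(1 + \<epsilon>) * D (r + norm (of_nat j * c) + 1) \<le> (1 + \<epsilon>) * D (r + (real \<tau> * norm c + 1))"
        using assms by (intro mult_left_mono) auto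
      then show "circ_mean r (\<lambda>z. u (z + of_nat j * c)) \<le> (1 + \<epsilon>) * D (r + (real \<tau> * norm c + 1)) + K j"
        using 1 by linarith
    qed
    also have "\<dots> = real (\<tau> + 1) * ((1 + \<epsilon>) * D (r + (real \<tau> * norm c + 1))) + (\<Sum>j\<le>\<tau>. K j)"
      by (simp add: sum.distrib)
    finally show ?case .
  qed
  then show thesis by (rule that)
qed

end

section \<open>Finite order and distinct poles\<close>

lemma poly_growth_if_finite_order:
  assumes "meromorphic_order f < \<infinity>"
  obtains K :: nat where "eventually (\<lambda>r. nevanlinna_T r f \<le> r ^ K) at_top"
proof -
  obtain K :: nat where K: "meromorphic_order f < ereal (real K)"
    using assms less_PInf_Ex_of_nat by auto
  have "eventually (\<lambda>r. ereal (ln (nevanlinna_T r f) / ln r) < ereal (real K)) at_top"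
    using Limsup_lessD[OF K[unfolded meromorphic_order_def]] .
  then have "eventually (\<lambda>r. nevanlinna_T r f \<le> r ^ K) at_top"
    using eventually_gt_at_top[of 1]
  proof eventually_elim
    case (elim r)
    show ?case
    proof (cases "nevanlinna_T r f > 0")
      case True
      have "ln r > 0" using elim by simp
      then have "ln (nevanlinna_T r f) < real K * ln r" using elim by (simp add: field_simps)
      also have "\<dots> = ln (r ^ K)" using elim by (simp add: ln_realpow)
      finally show ?thesis using True elim by (subst (asm) ln_less_cancel_iff) auto
    next
      \<comment> \<open>Where the characteristic is not positive its logarithm carries no
        information, but the bound is trivial.\<close>
      case False
      then have "nevanlinna_T r f \<le> 0" by simp
      also have "0 \<le> r ^ K" using elim by simp
      finally show ?thesis .
    qed
  qed
  then show thesis by (rule that)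
qed

lemma locfin_pole_indicator:
  assumes "f meromorphic_on UNIV" shows "locfin (\<lambda>a. if is_pole f a then 1 else 0)"
  unfolding locfin_def
proof
  fix r
  have "{x. \<not> \<not> is_pole f x} sparse_in cball 0 r"
    using meromorphic_on_imp_not_pole_cosparse[OF assms] unfolding eventually_cosparse
    by (rule sparse_in_subset) auto
  then have "finite (cball 0 r \<inter> {x. \<not> \<not> is_pole f x})" by (rule sparse_in_compact_finite) simp
  then show "finite {a. (if is_pole f a then 1 else 0) \<noteq> (0::nat) \<and> norm a \<le> r}"
    by (rule finite_subset[rotated]) auto
qed

lemma nevanlinna_Nbar_eq_Ncount:
  assumes "f meromorphic_on UNIV" "r > 0"
  shows "nevanlinna_Nbar r f = Ncount (\<lambda>a. if is_pole f a then 1 else 0) r"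
  unfolding nevanlinna_Nbar_def
proof (rule integrated_count_eq_Ncount[OF locfin_pole_indicator[OF assms(1)] assms(2)])
  fix t :: real
  have "{a. (if is_pole f a then 1 else 0) \<noteq> (0::nat) \<and> norm a \<le> t} = {a. is_pole f a \<and> norm a \<le> t}"
    by auto
  then show "distinct_pole_count f t = (\<Sum>a | (if is_pole f a then 1 else 0) \<noteq> (0::nat) \<and> norm a \<le> t. if is_pole f a then 1 else 0)"
    by (simp add: distinct_pole_count_def)
qed

text \<open>The nonvanishing of L_c(z,f) excludes a genuine solution: for f = exp, c = 2 pi i and
  coefficients with sum 0, the equation reads exp(z)^m = p(z), and this p has no zeros. In the proof
  it makes the numerator \<open>X\<close> a nonzero entire function.\<close>

theorem theorem3p1:
  fixes \<tau> m n :: nat and c :: complex and a :: "nat \<Rightarrow> complex"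
    and f p q :: "complex \<Rightarrow> complex"
  assumes "\<tau> \<ge> 1" and "c \<noteq> 0" and "a \<tau> \<noteq> 0"
    and "transcendental_meromorphic f" and "meromorphic_order f < \<infinity>"
    and "\<not> (\<forall>\<^sub>\<approx>z\<in>UNIV. shift_op \<tau> a c f z = 0)"
    and "m > 0" and "n > 0" and "m \<ge> (\<tau> + 1) * (n + 2) + 2"
    and "p meromorphic_on UNIV"
    and "small_wrt (\<lambda>r. nevanlinna_Nbar r (\<lambda>z. 1 / p z)) f"
    and "q meromorphic_on UNIV" and "\<not> (\<forall>\<^sub>\<approx>z\<in>UNIV. q z = 0)"
    and "small_wrt (\<lambda>r. nevanlinna_T r q) f"
  shows "\<not> (\<forall>\<^sub>\<approx>z\<in>UNIV. f z ^ m + q z * shift_op \<tau> a c f z ^ n = p z)"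
proof
  assume eq: "\<forall>\<^sub>\<approx>z\<in>UNIV. f z ^ m + q z * shift_op \<tau> a c f z ^ n = p z"
  have fm: "f meromorphic_on UNIV"
    and irr: "\<And>P Q :: complex poly. Q \<noteq> 0 \<Longrightarrow> \<not> (\<forall>\<^sub>\<approx>z\<in>UNIV. f z = poly P z / poly Q z)"
    using assms(4) by (auto simp: transcendental_meromorphic_def)
  have f0: "\<not> (\<forall>\<^sub>\<approx>z\<in>UNIV. f z = 0)" using irr[of 1 0] by simp
  obtain g h where gh: "coprime_entire g h" and fgh: "\<forall>\<^sub>\<approx>z\<in>UNIV. f z = g z / h z"
    and fp: "\<forall>z. is_pole f z \<longleftrightarrow> h z = 0" "\<forall>z. is_pole f z \<longrightarrow> nat (- zorder f z) = zord h z"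
    by (rule meromorphic_quotient_of_entire[OF fm f0])
  obtain q1 q2 where q12: "coprime_entire q1 q2" and qq: "\<forall>\<^sub>\<approx>z\<in>UNIV. q z = q1 z / q2 z"
    and qp: "\<forall>z. is_pole q z \<longleftrightarrow> q2 z = 0" "\<forall>z. is_pole q z \<longrightarrow> nat (- zorder q z) = zord q2 z"
    by (rule meromorphic_quotient_of_entire[OF assms(12,13)])
  interpret F: coprime_entire g h by fact
  interpret Q: coprime_entire q1 q2 by fact
  obtain Cf where "\<forall>r>0. nevanlinna_T r f = F.D r + Cf"
    by (rule nevanlinna_T_eq[OF gh fgh fp])
  then have Cf: "nevanlinna_T r f = F.D r + Cf" if "r > 0" for r using that by blast
  obtain Cq where "\<forall>r>0. nevanlinna_T r q = Q.D r + Cq"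
    by (rule nevanlinna_T_eq[OF q12 qq qp])
  then have Cq: "nevanlinna_T r q = Q.D r + Cq" if "r > 0" for r using that by blast

  \<comment> \<open>Transcendence enters through ln r = o(D(r)), which makes the O(ln r) errors of
    the second main theorem negligible.\<close>
  have logD: "eventually (\<lambda>r. C * ln r < F.D r) at_top" for C
  proof (rule ccontr)
    assume "\<not> ?thesis"
    then have "\<exists>r\<ge>x. F.D r \<le> C * ln r" for x
      unfolding eventually_at_top_linorder by (meson not_le)
    then obtain P R :: "complex poly" where PR: "R \<noteq> 0" "\<forall>\<^sub>\<approx>z\<in>UNIV. g z / h z = poly P z / poly R z"
      using F.rational_if_log_growth by blast
    have "\<forall>\<^sub>\<approx>z\<in>UNIV. f z = poly P z / poly R z"
      using fgh PR(2) by eventually_elim simp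
    then show False using irr[OF PR(1)] by blast
  qed

  define X where "X = F.shift_num \<tau> a c"
  define Y where "Y = F.shift_den \<tau> c"
  have L: "eventually (\<lambda>z. shift_op \<tau> a c f z = X z / Y z) (at z0)" for z0
    unfolding X_def Y_def by (rule F.eventually_shift_op_eq[OF fgh])
  have Y: "entire_nz Y" unfolding Y_def by (rule F.entire_nz_shift_den)
  have X: "entire_nz X"
  proof (rule ccontr)
    assume "\<not> entire_nz X"
    then have X0: "X z = 0" for z using not_entire_nz F.shift_num_holomorphic unfolding X_def by blast
    have "\<forall>\<^sub>\<approx>z\<in>UNIV. shift_op \<tau> a c f z = 0"
      unfolding eventually_cosparse_UNIV
    proof
      fix z0 show "eventually (\<lambda>z. shift_op \<tau> a c f z = 0) (at z0)"
        using L[of z0] by eventually_elim (simp add: X0)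
    qed
    with assms(6) show False by blast
  qed
  define A where "A = (\<lambda>z. g z ^ m * q2 z * Y z ^ n)"
  define B where "B = (\<lambda>z. h z ^ m * q1 z * X z ^ n)"
  have AB: "entire_nz A" "entire_nz B"
    unfolding A_def B_def by (intro entire_nz_mult entire_nz_power F.g F.h Q.g Q.h X Y)+
  have Peq: "eventually (\<lambda>z. A z + B z = p z * (h z ^ m * q2 z * Y z ^ n)) (at z0)" for z0
  proof -
    have "eventually (\<lambda>z. f z ^ m + q z * shift_op \<tau> a c f z ^ n = p z) (at z0)"
      "eventually (\<lambda>z. f z = g z / h z) (at z0)" "eventually (\<lambda>z. q z = q1 z / q2 z) (at z0)"
      using eq fgh qq unfolding eventually_cosparse_UNIV by blast+
    then show ?thesis
      using L[of z0] entire_nz_eventually[OF F.h, of z0] entire_nz_eventually[OF Q.h, of z0] entire_nz_eventually[OF Y, of z0]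
    proof eventually_elim
      case (elim z)
      have "p z = (g z / h z) ^ m + q1 z / q2 z * (X z / Y z) ^ n"
        using elim(1) unfolding elim(2-4) by simp
      then show ?case
        using elim(5-7) unfolding A_def B_def by (simp add: power_divide field_simps)
    qed
  qed
  define ip :: "complex \<Rightarrow> nat" where "ip = (\<lambda>b. if is_pole (\<lambda>z. 1 / p z) b then 1 else 0)"
  have pm: "(\<lambda>z. 1 / p z) meromorphic_on UNIV" by (intro meromorphic_intros assms)
  have ip: "locfin ip" unfolding ip_def by (rule locfin_pole_indicator[OF pm])
  \<comment> \<open>Zeros of \<open>A\<close> are zeros of \<open>g\<close>, \<open>q2\<close> or
    \<open>Y\<close>; those of \<open>B\<close> are zeros of \<open>h\<close>, \<open>q1\<close> or
    \<open>X\<close>; and zeros of \<open>h\<close> are zeros of \<open>Y\<close>. For the remaining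
    zeros of A + B the hypothesis controls only distinct zeros of \<open>p\<close>, hence the
    indicator \<open>ip\<close>.\<close>
  define \<nu> where "\<nu> = (\<lambda>b. zord g b + (zord Y b + (zord X b + (zord q1 b + (zord q2 b + ip b)))))"
  have \<nu>: "locfin \<nu>"
    unfolding \<nu>_def by (intro locfin_add locfin_zord F.g Q.g Q.h X Y ip)
  have trunc: "1 \<le> \<nu> b" if P: "entire_nz (\<lambda>z. A z + B z)" and b: "A b = 0 \<or> B b = 0 \<or> A b + B b = 0" for b
  proof (rule ccontr)
    assume "\<not> 1 \<le> \<nu> b"
    then have "zord g b = 0" "zord Y b = 0" "zord X b = 0" "zord q1 b = 0" "zord q2 b = 0" "ip b = 0"
      by (auto simp: \<nu>_def)
    then have nz: "g b \<noteq> 0" "Y b \<noteq> 0" "X b \<noteq> 0" "q1 b \<noteq> 0" "q2 b \<noteq> 0" and np: "\<not> is_pole (\<lambda>z. 1 / p z) b"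
      using zord_pos_iff[OF F.g, of b] zord_pos_iff[OF Y, of b] zord_pos_iff[OF X, of b]
        zord_pos_iff[OF Q.g, of b] zord_pos_iff[OF Q.h, of b] by (auto simp: ip_def split: if_splits)
    have hb: "h b \<noteq> 0" using nz(2) F.shift_den_zero[of b \<tau> c] by (auto simp: Y_def)
    \<comment> \<open>At a zero of A + B where none of the other factors vanishes, E / (A + B) has a
      pole and equals 1/p nearby, so \<open>ip\<close> is 1 after all.\<close>
    define E where "E = (\<lambda>z. h z ^ m * q2 z * Y z ^ n)"
    have E: "entire_nz E" unfolding E_def by (intro entire_nz_mult entire_nz_power F.h Q.h Y)
    have Eb: "E b \<noteq> 0" using hb nz by (simp add: E_def)
    have Pb: "A b + B b = 0" using b hb nz by (auto simp: A_def B_def)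
    have cont: "isCont G b" if "entire_nz G" for G
      using holomorphic_on_imp_continuous_on[OF entire_nz_holomorphic[OF that, of UNIV]]
      by (simp add: continuous_on_eq_continuous_at)
    have "filterlim (\<lambda>z. A z + B z) (at 0) (at b)"
      unfolding filterlim_at using cont[OF P] Pb entire_nz_eventually[OF P, of b] by (auto simp: isCont_def)
    then have "is_pole (\<lambda>z. E z / (A z + B z)) b"
      by (intro is_pole_divide cont[OF E] Eb)
    moreover have "eventually (\<lambda>z. E z / (A z + B z) = 1 / p z) (at b)"
      using Peq[of b] entire_nz_eventually[OF E, of b] entire_nz_eventually[OF P, of b]
      by eventually_elim (simp add: E_def)
    ultimately show False using np is_pole_cong[OF _ refl] by metis
  qed

  obtain K where K: "eventually (\<lambda>r. nevanlinna_T r f \<le> r ^ K) at_top"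
    using poly_growth_if_finite_order[OF assms(5)] by metis
  obtain Ep where Ep: "finite_log_measure Ep"
    "\<And>\<epsilon>. \<epsilon> > 0 \<Longrightarrow> eventually (\<lambda>r. r \<notin> Ep \<longrightarrow> \<bar>nevanlinna_Nbar r (\<lambda>z. 1 / p z)\<bar> \<le> \<epsilon> * \<bar>nevanlinna_T r f\<bar>) at_top"
    using small_wrtD[OF assms(11)] by blast
  obtain Eq where Eq: "finite_log_measure Eq"
    "\<And>\<epsilon>. \<epsilon> > 0 \<Longrightarrow> eventually (\<lambda>r. r \<notin> Eq \<longrightarrow> \<bar>nevanlinna_T r q\<bar> \<le> \<epsilon> * \<bar>nevanlinna_T r f\<bar>) at_top"
    using small_wrtD[OF assms(14)] by blast
  have Tpos: "eventually (\<lambda>r. nevanlinna_T r f \<ge> 0 \<and> F.D r \<ge> 1) at_top"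
    using logD[of "\<bar>Cf\<bar> + 1"] eventually_gt_at_top[of "exp 1"]
  proof eventually_elim
    case (elim r)
    have r: "r > 0" using elim(2) exp_gt_zero[of "1::real"] by linarith
    have "ln (exp 1) \<le> ln r" using elim by (intro ln_mono) auto
    then have "(\<bar>Cf\<bar> + 1) * 1 \<le> (\<bar>Cf\<bar> + 1) * ln r" by (intro mult_left_mono) auto
    then show ?case using elim(1) Cf[OF r] by auto
  qed
  have growthF: "poly_growth K F.D"
  proof (rule poly_growthI[OF F.D_mono])
    show "eventually (\<lambda>r. F.D r \<le> (1 + \<bar>Cf\<bar>) * r ^ K) at_top"
      using K eventually_ge_at_top[of 1]
    proof eventually_elim
      case (elim r)
      have "\<bar>Cf\<bar> * 1 \<le> \<bar>Cf\<bar> * r ^ K" using elim by (intro mult_left_mono one_le_power) auto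
      then show ?case using elim(1) Cf[of r] elim(2) by (simp add: distrib_right)
    qed
  qed
  \<comment> \<open>T(r,q) is controlled only off \<open>Eq\<close>. Every [r, 2r] with large
    \<open>r\<close> contains a radius off \<open>Eq\<close>, and monotonicity of \<open>Q.D\<close>
    carries the bound back to \<open>r\<close> at the cost of a factor 2^K.\<close>
  have growthQ: "poly_growth K Q.D"
  proof (rule poly_growthI[OF Q.D_mono])
    obtain x1 where x1: "\<And>x. x \<ge> x1 \<Longrightarrow> \<exists>y\<in>{x..2*x}. y \<notin> Eq"
      using finite_log_measure_avoid[OF Eq(1)] by metis
    have "eventually (\<lambda>r. (r \<notin> Eq \<longrightarrow> \<bar>nevanlinna_T r q\<bar> \<le> 1 * \<bar>nevanlinna_T r f\<bar>) \<and>
        nevanlinna_T r f \<le> r ^ K \<and> nevanlinna_T r f \<ge> 0) at_top"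
      using Eq(2)[OF zero_less_one] K Tpos by eventually_elim auto
    then obtain x2 where x2: "\<And>r. r \<ge> x2 \<Longrightarrow> (r \<notin> Eq \<longrightarrow> \<bar>nevanlinna_T r q\<bar> \<le> 1 * \<bar>nevanlinna_T r f\<bar>) \<and>
        nevanlinna_T r f \<le> r ^ K \<and> nevanlinna_T r f \<ge> 0"
      by (auto simp: eventually_at_top_linorder)
    show "eventually (\<lambda>r. Q.D r \<le> (2 ^ K + \<bar>Cq\<bar>) * r ^ K) at_top"
      using eventually_ge_at_top[of "max 1 (max x1 x2)"]
    proof eventually_elim
      case (elim r)
      then obtain y where y: "y \<in> {r..2*r}" "y \<notin> Eq" using x1[of r] by auto
      have "Q.D r \<le> Q.D y" using elim y by (intro Q.D_mono) auto
      also have "\<dots> \<le> nevanlinna_T y q + \<bar>Cq\<bar>" using Cq[of y] elim y by auto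
      also have "nevanlinna_T y q \<le> y ^ K" using x2[of y] y elim by auto
      also have "\<dots> \<le> (2 * r) ^ K" using y elim by (intro power_mono) auto
      finally have 1: "Q.D r \<le> 2 ^ K * r ^ K + \<bar>Cq\<bar>" by (simp add: power_mult_distrib)
      have "\<bar>Cq\<bar> * 1 \<le> \<bar>Cq\<bar> * r ^ K" using elim by (intro mult_left_mono one_le_power) auto
      then show ?case using 1 by (simp add: distrib_right)
    qed
  qed
  define MXY where "MXY = (\<lambda>r. circ_mean r (\<lambda>z. max (lnorm X z) (lnorm Y z)))"
  define S where "S = ln (1 + (\<Sum>j\<le>\<tau>. norm (a j)))"
  have MXY: "MXY r \<le> S + (\<Sum>j\<le>\<tau>. circ_mean r (\<lambda>z. F.u (z + of_nat j * c)))" if "r > 0" for r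
    using F.circ_mean_shift_num_den_le[OF X[unfolded X_def] that] by (simp add: MXY_def S_def X_def Y_def)
  have growthXY: "poly_growth K MXY"
  proof (rule poly_growth_mono)
    show "poly_growth K (\<lambda>r. S + (\<Sum>j\<le>\<tau>. circ_mean r (\<lambda>z. F.u (z + of_nat j * c))))"
      by (intro poly_growth_add poly_growth_const poly_growth_sum F.poly_growth_shift_mean growthF)
  qed (use MXY in auto)
  obtain C where C: "\<And>r. r \<ge> 1 \<Longrightarrow> F.D r \<le> C * r ^ K" "\<And>r. r \<ge> 1 \<Longrightarrow> Q.D r \<le> C * r ^ K"
    "\<And>r. r \<ge> 1 \<Longrightarrow> MXY r \<le> C * r ^ K"
    using poly_growth_common_constant[OF growthF growthQ growthXY] by metis

  obtain C1 where C1: "\<And>r. r \<ge> 1 \<Longrightarrow> real m * F.D r \<le> Ncount \<nu> r + Q.D r + real n * MXY r + C1 * (1 + ln r)"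
  proof (rule power_sum_equation_inequality[OF gh q12 X Y C[unfolded MXY_def] \<nu>, of m n])
    show "1 \<le> \<nu> b" if "entire_nz (\<lambda>z. g z ^ m * q2 z * Y z ^ n + h z ^ m * q1 z * X z ^ n)"
      "g b ^ m * q2 b * Y b ^ n = 0 \<or> h b ^ m * q1 b * X b ^ n = 0 \<or>
       g b ^ m * q2 b * Y b ^ n + h b ^ m * q1 b * X b ^ n = 0" for b
      using that trunc[of b] unfolding A_def B_def by blast
    fix C1 assume "\<And>r. 1 \<le> r \<Longrightarrow> real m * F.D r \<le> Ncount \<nu> r + Q.D r + real n * circ_mean r (\<lambda>z. max (lnorm X z) (lnorm Y z)) + C1 * (1 + ln r)"
    then show thesis by (intro that[of C1]) (simp add: MXY_def)
  qed

  obtain c1 where c1: "\<And>r. r > 0 \<Longrightarrow> Ncount (zord g) r \<le> F.D r + c1" "c1 \<ge> 0"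
    using F.Ncount_le_D by metis
  obtain c2 where c2: "\<And>r. r > 0 \<Longrightarrow> Ncount (zord q1) r \<le> Q.D r + c2" "\<And>r. r > 0 \<Longrightarrow> Ncount (zord q2) r \<le> Q.D r + c2" "c2 \<ge> 0"
    using Q.Ncount_le_D by metis
  obtain cX where cX: "\<And>r. r > 0 \<Longrightarrow> circ_mean r (lnorm X) = Ncount (zord X) r + cX"
    using jensen[OF X] by metis
  obtain cY where cY: "\<And>r. r > 0 \<Longrightarrow> circ_mean r (lnorm Y) = Ncount (zord Y) r + cY"
    using jensen[OF Y] by metis
  have NXY: "Ncount (zord X) r \<le> MXY r - cX" "Ncount (zord Y) r \<le> MXY r - cY" if r: "r > 0" for r
  proof -
    have i: "circ_int r (\<lambda>z. max (lnorm X z) (lnorm Y z))" by (intro circ_int_max circ_int_lnorm X Y r)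
    have "circ_mean r (lnorm X) \<le> MXY r" "circ_mean r (lnorm Y) \<le> MXY r" unfolding MXY_def
      using circ_mean_mono[OF r circ_int_lnorm[OF X r] i finite.emptyI]
        circ_mean_mono[OF r circ_int_lnorm[OF Y r] i finite.emptyI] by simp_all
    then show "Ncount (zord X) r \<le> MXY r - cX" "Ncount (zord Y) r \<le> MXY r - cY"
      using cX[OF r] cY[OF r] by linarith+
  qed
  \<comment> \<open>\<open>MXY\<close> occurs n + 2 times: n times through the powers of
    \<open>X\<close> and \<open>Y\<close>, and twice through their zeros. Each occurrence costs
    \<tau> + 1 translated means.\<close>
  define N where "N = real (n + 2) * real (\<tau> + 1)"
  have N: "N \<ge> 1" "N + 2 \<le> real m"
  proof -
    have "(\<tau> + 1) * (n + 2) \<ge> 1" by simp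
    then have "real ((\<tau> + 1) * (n + 2)) \<ge> 1" by linarith
    then show "N \<ge> 1" unfolding N_def by (simp only: of_nat_mult mult.commute)
    have "real ((\<tau> + 1) * (n + 2) + 2) \<le> real m" using assms(9) by (simp only: of_nat_le_iff)
    then show "N + 2 \<le> real m" unfolding N_def by (simp only: of_nat_add of_nat_mult mult.commute)
  qed
  \<comment> \<open>One factor 1 + \<epsilon> comes from translation and one from slow growth. Their
    product is at most 1 + 3\<epsilon>, and 3 N \<epsilon> = 1/4.\<close>
  define \<epsilon> where "\<epsilon> = 1 / (12 * N)"
  have \<epsilon>: "\<epsilon> > 0" "\<epsilon> \<le> 1" using N by (auto simp: \<epsilon>_def divide_simps)
  have N\<epsilon>: "N * ((1 + \<epsilon>) * (1 + \<epsilon>)) \<le> N + 1 / 4"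
  proof -
    have "\<epsilon> * \<epsilon> \<le> 1 * \<epsilon>" using \<epsilon> by (intro mult_right_mono) auto
    then have "(1 + \<epsilon>) * (1 + \<epsilon>) \<le> 1 + 3 * \<epsilon>" by (simp add: algebra_simps)
    then have "N * ((1 + \<epsilon>) * (1 + \<epsilon>)) \<le> N * (1 + 3 * \<epsilon>)" using N by (intro mult_left_mono) auto
    also have "\<dots> = N + 1 / 4" using N by (simp add: \<epsilon>_def field_simps)
    finally show ?thesis .
  qed
  define \<sigma> where "\<sigma> = real \<tau> * norm c + 1"
  have \<sigma>: "\<sigma> > 0" unfolding \<sigma>_def by (intro add_nonneg_pos) auto
  obtain KU where KU: "eventually (\<lambda>r. (\<Sum>j\<le>\<tau>. circ_mean r (\<lambda>z. F.u (z + of_nat j * c)))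
      \<le> real (\<tau> + 1) * ((1 + \<epsilon>) * F.D (r + \<sigma>)) + KU) at_top"
    unfolding \<sigma>_def by (rule F.shift_means_le[OF \<epsilon>(1)])
  define C3 where "C3 = real (n + 2) * \<bar>S + KU\<bar> + c1 + 2 * c2 + \<bar>cX\<bar> + \<bar>cY\<bar> + \<bar>Cf\<bar> + 3 * \<bar>Cq\<bar>"
  have C3: "C3 \<ge> 0" using c1(2) c2(3) by (simp add: C3_def)
  \<comment> \<open>\<open>Q.D\<close> occurs three times, once directly and twice through the zeros
    of \<open>q1\<close> and \<open>q2\<close>. So the share 1/24 for \<open>q\<close> and 1/8 for
    \<open>p\<close> add up to T/4. The radius 3 ensures ln r >= 1, which lets constants be absorbed
    into multiples of ln r.\<close>
  have "eventually (\<lambda>r. r \<ge> 3 \<and> F.D r \<ge> 1 \<and> nevanlinna_T r f \<ge> 0 \<and> 4 * (C3 + 2 * \<bar>C1\<bar>) * ln r < F.D r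
      \<and> (r \<notin> Ep \<longrightarrow> \<bar>nevanlinna_Nbar r (\<lambda>z. 1 / p z)\<bar> \<le> 1/8 * \<bar>nevanlinna_T r f\<bar>)
      \<and> (r \<notin> Eq \<longrightarrow> \<bar>nevanlinna_T r q\<bar> \<le> 1/24 * \<bar>nevanlinna_T r f\<bar>)
      \<and> (\<Sum>j\<le>\<tau>. circ_mean r (\<lambda>z. F.u (z + of_nat j * c))) \<le> real (\<tau> + 1) * ((1 + \<epsilon>) * F.D (r + \<sigma>)) + KU) at_top"
    using eventually_ge_at_top[of 3] Tpos logD[of "4 * (C3 + 2 * \<bar>C1\<bar>)"] Ep(2)[of "1/8"] Eq(2)[of "1/24"] KU
    by (auto simp: eventually_conj_iff elim: eventually_mono)
  then obtain x0 where x0: "\<And>r. r \<ge> x0 \<Longrightarrow> r \<ge> 3 \<and> F.D r \<ge> 1 \<and> nevanlinna_T r f \<ge> 0 \<and> 4 * (C3 + 2 * \<bar>C1\<bar>) * ln r < F.D r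
      \<and> (r \<notin> Ep \<longrightarrow> \<bar>nevanlinna_Nbar r (\<lambda>z. 1 / p z)\<bar> \<le> 1/8 * \<bar>nevanlinna_T r f\<bar>)
      \<and> (r \<notin> Eq \<longrightarrow> \<bar>nevanlinna_T r q\<bar> \<le> 1/24 * \<bar>nevanlinna_T r f\<bar>)
      \<and> (\<Sum>j\<le>\<tau>. circ_mean r (\<lambda>z. F.u (z + of_nat j * c))) \<le> real (\<tau> + 1) * ((1 + \<epsilon>) * F.D (r + \<sigma>)) + KU"
    by (auto simp: eventually_at_top_linorder)
  have "eventually (\<lambda>r. F.D r \<ge> 1) at_top" using Tpos by eventually_elim simp
  \<comment> \<open>Slow growth occurs at arbitrarily large radii off a given exceptional set, so
    with the union of \<open>Ep\<close> and \<open>Eq\<close> one radius satisfies every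
    requirement.\<close>
  from slow_growth_outside_exceptional_set[OF finite_log_measure_Un[OF Ep(1) Eq(1)] F.continuous_D F.D_mono C(1) this \<sigma> \<epsilon>(1)]
  obtain r where r: "r \<ge> x0" "r \<notin> Ep" "r \<notin> Eq" "F.D (r + \<sigma>) \<le> (1 + \<epsilon>) * F.D r" by blast
  define d where "d = F.D r"
  note rr = x0[OF r(1)]
  have r0: "r > 0" "r \<ge> 1" using rr by auto
  have ln1: "ln r \<ge> 1"
  proof -
    have "exp 1 \<le> r" using exp_le rr by (meson order_trans)
    then have "ln (exp 1) \<le> ln r" by (intro ln_mono) auto
    then show ?thesis by simp
  qed
  define T where "T = nevanlinna_T r f"
  have T: "T = d + Cf" "T \<ge> 0" "d \<ge> 1" using Cf[OF r0(1)] rr by (auto simp: T_def d_def)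
  have q: "Q.D r \<le> 1/24 * T + \<bar>Cq\<bar>"
  proof -
    have "\<bar>nevanlinna_T r q\<bar> \<le> 1/24 * \<bar>T\<bar>" using rr r(3) unfolding T_def by blast
    then show ?thesis using T(2) Cq[OF r0(1)] by linarith
  qed
  have Nip: "Ncount ip r \<le> 1/8 * T"
  proof -
    have "\<bar>nevanlinna_Nbar r (\<lambda>z. 1 / p z)\<bar> \<le> 1/8 * \<bar>T\<bar>" using rr r(2) unfolding T_def by blast
    then show ?thesis
      using T(2) nevanlinna_Nbar_eq_Ncount[OF pm r0(1)] unfolding ip_def by linarith
  qed
  have M: "real (n + 2) * MXY r \<le> (N + 1/4) * d + real (n + 2) * \<bar>S + KU\<bar>"
  proof -
    have "MXY r \<le> S + (real (\<tau> + 1) * ((1 + \<epsilon>) * F.D (r + \<sigma>)) + KU)"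
      using MXY[OF r0(1)] rr by linarith
    also have "real (\<tau> + 1) * ((1 + \<epsilon>) * F.D (r + \<sigma>)) \<le> real (\<tau> + 1) * ((1 + \<epsilon>) * ((1 + \<epsilon>) * d))"
      using r(4) \<epsilon> unfolding d_def by (intro mult_left_mono) auto
    finally have "MXY r \<le> real (\<tau> + 1) * ((1 + \<epsilon>) * ((1 + \<epsilon>) * d)) + \<bar>S + KU\<bar>" by linarith
    then have "real (n + 2) * MXY r \<le> real (n + 2) * (real (\<tau> + 1) * ((1 + \<epsilon>) * ((1 + \<epsilon>) * d)) + \<bar>S + KU\<bar>)"
      by (intro mult_left_mono) auto
    also have "\<dots> = N * ((1 + \<epsilon>) * (1 + \<epsilon>)) * d + real (n + 2) * \<bar>S + KU\<bar>"
      unfolding N_def by (simp only: distrib_left mult_ac)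
    also have "N * ((1 + \<epsilon>) * (1 + \<epsilon>)) * d \<le> (N + 1/4) * d"
      using N\<epsilon> T(3) by (intro mult_right_mono) auto
    finally show ?thesis by simp
  qed
  have N\<nu>: "Ncount \<nu> r = Ncount (zord g) r + (Ncount (zord Y) r + (Ncount (zord X) r + (Ncount (zord q1) r + (Ncount (zord q2) r + Ncount ip r))))"
    unfolding \<nu>_def by (simp add: Ncount_add locfin_add locfin_zord F.g Q.g Q.h X Y ip)
  have "C1 * (1 + ln r) \<le> \<bar>C1\<bar> * (2 * ln r)"
    using ln1 by (intro mult_mono) auto
  moreover have "C3 \<le> C3 * ln r" using C3 ln1 mult_left_mono[of 1 "ln r" C3] by simp
  ultimately have small: "C3 + C1 * (1 + ln r) \<le> d / 4"
    using rr unfolding d_def by (simp add: algebra_simps)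
  have n2: "real n * MXY r + (MXY r + MXY r) = real (n + 2) * MXY r" by (simp add: algebra_simps)
  define L where "L = C1 * (1 + ln r)"
  define V where "V = real n * MXY r"
  have "real m * d \<le> Ncount \<nu> r + Q.D r + V + L"
    using C1[OF r0(2)] by (simp only: L_def V_def d_def)
  moreover have "Ncount \<nu> r \<le> d + c1 + (MXY r - cY) + (MXY r - cX) + 2 * (Q.D r + c2) + 1/8 * T"
  proof -
    have "Ncount \<nu> r \<le> (d + c1) + ((MXY r - cY) + ((MXY r - cX) + ((Q.D r + c2) + ((Q.D r + c2) + 1/8 * T))))"
      unfolding N\<nu> by (intro add_mono c1(1)[OF r0(1), folded d_def] NXY[OF r0(1)] c2(1,2)[OF r0(1)] Nip)
    then show ?thesis by (simp add: algebra_simps)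
  qed
  moreover have "V + (MXY r + MXY r) \<le> (N + 1/4) * d + real (n + 2) * \<bar>S + KU\<bar>"
    using M n2 by (simp only: V_def)
  moreover have "- cX \<le> \<bar>cX\<bar>" "- cY \<le> \<bar>cY\<bar>" by auto
  moreover have "3 * Q.D r \<le> 1/8 * T + 3 * \<bar>Cq\<bar>" using q by simp
  ultimately have "real m * d \<le> d + (N + 1/4) * d + 1/4 * T + (C3 - \<bar>Cf\<bar>) + L"
    unfolding C3_def by (simp add: algebra_simps)
  then have "real m * d \<le> d + (N + 1/4) * d + 1/4 * T + (C3 - \<bar>Cf\<bar>) + C1 * (1 + ln r)"
    by (simp only: L_def)
  \<comment> \<open>Replacing T by d + Cf costs at most |Cf|, which \<open>C3\<close> holds in
    reserve; the remaining constants and logarithms are at most d/4.\<close>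
  then have "real m * d \<le> d + (N + 1/4) * d + 1/4 * d + d / 4"
    using small T(1) by linarith
  also have "\<dots> = (N + 7/4) * d" by (simp add: algebra_simps)
  also have "\<dots> < (N + 2) * d" using T(3) by (intro mult_strict_right_mono) auto
  also have "\<dots> \<le> real m * d" using N(2) T(3) by (intro mult_right_mono) auto
  finally show False by simp
qed

end
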